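(* Let $\mu$ be a probability measure on $\mathbb R$ and let $c\in\mathbb R$. The following are equivalent. (1) $\mu$ is unimodal with mode $c$. (2) $\operatorname{Im}\big((z-c)G_\mu'(z)\big)\ge0$ for all $z\in\mathbb C^+$. (3) There exists an $\mathbb R$-valued random variable $X$, independent of a uniform random variable $U$ on $(0,1)$, such that $\mu$ is the law of $UX+c$. (4) The following three assertions hold: - $G_\mu$ is univalent in $\mathbb C^+$; - $G_\mu(\mathbb C^+)$ is horizontally convex, namely if $z_1,z_2\in G_\mu(\mathbb C^+)$ have the same imaginary part, then $(1-t)z_1+tz_2\in G_\mu(\mathbb C^+)$ for any $t\in(0,1)$; - there exist points $z_n\in\mathbb C^+$ such that $z_n\to c$ and $\lim_{n\to\infty}\operatorname{Im}(G_\mu(z_n))=\inf_{z\in\mathbb C^+}\operatorname{Im}(G_\mu(z))$.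
   Context: $\mathbb{C}^+=\{z\in\mathbb{C}:\operatorname{Im} z>0\}$; $G_\mu(z)=\int_{\mathbb R}\frac{1}{z-x}\mu(dx)$ for $z\in\mathbb C^+$. Univalent means holomorphic and injective. A Borel measure $\mu$ on $\mathbb R$ is unimodal with mode $c\in\mathbb R$ if there exist a non-decreasing function $f:(-\infty,c)\to[0,\infty)$, a non-increasing function $g:(c,\infty)\to[0,\infty)$ and $\lambda\in[0,\infty]$ such that $\mu(dx)=f(x)\mathbf 1_{(-\infty,c)}(x)\,dx+\lambda\delta_c+g(x)\mathbf 1_{(c,\infty)}(x)\,dx$. *)

theory Defs
  imports "HOL-Probability.Probability" "HOL-Complex_Analysis.Complex_Analysis"
begin

definition upper_half_plane :: "complex set" where
  "upper_half_plane = {z. Im z > 0}"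

definition cauchy_transform :: "real measure \<Rightarrow> complex \<Rightarrow> complex" where
  "cauchy_transform \<mu> z = (LINT x|\<mu>. 1 / (z - complex_of_real x))"

definition univalent_on :: "(complex \<Rightarrow> complex) \<Rightarrow> complex set \<Rightarrow> bool" where
  "univalent_on f S \<longleftrightarrow> f holomorphic_on S \<and> inj_on f S"

definition horizontally_convex :: "complex set \<Rightarrow> bool" where
  "horizontally_convex S \<longleftrightarrow>
     (\<forall>z1\<in>S. \<forall>z2\<in>S. Im z1 = Im z2 \<longrightarrow>
        (\<forall>t::real. 0 < t \<and> t < 1 \<longrightarrow>
           complex_of_real (1 - t) * z1 + complex_of_real t * z2 \<in> S))"

(* f and g are total functions here, but only their values on (-oo, c) and on (c, oo)
   respectively are constrained and used. The mass of the atom is extended-valued. *)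
definition unimodal :: "real measure \<Rightarrow> real \<Rightarrow> bool" where
  "unimodal \<mu> c \<longleftrightarrow>
     sets \<mu> = sets borel \<and>
     (\<exists>(f :: real \<Rightarrow> real) (g :: real \<Rightarrow> real) (m :: ennreal).
        (\<forall>x<c. 0 \<le> f x) \<and> mono_on {..<c} f \<and>
        (\<forall>x>c. 0 \<le> g x) \<and> antimono_on {c<..} g \<and>
        (\<forall>A\<in>sets borel.
           emeasure \<mu> A =
             (\<integral>\<^sup>+x\<in>A. (ennreal (f x) * indicator {..<c} x) \<partial>lborel)
             + m * emeasure (return borel c) A
             + (\<integral>\<^sup>+x\<in>A. (ennreal (g x) * indicator {c<..} x) \<partial>lborel)))"

definition scaled_uniform_on ::
    "'a measure \<Rightarrow> ('a \<Rightarrow> real) \<Rightarrow> ('a \<Rightarrow> real) \<Rightarrow> real measure \<Rightarrow> real \<Rightarrow> bool" where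
  "scaled_uniform_on \<Omega> X U \<mu> c \<longleftrightarrow>
     prob_space \<Omega> \<and>
     prob_space.indep_var \<Omega> borel X borel U \<and>
     distr \<Omega> borel U = uniform_measure lborel {0<..<1} \<and>
     \<mu> = distr \<Omega> borel (\<lambda>\<omega>. U \<omega> * X \<omega> + c)"

(* HOL cannot quantify existentially over the type of the sample space, so the
   type of the sample space is fixed to be the plane. The lemma
   scaled_uniform_lawI shows that this loses nothing: a pair (X, U) on any
   probability space can be replaced by the coordinates under its joint law. *)
definition scaled_uniform_law :: "real measure \<Rightarrow> real \<Rightarrow> bool" where
  "scaled_uniform_law \<mu> c \<longleftrightarrow>
     (\<exists>(\<Omega> :: (real \<times> real) measure) X U. scaled_uniform_on \<Omega> X U \<mu> c)"

lemma scaled_uniform_lawI: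
  fixes \<Omega> :: "'a measure"
  assumes "scaled_uniform_on \<Omega> X U \<mu> c"
  shows "scaled_uniform_law \<mu> c"
proof -
  interpret prob_space \<Omega>
    using assms by (simp add: scaled_uniform_on_def)
  have ind: "indep_var borel X borel U"
    and U: "distr \<Omega> borel U = uniform_measure lborel {0<..<1}"
    and mu: "\<mu> = distr \<Omega> borel (\<lambda>\<omega>. U \<omega> * X \<omega> + c)"
    using assms by (auto simp: scaled_uniform_on_def)
  have [measurable]: "X \<in> borel_measurable \<Omega>" "U \<in> borel_measurable \<Omega>"
    using ind by (auto dest: indep_var_rv1 indep_var_rv2)
  define N where "N = distr \<Omega> (borel \<Otimes>\<^sub>M borel) (\<lambda>\<omega>. (X \<omega>, U \<omega>))"
  interpret N: prob_space N
    unfolding N_def by (rule prob_space_distr) simp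
  have [measurable_cong]: "sets N = sets (borel \<Otimes>\<^sub>M borel)"
    by (simp add: N_def)
  have dist: "distr N borel fst = distr \<Omega> borel X" "distr N borel snd = distr \<Omega> borel U"
    "distr N borel (\<lambda>\<omega>. snd \<omega> * fst \<omega> + c) = \<mu>"
    unfolding N_def mu by (subst distr_distr; simp add: comp_def)+
  have "distr N (borel \<Otimes>\<^sub>M borel) (\<lambda>\<omega>. (fst \<omega>, snd \<omega>)) = N"
    by (simp add: N_def distr_distr comp_def)
  then have "N.indep_var borel fst borel snd"
    using ind unfolding N.indep_var_distribution_eq indep_var_distribution_eq dist
    by (simp add: N_def)
  then have "scaled_uniform_on N fst snd \<mu> c"
    unfolding scaled_uniform_on_def using N.prob_space_axioms dist U by simp
  then show ?thesis
    unfolding scaled_uniform_law_def by blast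
qed

end

(* Write G for the Cauchy transform and take c = 0. The hub of the proof is the scaling inequality
     mu (t I) <= t mu (I)  for t > 1 and all half-open intervals I.

   It holds if mu is unimodal, by substitution. It holds under (2), because (2) says that Im G
   increases along rays from 0, i.e. that t mu dominates the law of X / t after Poisson smoothing,
   and Stieltjes inversion removes the smoothing.

   Conversely it makes (t mu - law (X / t)) / (t - 1) a probability measure nu_t; these are tight as
   t -> 1, a weak limit nu satisfies Im (z G') = - Im G_nu, and the law of U X with X ~ nu has the
   same radial derivative, so it equals mu. For such laws z G'(z) = - G_nu(z), which gives (2) with
   strict inequality, and Fubini's theorem gives the monotone densities.

   Under (4) the sets {- Im G < h} and {- Im G > h} are connected. If an interval I of the positive
   half line has average density below l, Vitali's theorem gives a point a of I above which
   - Im G < pi l; a path to infinity in that set separates 0 from everything to the right of a, so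
   - Im G <= pi l near the axis there and the density is at most l. Thus averages over successive
   intervals decrease, which is the scaling inequality.

   Finally, under (1) and strict (2), every level curve of Im G is a graph r = r(x) over an interval
   of rays through x + i, so Re G maps it onto an interval. *)
theory Submission
  imports Defs "HOL-Real_Asymp.Real_Asymp"
begin

section \<open>The Cauchy transform and Stieltjes inversion\<close>

text \<open>Where nu_t comes from: if mu has a smooth density h, then t mu - law (X / t) has density
  t (h(x) - h(t x)), so nu_t approximates - x h'(x) dx. The finite difference needs no regularity of
  mu: the scaling inequality compares increments of distribution functions, and it says exactly that
  the candidate distribution function of nu_t increases.

  Imaginary parts suffice up to the mixture representation, because Im G determines mu and tends to
  0 along rays; the radial derivative therefore leaves no constant of integration. Strictness
  matters afterwards: it yields univalence, and it makes every ray meet a level curve at most once.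

  Condition (4) speaks about the image of G and says nothing local about mu. Univalence and
  horizontal convexity enter only through connectedness of height sets, and the points z_n only
  through the fact that each nonempty set {- Im G > h} accumulates at 0. Localising on the real line
  requires a point whose small balls all have density at most some l' < l; the gap l - l' absorbs
  the Poisson tail, which is of order y.\<close>

text \<open>This is pi times the Poisson kernel of the upper half-plane. Its average over the
  measure is - Im G, called the height below.\<close>

definition cauchy_height :: "complex \<Rightarrow> real \<Rightarrow> real" where
  "cauchy_height z x = Im z / ((Re z - x)\<^sup>2 + (Im z)\<^sup>2)"

lemma cauchy_height_eq: "cauchy_height z x = - Im (1 / (z - complex_of_real x))"
  by (simp add: cauchy_height_def Im_divide)

lemma cauchy_height_nonneg: "Im z > 0 \<Longrightarrow> 0 \<le> cauchy_height z x"
  by (simp add: cauchy_height_def)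

lemma cauchy_height_pos: "Im z > 0 \<Longrightarrow> 0 < cauchy_height z x"
  by (auto simp: cauchy_height_def intro!: divide_pos_pos add_nonneg_pos)

lemma cauchy_height_le:
  assumes "Im z > 0"
  shows "cauchy_height z x \<le> 1 / Im z"
proof -
  have "Im z / ((Re z - x)\<^sup>2 + (Im z)\<^sup>2) \<le> Im z / (Im z)\<^sup>2"
    using assms by (intro divide_left_mono) (auto intro!: mult_pos_pos add_nonneg_pos)
  then show ?thesis using assms by (simp add: cauchy_height_def power2_eq_square)
qed

lemma continuous_cauchy_height:
  assumes "Im z > 0"
  shows "isCont (cauchy_height z) x"
proof -
  have "(Re z - x)\<^sup>2 + (Im z)\<^sup>2 \<noteq> 0" using assms by (simp add: sum_power2_eq_zero_iff)
  then show ?thesis unfolding cauchy_height_def by (intro continuous_intros) auto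
qed

lemma measurable_cauchy_height [measurable]: "cauchy_height z \<in> borel_measurable borel"
  unfolding cauchy_height_def by measurable

lemma norm_diff_of_real_ge: "\<bar>Im z\<bar> \<le> norm (z - complex_of_real x)"
  using abs_Im_le_cmod[of "z - complex_of_real x"] by simp

context real_distribution
begin

lemma integrable_cauchy_kernel:
  assumes "Im z > 0"
  shows "integrable M (\<lambda>x. 1 / (z - complex_of_real x))"
proof (rule integrable_const_bound[where B = "1 / Im z"])
  have "norm (1 / (z - complex_of_real x)) \<le> 1 / Im z" for x
  proof -
    have "Im z \<le> norm (z - complex_of_real x)" using assms norm_diff_of_real_ge[of z x] by simp
    then show ?thesis using assms
      unfolding norm_divide norm_one by (intro divide_left_mono mult_pos_pos) auto
  qed
  then show "AE x in M. norm (1 / (z - complex_of_real x)) \<le> 1 / Im z" by simp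
qed simp

lemma integrable_cauchy_height: "Im z > 0 \<Longrightarrow> integrable M (cauchy_height z)"
  by (rule integrable_const_bound[where B = "1 / Im z"])
    (auto simp: cauchy_height_le cauchy_height_nonneg)

lemma Im_cauchy_transform:
  assumes "Im z > 0"
  shows "Im (cauchy_transform M z) = - (LINT x|M. cauchy_height z x)"
  unfolding cauchy_transform_def cauchy_height_eq
  using integral_Im[OF integrable_cauchy_kernel[OF assms]] by simp

lemma nn_integral_cauchy_height:
  assumes "Im z > 0"
  shows "(\<integral>\<^sup>+x. ennreal (cauchy_height z x) \<partial>M) = ennreal (- Im (cauchy_transform M z))"
  by (subst nn_integral_eq_integral)
    (auto simp: assms Im_cauchy_transform integrable_cauchy_height cauchy_height_nonneg)

lemma Im_cauchy_transform_neg: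
  assumes "Im z > 0"
  shows "Im (cauchy_transform M z) < 0"
proof -
  have "(LINT x|M. cauchy_height z x) \<noteq> 0"
  proof
    assume "(LINT x|M. cauchy_height z x) = 0"
    then have "AE x in M. cauchy_height z x = 0"
      using integral_nonneg_eq_0_iff_AE[OF integrable_cauchy_height[OF assms]]
      by (simp add: cauchy_height_nonneg assms)
    then have "AE x in M. False"
      by (rule AE_mp) (use cauchy_height_pos[OF assms] in \<open>auto simp: less_le\<close>)
    then show False by simp
  qed
  moreover have "(LINT x|M. cauchy_height z x) \<ge> 0"
    by (simp add: cauchy_height_nonneg assms)
  ultimately show ?thesis using assms by (simp add: Im_cauchy_transform)
qed

lemma Im_cauchy_transform_ge:
  assumes "Im z > 0"
  shows "- Im (cauchy_transform M z) \<le> 1 / Im z"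
proof -
  have "(LINT x|M. cauchy_height z x) \<le> (LINT x|M. 1 / Im z)"
    by (intro integral_mono integrable_cauchy_height) (auto simp: assms cauchy_height_le)
  then show ?thesis using assms prob_space by (simp add: Im_cauchy_transform)
qed

text \<open>Dominated convergence for the difference quotients. With \<open>d\<close> half the
  distance from \<open>z\<close> to the real axis, all points \<open>z + h\<close> with
  \<open>norm h < d\<close> stay at distance at least \<open>d\<close> from the axis, so the
  quotients are bounded by \<open>1 / (d * d)\<close>. The limit is tested on sequences because
  dominated convergence is sequential.\<close>

lemma has_field_derivative_cauchy_transform:
  assumes z: "Im z > 0"
  shows "(cauchy_transform M has_field_derivative (LINT x|M. - 1 / (z - complex_of_real x)\<^sup>2)) (at z)"
proof -
  define d where "d = Im z / 2"
  have d: "d > 0" using z by (simp add: d_def)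
  have near: "d \<le> norm (z + h - complex_of_real x)" if "norm h < d" for h x
  proof -
    have "\<bar>Im h\<bar> < d" using that abs_Im_le_cmod[of h] by linarith
    then have "d \<le> \<bar>Im (z + h)\<bar>" using z unfolding d_def by (simp add: abs_if split: if_splits)
    then show ?thesis using norm_diff_of_real_ge[of "z + h" x] by simp
  qed
  have Im_near: "Im (z + h) > 0" if "norm h < d" for h
    using that abs_Im_le_cmod[of h] z unfolding d_def by (simp add: abs_if split: if_splits)
  have nz: "z + h - complex_of_real x \<noteq> 0" if "norm h < d" for h x
    using near[OF that, of x] d by auto
  have bound: "norm (1 / ((z + h - complex_of_real x) * (z - complex_of_real x))) \<le> 1 / (d * d)"
    if "norm h < d" for h x
  proof -
    have "d * d \<le> norm ((z + h - complex_of_real x) * (z - complex_of_real x))"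
      unfolding norm_mult using near[OF that, of x] near[of 0 x] d
      by (intro mult_mono) auto
    moreover have "d * d > 0" using d by simp
    ultimately show ?thesis unfolding norm_divide norm_one
      by (intro divide_left_mono) (auto intro!: mult_pos_pos simp del: zero_less_norm_iff)
  qed
  have eq: "(cauchy_transform M (z + h) - cauchy_transform M z) / h
      = (LINT x|M. - 1 / ((z + h - complex_of_real x) * (z - complex_of_real x)))"
    if h: "h \<noteq> 0" "norm h < d" for h
  proof -
    have "1 / (z + h - complex_of_real x) - 1 / (z - complex_of_real x)
        = h * (- 1 / ((z + h - complex_of_real x) * (z - complex_of_real x)))" for x
      using nz[OF h(2), of x] nz[of 0 x] d by (simp add: field_simps)
    then have "cauchy_transform M (z + h) - cauchy_transform M z
      = (LINT x|M. h * (- 1 / ((z + h - complex_of_real x) * (z - complex_of_real x))))"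
      unfolding cauchy_transform_def
      by (simp only: Bochner_Integration.integral_diff[OF integrable_cauchy_kernel[OF Im_near[OF h(2)]]
            integrable_cauchy_kernel[OF z], symmetric])
    also have "\<dots> = h * (LINT x|M. - 1 / ((z + h - complex_of_real x) * (z - complex_of_real x)))"
      by (rule integral_mult_right_zero)
    finally show ?thesis by (rule ssubst) (rule nonzero_mult_div_cancel_left[OF h(1)])
  qed
  have ev: "\<forall>\<^sub>F h in at 0. h \<noteq> 0 \<and> norm h < d" 
    using d by (auto simp: eventually_at dist_norm intro!: exI[of _ d])
  have "((\<lambda>h. LINT x|M. - 1 / ((z + h - complex_of_real x) * (z - complex_of_real x)))
      \<longlongrightarrow> (LINT x|M. - 1 / (z - complex_of_real x)\<^sup>2)) (at 0)"
    unfolding tendsto_at_iff_sequentially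
  proof (intro allI impI)
    fix X :: "nat \<Rightarrow> complex" assume "\<forall>i. X i \<in> UNIV - {0}" and X: "X \<longlonglongrightarrow> 0"
    obtain N where N: "\<And>n. n \<ge> N \<Longrightarrow> norm (X n) < d"
      using LIMSEQ_D[OF X d] by auto
    have XN: "(\<lambda>n. X (n + N)) \<longlonglongrightarrow> 0" by (rule LIMSEQ_ignore_initial_segment[OF X])
    have "(\<lambda>n. LINT x|M. - 1 / ((z + X (n + N) - complex_of_real x) * (z - complex_of_real x)))
      \<longlonglongrightarrow> (LINT x|M. - 1 / (z - complex_of_real x)\<^sup>2)"
    proof (rule integral_dominated_convergence[where w = "\<lambda>_. 1 / (d * d)"])
      show "AE x in M. (\<lambda>n. - 1 / ((z + X (n + N) - complex_of_real x) * (z - complex_of_real x)))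
            \<longlonglongrightarrow> - 1 / (z - complex_of_real x)\<^sup>2"
      proof (rule AE_I2)
        fix x
        have "(\<lambda>n. - 1 / ((z + X (n + N) - complex_of_real x) * (z - complex_of_real x)))
            \<longlonglongrightarrow> - 1 / ((z + 0 - complex_of_real x) * (z - complex_of_real x))"
          using nz[of 0 x] d by (intro tendsto_intros XN) auto
        then show "(\<lambda>n. - 1 / ((z + X (n + N) - complex_of_real x) * (z - complex_of_real x)))
            \<longlonglongrightarrow> - 1 / (z - complex_of_real x)\<^sup>2" by (simp add: power2_eq_square)
      qed
      show "AE x in M. norm (- 1 / ((z + X (n + N) - complex_of_real x) * (z - complex_of_real x)))
          \<le> 1 / (d * d)" for n
        using bound[OF N[of "n + N"]] by (simp add: norm_divide)
    qed simp_all
    then show "((\<lambda>h. LINT x|M. - 1 / ((z + h - complex_of_real x) * (z - complex_of_real x))) \<circ> X)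
       \<longlonglongrightarrow> (LINT x|M. - 1 / (z - complex_of_real x)\<^sup>2)"
      unfolding comp_def by (rule LIMSEQ_offset)
  qed
  then have "((\<lambda>h. (cauchy_transform M (z + h) - cauchy_transform M z) / h)
      \<longlongrightarrow> (LINT x|M. - 1 / (z - complex_of_real x)\<^sup>2)) (at 0)"
    by (rule Lim_transform_eventually) (use ev in \<open>auto elim!: eventually_mono simp: eq\<close>)
  then show ?thesis by (simp add: DERIV_def)
qed

lemma holomorphic_cauchy_transform: "cauchy_transform M holomorphic_on upper_half_plane"
  unfolding upper_half_plane_def holomorphic_on_def field_differentiable_def
  using has_field_derivative_cauchy_transform has_field_derivative_at_within by blast

lemma deriv_cauchy_transform:
  "Im z > 0 \<Longrightarrow> deriv (cauchy_transform M) z = (LINT x|M. - 1 / (z - complex_of_real x)\<^sup>2)"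
  by (rule DERIV_imp_deriv) (rule has_field_derivative_cauchy_transform)

lemma cauchy_transform_DERIV:
  "Im z > 0 \<Longrightarrow> (cauchy_transform M has_field_derivative deriv (cauchy_transform M) z) (at z)"
  using has_field_derivative_cauchy_transform deriv_cauchy_transform by metis

end

section \<open>Stieltjes inversion for intervals\<close>

text \<open>For \<open>a < b\<close> this is pi times the mass of the interval with each endpoint
  counted by one half, which is the limit of Poisson integrals over \<open>{a..b}\<close> as the
  height of the segment tends to 0.\<close>

definition interval_mass :: "real measure \<Rightarrow> real \<Rightarrow> real \<Rightarrow> real" where
  "interval_mass M a b = (LINT s|M. pi / 2 * (sgn (b - s) - sgn (a - s)))"

lemma cauchy_height_integral:
  assumes "a \<le> b" "y > 0"
  shows "(\<integral>\<^sup>+x. ennreal (cauchy_height (Complex x y) s) * indicator {a..b} x \<partial>lborel)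
    = ennreal (arctan ((b - s) / y) - arctan ((a - s) / y))"
proof (rule nn_integral_FTC_Icc)
  show "(\<lambda>x. cauchy_height (Complex x y) s) \<in> borel_measurable borel"
    unfolding cauchy_height_def by simp
  fix x
  show "((\<lambda>x. arctan ((x - s) / y)) has_real_derivative cauchy_height (Complex x y) s) (at x)"
  proof -
    have pos: "(x - s)\<^sup>2 + y\<^sup>2 > 0" using assms by (intro add_nonneg_pos) auto
    have "((\<lambda>x. arctan ((x - s) / y)) has_real_derivative 
        inverse (1 + ((x - s) / y)\<^sup>2) * (1 / y)) (at x)"
      using assms by (auto intro!: derivative_eq_intros)
    moreover have "inverse (1 + ((x - s) / y)\<^sup>2) * (1 / y) = y / ((x - s)\<^sup>2 + y\<^sup>2)"
      using assms pos by (simp add: power_divide divide_simps add_eq_0_iff) 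
         (simp add: power2_eq_square algebra_simps)
    ultimately show ?thesis by (simp add: cauchy_height_def)
  qed
qed (use assms in \<open>auto simp: cauchy_height_nonneg\<close>)

lemma tendsto_arctan_scaled:
  assumes "\<And>n. y n > 0" "y \<longlonglongrightarrow> 0"
  shows "(\<lambda>n. arctan (u / y n)) \<longlonglongrightarrow> pi / 2 * sgn u"
proof -
  have inv: "filterlim (\<lambda>n. inverse (y n)) at_top sequentially"
    using assms by (intro filterlim_inverse_at_top) auto
  consider "u = 0" | "u > 0" | "u < 0" by linarith
  then show ?thesis
  proof cases
    case 2
    then have "filterlim (\<lambda>n. u * inverse (y n)) at_top sequentially"
      using inv by (intro filterlim_tendsto_pos_mult_at_top[OF tendsto_const])
    then have "(\<lambda>n. arctan (u * inverse (y n))) \<longlonglongrightarrow> pi / 2"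
      by (rule filterlim_compose[OF tendsto_arctan_at_top])
    then show ?thesis using 2 by (simp add: field_simps)
  next
    case 3
    then have "filterlim (\<lambda>n. u * inverse (y n)) at_bot sequentially"
      using inv by (intro filterlim_tendsto_neg_mult_at_bot[OF tendsto_const])
    then have "(\<lambda>n. arctan (u * inverse (y n))) \<longlonglongrightarrow> - (pi / 2)"
      by (rule filterlim_compose[OF tendsto_arctan_at_bot])
    then show ?thesis using 3 by (simp add: field_simps)
  qed simp
qed

lemma sgn_diff_tendsto_right:
  "(\<lambda>n. sgn (b + inverse (real (Suc n)) - s)) \<longlonglongrightarrow> (if s \<le> b then 1 else -1 :: real)"
proof (cases "s \<le> b")
  case True
  then have "sgn (b + inverse (real (Suc n)) - s) = 1" for n
    by (simp add: sgn_1_pos add_strict_increasing2 diff_less_eq add.commute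
          less_add_same_cancel1 add_pos_nonneg algebra_simps add_increasing2 le_less_trans)
  then show ?thesis using True by simp
next
  case False
  have "(\<lambda>n. b + inverse (real (Suc n)) - s) \<longlonglongrightarrow> b + 0 - s"
    by (intro tendsto_intros LIMSEQ_inverse_real_of_nat)
  then have "\<forall>\<^sub>F n in sequentially. b + inverse (real (Suc n)) - s < 0"
    using False by (intro order_tendstoD) auto
  then have "\<forall>\<^sub>F n in sequentially. sgn (b + inverse (real (Suc n)) - s) = (-1::real)"
    by eventually_elim simp
  then show ?thesis using False by (simp add: tendsto_eventually)
qed

context real_distribution
begin

lemma strip_integral:
  assumes "a \<le> b" "y > 0"
  shows "(\<integral>\<^sup>+x. ennreal (- Im (cauchy_transform M (Complex x y))) * indicator {a..b} x \<partial>lborel)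
    = ennreal (LINT s|M. arctan ((b - s) / y) - arctan ((a - s) / y))"
proof -
  interpret L: pair_sigma_finite lborel M ..
  have le: "arctan ((a - s) / y) \<le> arctan ((b - s) / y)" for s
    using assms by (simp add: arctan_le_iff divide_right_mono)
  have "(\<integral>\<^sup>+x. ennreal (- Im (cauchy_transform M (Complex x y))) * indicator {a..b} x \<partial>lborel)
    = (\<integral>\<^sup>+x. (\<integral>\<^sup>+s. ennreal (cauchy_height (Complex x y) s) * indicator {a..b} x \<partial>M) \<partial>lborel)"
    using assms by (simp add: nn_integral_cauchy_height[symmetric] nn_integral_multc)
  also have "\<dots> = (\<integral>\<^sup>+s. (\<integral>\<^sup>+x. ennreal (cauchy_height (Complex x y) s) * indicator {a..b} x \<partial>lborel) \<partial>M)"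
    by (rule L.Fubini'[symmetric]) (simp add: cauchy_height_def split_beta')
  also have "\<dots> = (\<integral>\<^sup>+s. ennreal (arctan ((b - s) / y) - arctan ((a - s) / y)) \<partial>M)"
    by (simp add: cauchy_height_integral assms)
  also have "\<dots> = ennreal (LINT s|M. arctan ((b - s) / y) - arctan ((a - s) / y))"
  proof (rule nn_integral_eq_integral)
    have "\<bar>arctan ((b - s) / y) - arctan ((a - s) / y)\<bar> \<le> pi" for s
      using arctan_bounded[of "(b - s) / y"] arctan_bounded[of "(a - s) / y"] by (simp add: abs_le_iff)
    then show "integrable M (\<lambda>s. arctan ((b - s) / y) - arctan ((a - s) / y))"
      by (intro integrable_const_bound[where B = pi]) auto
  qed (use le in auto)
  finally show ?thesis .
qed

lemma strip_mass_tendsto: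
  assumes "\<And>n. y n > 0" "y \<longlonglongrightarrow> 0"
  shows "(\<lambda>n. LINT s|M. arctan ((b - s) / y n) - arctan ((a - s) / y n)) \<longlonglongrightarrow> interval_mass M a b"
  unfolding interval_mass_def
proof (rule integral_dominated_convergence[where w = "\<lambda>_. pi"])
  show "AE s in M. (\<lambda>n. arctan ((b - s) / y n) - arctan ((a - s) / y n))
      \<longlonglongrightarrow> pi / 2 * (sgn (b - s) - sgn (a - s))"
    unfolding right_diff_distrib
    by (intro AE_I2 tendsto_intros tendsto_arctan_scaled assms)
  have "\<bar>arctan ((b - s) / y n) - arctan ((a - s) / y n)\<bar> \<le> pi" for s n
    using arctan_bounded[of "(b - s) / y n"] arctan_bounded[of "(a - s) / y n"] by (simp add: abs_le_iff)
  then show "AE s in M. norm (arctan ((b - s) / y n) - arctan ((a - s) / y n)) \<le> pi" for n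
    by simp
qed auto

text \<open>Moving both endpoints to the right by a vanishing amount gives \<open>b\<close> full
  weight and \<open>a\<close> none, so the half weights turn into a half-open interval.\<close>

lemma interval_mass_tendsto:
  assumes "a \<le> b"
  shows "(\<lambda>n. interval_mass M (a + inverse (real (Suc n))) (b + inverse (real (Suc n))))
      \<longlonglongrightarrow> pi * measure M {a<..b}"
proof -
  have "(\<lambda>n. interval_mass M (a + inverse (real (Suc n))) (b + inverse (real (Suc n))))
      \<longlonglongrightarrow> (LINT s|M. pi * indicator {a<..b} s)"
    unfolding interval_mass_def
  proof (rule integral_dominated_convergence[where w = "\<lambda>_. pi"])
    show "AE s in M. (\<lambda>n. pi / 2 * (sgn (b + inverse (real (Suc n)) - s) - sgn (a + inverse (real (Suc n)) - s)))
      \<longlonglongrightarrow> pi * indicator {a<..b} s"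
    proof (rule AE_I2)
      fix s
      have "(\<lambda>n. pi / 2 * (sgn (b + inverse (real (Suc n)) - s) - sgn (a + inverse (real (Suc n)) - s)))
        \<longlonglongrightarrow> pi / 2 * ((if s \<le> b then 1 else -1) - (if s \<le> a then 1 else -1))"
        by (intro tendsto_intros sgn_diff_tendsto_right)
      then show "(\<lambda>n. pi / 2 * (sgn (b + inverse (real (Suc n)) - s) - sgn (a + inverse (real (Suc n)) - s)))
        \<longlonglongrightarrow> pi * indicator {a<..b} s"
        using assms by (auto simp: indicator_def split: if_splits)
    qed
    show "AE s in M. norm (pi / 2 * (sgn (b + inverse (real (Suc n)) - s) - sgn (a + inverse (real (Suc n)) - s))) \<le> pi" for n
      by (intro AE_I2) (auto simp: sgn_if abs_mult)
  qed auto
  then show ?thesis by simp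
qed

lemma interval_mass_ge:
  assumes "a \<le> b"
  shows "pi * measure M {a<..<b} \<le> interval_mass M a b"
proof -
  have "(LINT s|M. pi * indicator {a<..<b} s) \<le> interval_mass M a b"
    unfolding interval_mass_def
  proof (rule integral_mono)
    show "integrable M (\<lambda>s. pi / 2 * (sgn (b - s) - sgn (a - s)))"
      by (rule integrable_const_bound[where B = pi]) (auto simp: sgn_if abs_mult)
    show "pi * indicator {a<..<b} s \<le> pi / 2 * (sgn (b - s) - sgn (a - s))" for s
      using assms by (auto simp: sgn_if indicator_def)
    show "integrable M (\<lambda>s. pi * indicator {a<..<b} s)"
      by (rule integrable_const_bound[where B = pi]) (auto simp: indicator_def)
  qed
  then show ?thesis by simp
qed

text \<open>Integrating the bound over horizontal segments that sink to the axis bounds the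
  half-weighted mass of the interval, which is at least the mass of its interior.\<close>

lemma measure_Ioo_le_of_height_le:
  assumes "a \<le> b" "r > 0" "C \<ge> 0"
    and le: "\<And>x y. a \<le> x \<Longrightarrow> x \<le> b \<Longrightarrow> 0 < y \<Longrightarrow> y < r \<Longrightarrow> - Im (cauchy_transform M (Complex x y)) \<le> C"
  shows "pi * measure M {a<..<b} \<le> C * (b - a)"
proof -
  define y where "y n = r / 2 * inverse (real (Suc n))" for n
  have y: "y n > 0" "y n < r" for n
  proof -
    show "y n > 0" unfolding y_def using \<open>r > 0\<close> by simp
    have "y n \<le> r / 2 * 1" unfolding y_def using \<open>r > 0\<close> by (intro mult_left_mono) (auto simp: field_simps)
    then show "y n < r" using \<open>r > 0\<close> by simp
  qed
  have "(\<lambda>n. r / 2 * inverse (real (Suc n))) \<longlonglongrightarrow> r / 2 * 0"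
    by (intro tendsto_intros LIMSEQ_inverse_real_of_nat)
  then have "y \<longlonglongrightarrow> 0" by (simp add: y_def[abs_def])
  note lim = strip_mass_tendsto[OF y(1) this]
  have "(LINT s|M. arctan ((b - s) / y n) - arctan ((a - s) / y n)) \<le> C * (b - a)" for n
  proof -
    have "ennreal (LINT s|M. arctan ((b - s) / y n) - arctan ((a - s) / y n)) 
       = (\<integral>\<^sup>+x. ennreal (- Im (cauchy_transform M (Complex x (y n)))) * indicator {a..b} x \<partial>lborel)"
      by (rule strip_integral[symmetric]) (use assms y in auto)
    also have "\<dots> \<le> (\<integral>\<^sup>+x. ennreal C * indicator {a..b} x \<partial>lborel)"
      by (intro nn_integral_mono) (auto simp: indicator_def intro!: ennreal_leI le y)
    also have "\<dots> = ennreal (C * (b - a))"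
      using assms by (simp add: nn_integral_cmult_indicator ennreal_mult)
    finally show ?thesis using assms by (subst (asm) ennreal_le_iff) auto
  qed
  then have "interval_mass M a b \<le> C * (b - a)"
    by (intro LIMSEQ_le_const2[OF lim]) auto
  then show ?thesis using interval_mass_ge[OF \<open>a \<le> b\<close>] by linarith
qed

end

text \<open>The inequality is integrated over a horizontal segment, the segment sinks to the axis,
  and finally the endpoints are approached from the right to remove the half weights.\<close>

lemma measure_Ioc_le_of_height_le:
  assumes M: "real_distribution M" and N: "real_distribution N" and "t \<ge> 0" "a \<le> b"
    and le: "\<And>z. Im z > 0 \<Longrightarrow> - Im (cauchy_transform M z) \<le> t * (- Im (cauchy_transform N z))"
  shows "measure M {a<..b} \<le> t * measure N {a<..b}"
proof -
  interpret M: real_distribution M by fact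
  interpret N: real_distribution N by fact
  have *: "interval_mass M a b \<le> t * interval_mass N a b" if "a \<le> b" for a b
  proof -
    define y where "y n = inverse (real (Suc n))" for n
    have y: "y n > 0" for n by (simp add: y_def)
    have y0: "y \<longlonglongrightarrow> 0" unfolding y_def[abs_def] by (rule LIMSEQ_inverse_real_of_nat)
    have "(LINT s|M. arctan ((b - s) / y n) - arctan ((a - s) / y n)) 
       \<le> t * (LINT s|N. arctan ((b - s) / y n) - arctan ((a - s) / y n))" for n
    proof -
      have nonneg: "0 \<le> (LINT s|N. arctan ((b - s) / y n) - arctan ((a - s) / y n))"
        using that y[of n] by (intro Bochner_Integration.integral_nonneg) (simp add: arctan_le_iff divide_right_mono)
      have "ennreal (LINT s|M. arctan ((b - s) / y n) - arctan ((a - s) / y n)) 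
         = (\<integral>\<^sup>+x. ennreal (- Im (cauchy_transform M (Complex x (y n)))) * indicator {a..b} x \<partial>lborel)"
        by (rule M.strip_integral[symmetric]) (use that y in auto)
      also have "\<dots> \<le> (\<integral>\<^sup>+x. ennreal t * (ennreal (- Im (cauchy_transform N (Complex x (y n)))) * indicator {a..b} x) \<partial>lborel)"
        using y[of n] le[of "Complex _ (y n)"] \<open>t \<ge> 0\<close>
        by (intro nn_integral_mono) (auto simp: indicator_def ennreal_mult'[symmetric] intro!: ennreal_leI)
      also have "\<dots> = ennreal t * (\<integral>\<^sup>+x. (ennreal (- Im (cauchy_transform N (Complex x (y n)))) * indicator {a..b} x) \<partial>lborel)"
      proof (rule nn_integral_cmult)
        have "(\<lambda>x. ennreal (- Im (cauchy_transform N (Complex x (y n))))) = 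
          (\<lambda>x. \<integral>\<^sup>+s. ennreal (cauchy_height (Complex x (y n)) s) \<partial>N)"
          using y by (simp add: N.nn_integral_cauchy_height)
        also have "\<dots> \<in> borel_measurable borel"
          by (rule N.borel_measurable_nn_integral) (simp add: cauchy_height_def split_beta')
        finally show "(\<lambda>x. (ennreal (- Im (cauchy_transform N (Complex x (y n)))) * indicator {a..b} x)) \<in> borel_measurable lborel"
          by simp
      qed
      also have "\<dots> = ennreal t * ennreal (LINT s|N. arctan ((b - s) / y n) - arctan ((a - s) / y n))"
        by (subst N.strip_integral) (use that y in auto)
      also have "\<dots> = ennreal (t * (LINT s|N. arctan ((b - s) / y n) - arctan ((a - s) / y n)))"
        using \<open>t \<ge> 0\<close> nonneg by (simp add: ennreal_mult)
      finally show ?thesis using nonneg \<open>t \<ge> 0\<close> by (subst (asm) ennreal_le_iff) auto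
    qed
    then show ?thesis
      by (intro LIMSEQ_le[OF M.strip_mass_tendsto[OF y y0] tendsto_mult[OF tendsto_const N.strip_mass_tendsto[OF y y0]]]) auto
  qed
  have "pi * measure M {a<..b} \<le> t * (pi * measure N {a<..b})"
    using * \<open>a \<le> b\<close>
    by (intro LIMSEQ_le[OF M.interval_mass_tendsto tendsto_mult[OF tendsto_const N.interval_mass_tendsto]]) auto
  then show ?thesis by (simp add: mult.left_commute[of t pi])
qed

text \<open>Comparison in both directions with factor 1 identifies the masses of half-open
  intervals; sending the left endpoint to minus infinity identifies the distribution
  functions.\<close>

lemma real_distribution_eqI_Im_cauchy_transform:
  assumes "real_distribution M" "real_distribution N"
    and eq: "\<And>z. Im z > 0 \<Longrightarrow> Im (cauchy_transform M z) = Im (cauchy_transform N z)"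
  shows "M = N"
proof -
  interpret M: real_distribution M by fact
  interpret N: real_distribution N by fact
  have Ioc: "measure M {a<..b} = measure N {a<..b}" if "a \<le> b" for a b
    using measure_Ioc_le_of_height_le[of M N 1 a b] measure_Ioc_le_of_height_le[of N M 1 a b] assms that
    by simp
  have "cdf M x = cdf N x" for x
  proof -
    have eq: "cdf M x - cdf M (x - real (Suc n)) = cdf N x - cdf N (x - real (Suc n))" for n
      using Ioc[of "x - real (Suc n)" x] M.cdf_diff_eq[of "x - real (Suc n)" x] N.cdf_diff_eq[of "x - real (Suc n)" x] by simp
    have bot: "filterlim (\<lambda>n. x - real (Suc n)) at_bot sequentially"
      by real_asymp
    have "(\<lambda>n. cdf M x - cdf M (x - real (Suc n))) \<longlonglongrightarrow> cdf M x - 0"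
      by (intro tendsto_intros filterlim_compose[OF M.cdf_lim_at_bot bot])
    moreover have "(\<lambda>n. cdf N x - cdf N (x - real (Suc n))) \<longlonglongrightarrow> cdf N x - 0"
      by (intro tendsto_intros filterlim_compose[OF N.cdf_lim_at_bot bot])
    ultimately show ?thesis unfolding eq by (simp add: LIMSEQ_unique)
  qed
  then show ?thesis using cdf_unique[OF assms(1,2)] by blast
qed

section \<open>Scaling inequality and uniform mixtures\<close>

text \<open>Decompositions of a measure are established on sets but applied to Poisson kernels.
  Induction over measurable functions makes the passage, and it also covers a density plus an atom
  of extended weight.\<close>

lemma nn_integral_add_measure:
  assumes sets: "sets K = sets M" "sets L = sets M"
    and eq: "\<And>A. A \<in> sets M \<Longrightarrow> emeasure M A = emeasure K A + emeasure L A"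
    and f: "f \<in> borel_measurable M"
  shows "nn_integral M f = nn_integral K f + nn_integral L f"
proof -
  have sp: "space K = space M" "space L = space M" using sets sets_eq_imp_space_eq by blast+
  have mK: "g \<in> borel_measurable K" and mL: "g \<in> borel_measurable L" if "g \<in> borel_measurable M" for g :: "'a \<Rightarrow> ennreal"
    using that sets measurable_cong_sets by blast+
  show ?thesis
    using f
  proof induction
    case (cong f g)
    have "nn_integral M g = nn_integral M f" "nn_integral K g = nn_integral K f" "nn_integral L g = nn_integral L f"
      using cong.hyps(3) sp by (auto intro!: nn_integral_cong)
    then show ?case using cong.IH by simp
  next
    case (set A)
    then show ?case using eq sets by simp
  next
    case (mult u c)
    note u = mult.hyps(2)
    show ?case
      unfolding nn_integral_cmult[OF u] nn_integral_cmult[OF mK[OF u]] nn_integral_cmult[OF mL[OF u]] mult.IH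
      by (rule distrib_left)
  next
    case (add u v)
    note u = add.hyps(1) and v = add.hyps(3)
    show ?case
      unfolding nn_integral_add[OF v u] nn_integral_add[OF mK[OF v] mK[OF u]] nn_integral_add[OF mL[OF v] mL[OF u]] add.IH
      by (simp only: ac_simps)
  next
    case (seq U)
    have sup: "nn_integral N (SUP i. U i) = (SUP i. nn_integral N (U i))"
      if "\<And>i. U i \<in> borel_measurable N" for N
    proof -
      have "(SUP i. U i) = (\<lambda>x. SUP i. U i x)" by (auto simp: fun_eq_iff image_comp)
      then show ?thesis
        using that nn_integral_monotone_convergence_SUP[OF seq.hyps(3), of N] by simp
    qed
    have inc: "incseq (\<lambda>i. nn_integral N (U i))" for N
      using seq.hyps(3) by (auto simp: incseq_def le_fun_def intro!: nn_integral_mono)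
    have "nn_integral M (SUP i. U i) = (SUP i. nn_integral K (U i) + nn_integral L (U i))"
      by (subst sup[OF seq.hyps(1)]) (simp only: seq.IH)
    also have "\<dots> = (SUP i. nn_integral K (U i)) + (SUP i. nn_integral L (U i))"
      by (rule ennreal_SUP_add[OF inc inc])
    also have "\<dots> = nn_integral K (SUP i. U i) + nn_integral L (SUP i. U i)"
      by (simp only: sup[OF mK[OF seq.hyps(1)]] sup[OF mL[OF seq.hyps(1)]])
    finally show ?case .
  qed
qed

lemma emeasure_add_eqI_Ioc:
  fixes M K L :: "real measure"
  assumes [measurable_cong, simp]: "sets M = sets borel" "sets K = sets borel" "sets L = sets borel"
    and fin: "emeasure M UNIV < \<infinity>"
    and Ioc: "\<And>a b. a \<le> b \<Longrightarrow> emeasure M {a<..b} = emeasure K {a<..b} + emeasure L {a<..b}"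
    and A: "A \<in> sets borel"
  shows "emeasure M A = emeasure K A + emeasure L A"
proof -
  \<comment> \<open>The sum is packaged as one measure, so that uniqueness on the
    intersection-stable half-open intervals applies to it.\<close>
  define S where "S = measure_of UNIV (sets borel) (\<lambda>A. emeasure K A + emeasure L A :: ennreal)"
  have sigma: "sigma_algebra UNIV (sets (borel :: real measure))"
    using sets.sigma_algebra_axioms[of "borel :: real measure"] by simp
  have S_sets: "sets S = sets borel"
    unfolding S_def using sets.sigma_sets_eq[of "borel :: real measure"] by (simp add: sets_measure_of_conv)
  have S: "emeasure S B = emeasure K B + emeasure L B" if "B \<in> sets borel" for B
    unfolding S_def
  proof (rule emeasure_measure_of_sigma[OF sigma])
    show "positive (sets borel) (\<lambda>A. emeasure K A + emeasure L A)" by (simp add: positive_def)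
    show "countably_additive (sets borel) (\<lambda>A. emeasure K A + emeasure L A)"
    proof (rule countably_additiveI)
      fix F :: "nat \<Rightarrow> real set"
      assume "range F \<subseteq> sets borel" "disjoint_family F"
      then show "(\<Sum>i. emeasure K (F i) + emeasure L (F i)) = emeasure K (\<Union> (range F)) + emeasure L (\<Union> (range F))"
        using suminf_emeasure[of F K] suminf_emeasure[of F L]
        by (simp add: suminf_add[symmetric])
    qed
  qed (use that in simp)
  have "M = S"
  proof (rule measure_eqI_generator_eq)
    show "Int_stable (range (\<lambda>(a, b). {a<..b::real}))"
    proof (rule Int_stableI_image)
      fix i j :: "real \<times> real"
      show "\<exists>k\<in>UNIV. (case i of (a, b) \<Rightarrow> {a<..b}) \<inter> (case j of (a, b) \<Rightarrow> {a<..b}) = (case k of (a, b) \<Rightarrow> {a<..b})"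
        by (intro bexI[of _ "(max (fst i) (fst j), min (snd i) (snd j))"]) (auto split: prod.splits)
    qed
    show "range (\<lambda>(a, b). {a<..b::real}) \<subseteq> Pow UNIV" by simp
    show "emeasure M X = emeasure S X" if "X \<in> range (\<lambda>(a, b). {a<..b::real})" for X
    proof -
      obtain a b where X: "X = {a<..b}" using \<open>X \<in> _\<close> by auto
      show ?thesis
      proof (cases "a \<le> b")
        case True then show ?thesis using Ioc[OF True] S[of X] by (simp add: X)
      next
        case False then have "X = {}" by (auto simp: X)
        then show ?thesis by simp
      qed
    qed
    show "sets M = sigma_sets UNIV (range (\<lambda>(a, b). {a<..b::real}))"
      by (simp add: borel_sigma_sets_Ioc)
    show "sets S = sigma_sets UNIV (range (\<lambda>(a, b). {a<..b::real}))"
      by (simp add: borel_sigma_sets_Ioc S_sets)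
    show "range (\<lambda>i::nat. {- real i<..real i}) \<subseteq> range (\<lambda>(a, b). {a<..b::real})" by auto
    show "(\<Union>i::nat. {- real i<..real i}) = UNIV" by (rule UN_Ioc_eq_UNIV)
    show "emeasure M {- real i<..real i} \<noteq> \<infinity>" for i
      using fin emeasure_mono[of "{- real i<..real i}" UNIV M] by (auto simp: top_unique)
  qed
  then show ?thesis using S[OF A] by simp
qed

lemma cauchy_height_scale:
  assumes "t > 0"
  shows "cauchy_height z (x / t) = t * cauchy_height (complex_of_real t * z) x"
proof -
  have "(t * Re z - x)\<^sup>2 + (t * Im z)\<^sup>2 = t\<^sup>2 * ((Re z - x / t)\<^sup>2 + (Im z)\<^sup>2)"
    using assms by (simp add: power2_eq_square field_simps)
  then show ?thesis using assms by (simp add: cauchy_height_def power2_eq_square)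
qed

text \<open>For a density this says that it does not increase along rays from \<open>0\<close>.\<close>
definition subscaling :: "real measure \<Rightarrow> bool" where
  "subscaling M \<longleftrightarrow> (\<forall>t>1. \<forall>a b. a \<le> b \<longrightarrow> measure M {t * a<..t * b} \<le> t * measure M {a<..b})"

context real_distribution
begin

text \<open>By subscaling, \<open>t\<close> times the measure dominates its image under \<open>x \<mapsto> x / t\<close>, and
  the difference has total mass \<open>t - 1\<close>. The normalised difference is a finite-difference version
  of the law of \<open>X\<close> in the representation \<open>U * X\<close>.\<close>
lemma scaling_difference:
  assumes sub: "subscaling M" and t: "t > 1"
  shows "\<exists>N. real_distribution N \<and> (\<forall>z. Im z > 0 \<longrightarrow>
    (t - 1) * Im (cauchy_transform N z) = 
      t * (Im (cauchy_transform M z) - Im (cauchy_transform M (complex_of_real t * z))))"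
proof -
  \<comment> \<open>The law of \<open>x / t\<close> has distribution function
    \<open>cdf M (t * x)\<close>, so this is the distribution function of the normalised
    difference.\<close>
  define H where "H x = (t * cdf M x - cdf M (t * x)) / (t - 1)" for x
  define N where "N = interval_measure H"
  have Hmono: "H x \<le> H y" if "x \<le> y" for x y
  proof (cases "x = y")
    case False
    then have "x < y" using that by simp
    then have "cdf M y - cdf M x = measure M {x<..y}" "cdf M (t * y) - cdf M (t * x) = measure M {t * x<..t * y}"
      using t by (auto intro!: cdf_diff_eq)
    moreover have "measure M {t * x<..t * y} \<le> t * measure M {x<..y}"
      using sub that t unfolding subscaling_def by blast
    ultimately have "t * cdf M x - cdf M (t * x) \<le> t * cdf M y - cdf M (t * y)"
      by (simp add: algebra_simps)
    then show ?thesis using t by (simp add: H_def divide_right_mono)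
  qed simp
  have Hcont: "continuous (at_right a) H" for a
  proof -
    have "(cdf M \<longlongrightarrow> cdf M (t * a)) (at_right (t * a))"
      using cdf_is_right_cont[of "t * a"] by (simp add: continuous_within)
    moreover have "filterlim (\<lambda>x. t * x) (at_right (t * a)) (at_right a)"
      using t by (auto simp: filterlim_at eventually_at_filter intro!: tendsto_eq_intros)
    ultimately have "((\<lambda>x. cdf M (t * x)) \<longlongrightarrow> cdf M (t * a)) (at_right a)"
      by (rule filterlim_compose)
    then show ?thesis unfolding continuous_within H_def 
      using t cdf_is_right_cont[of a, unfolded continuous_within]
      by (intro tendsto_intros) auto
  qed
  have "filterlim (\<lambda>x. t * x) at_bot at_bot" "filterlim (\<lambda>x. t * x) at_top at_top"
    using t by real_asymp+
  then have l: "((\<lambda>x. cdf M (t * x)) \<longlongrightarrow> 0) at_bot" "((\<lambda>x. cdf M (t * x)) \<longlongrightarrow> 1) at_top"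
    using cdf_lim_at_bot cdf_lim_at_top_prob filterlim_compose by blast+
  have "(H \<longlongrightarrow> (t * 0 - 0) / (t - 1)) at_bot" unfolding H_def
    using t by (intro tendsto_intros l cdf_lim_at_bot) auto
  then have Hbot: "(H \<longlongrightarrow> 0) at_bot" by simp
  have "(H \<longlongrightarrow> (t * 1 - 1) / (t - 1)) at_top" unfolding H_def
    using t by (intro tendsto_intros l cdf_lim_at_top_prob) auto
  then have Htop: "(H \<longlongrightarrow> 1) at_top" using t by simp
  have N: "real_distribution N"
    unfolding N_def by (rule real_distribution_interval_measure[OF Hmono Hcont Hbot Htop])
  interpret N: real_distribution N by fact
  define B where "B = distr M borel (\<lambda>x. x / t)"
  have N_Ioc: "measure N {a<..b} = H b - H a" if "a \<le> b" for a b
    unfolding N_def using that Hmono Hcont by (rule measure_interval_measure_Ioc)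
  have B_Ioc: "measure B {a<..b} = measure M {t * a<..t * b}" for a b
  proof -
    have "(\<lambda>x. x / t) -` {a<..b} = {t * a<..t * b}" using t by (auto simp: field_simps)
    then show ?thesis unfolding B_def by (subst measure_distr) auto
  qed
  interpret B: real_distribution B
    unfolding B_def by (intro real_distribution_distr) simp
  have "emeasure (scale_measure (ennreal t) M) A = emeasure (scale_measure (ennreal (t - 1)) N) A + emeasure B A"
    if "A \<in> sets borel" for A
  proof (rule emeasure_add_eqI_Ioc[OF _ _ _ _ _ that])
    show "emeasure (scale_measure (ennreal t) M) UNIV < \<infinity>"
      using emeasure_space_1 by simp
    fix a b :: real assume "a \<le> b"
    have "t * measure M {a<..b} = (t - 1) * measure N {a<..b} + measure B {a<..b}"
    proof (cases "a = b")
      case False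
      then have "a < b" using \<open>a \<le> b\<close> by simp
      then have m: "measure M {a<..b} = cdf M b - cdf M a" "measure M {t * a<..t * b} = cdf M (t * b) - cdf M (t * a)"
        using t by (auto intro!: cdf_diff_eq[symmetric])
      have "(t - 1) * H x = t * cdf M x - cdf M (t * x)" for x using t by (simp add: H_def)
      then have "(t - 1) * (H b - H a) = (t * cdf M b - cdf M (t * b)) - (t * cdf M a - cdf M (t * a))"
        by (simp only: right_diff_distrib)
      then show ?thesis unfolding N_Ioc[OF \<open>a \<le> b\<close>] B_Ioc m by (simp only: right_diff_distrib)
    qed simp
    then show "emeasure (scale_measure (ennreal t) M) {a<..b} =
        emeasure (scale_measure (ennreal (t - 1)) N) {a<..b} + emeasure B {a<..b}"
      using t by (simp add: emeasure_eq_measure N.emeasure_eq_measure B.emeasure_eq_measure ennreal_mult[symmetric]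
          ennreal_plus[symmetric] del: ennreal_plus)
  qed simp_all
  then have add: "(\<integral>\<^sup>+x. f x \<partial>scale_measure (ennreal t) M) = 
      (\<integral>\<^sup>+x. f x \<partial>scale_measure (ennreal (t - 1)) N) + (\<integral>\<^sup>+x. f x \<partial>B)"
    if "f \<in> borel_measurable borel" for f
    using that by (intro nn_integral_add_measure) auto
  show ?thesis
  proof (intro exI[of _ N] conjI N allI impI)
    fix z assume z: "Im z > 0"
    then have tz: "Im (complex_of_real t * z) > 0" using t by simp
    have "ennreal t * ennreal (- Im (cauchy_transform M z)) = 
       ennreal (t - 1) * ennreal (- Im (cauchy_transform N z)) + (\<integral>\<^sup>+x. ennreal (cauchy_height z x) \<partial>B)"
      using add[of "\<lambda>x. ennreal (cauchy_height z x)"] z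
      by (simp add: nn_integral_scale_measure nn_integral_cauchy_height N.nn_integral_cauchy_height)
    also have "(\<integral>\<^sup>+x. ennreal (cauchy_height z x) \<partial>B) = (\<integral>\<^sup>+x. ennreal (cauchy_height z (x / t)) \<partial>M)"
      unfolding B_def by (subst nn_integral_distr) auto
    also have "\<dots> = (\<integral>\<^sup>+x. ennreal t * ennreal (cauchy_height (complex_of_real t * z) x) \<partial>M)"
      using t by (simp add: cauchy_height_scale ennreal_mult')
    also have "\<dots> = ennreal t * ennreal (- Im (cauchy_transform M (complex_of_real t * z)))"
      by (subst nn_integral_cmult) (auto simp: nn_integral_cauchy_height[OF tz])
    finally have eq: "ennreal t * ennreal (- Im (cauchy_transform M z)) =
        ennreal (t - 1) * ennreal (- Im (cauchy_transform N z)) +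
        ennreal t * ennreal (- Im (cauchy_transform M (complex_of_real t * z)))" .
    define a b c where "a = - Im (cauchy_transform M z)" and "b = - Im (cauchy_transform N z)"
      and "c = - Im (cauchy_transform M (complex_of_real t * z))"
    have nonneg: "a \<ge> 0" "b \<ge> 0" "c \<ge> 0"
      using Im_cauchy_transform_neg[OF z] Im_cauchy_transform_neg[OF tz] N.Im_cauchy_transform_neg[OF z]
      by (auto simp: a_def b_def c_def)
    have "ennreal (t * a) = ennreal ((t - 1) * b + t * c)"
      using eq nonneg t unfolding a_def[symmetric] b_def[symmetric] c_def[symmetric]
      by (simp add: ennreal_mult ennreal_plus)
    then have "t * a = (t - 1) * b + t * c"
      using nonneg t by (subst (asm) ennreal_inj) auto
    then show "(t - 1) * Im (cauchy_transform N z) = 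
      t * (Im (cauchy_transform M z) - Im (cauchy_transform M (complex_of_real t * z)))"
      unfolding a_def b_def c_def by (simp add: algebra_simps)
  qed
qed

end

lemma DERIV_Im_radial:
  assumes "(F has_field_derivative D) (at (complex_of_real r * z))"
  shows "((\<lambda>r. Im (F (complex_of_real r * z))) has_real_derivative Im (z * D)) (at r)"
proof -
  have "((\<lambda>r. complex_of_real r * z) has_vector_derivative z) (at r)"
    by (auto intro!: derivative_eq_intros simp: has_vector_derivative_def scaleR_conv_of_real)
  from field_vector_diff_chain_at[OF this assms]
  have "((\<lambda>r. F (complex_of_real r * z)) has_vector_derivative z * D) (at r)" by (simp add: comp_def)
  from bounded_linear.has_vector_derivative[OF bounded_linear_Im this]
  show ?thesis by (simp add: has_real_derivative_iff_has_vector_derivative)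
qed

context real_distribution
begin

lemma DERIV_Im_cauchy_transform_radial:
  assumes "Im z > 0" "r > 0"
  shows "((\<lambda>r. Im (cauchy_transform M (complex_of_real r * z))) has_real_derivative
      Im (z * deriv (cauchy_transform M) (complex_of_real r * z))) (at r)"
  by (rule DERIV_Im_radial) (use assms in \<open>auto intro!: cauchy_transform_DERIV\<close>)

text \<open>Fixes the constant of integration when imaginary parts are compared through their radial
  derivatives.\<close>

lemma Im_cauchy_transform_radial_tendsto_0:
  assumes z: "Im z > 0"
  shows "((\<lambda>r. Im (cauchy_transform M (complex_of_real r * z))) \<longlongrightarrow> 0) at_top"
proof (rule tendsto_sandwich)
  show "\<forall>\<^sub>F r in at_top. - (1 / (r * Im z)) \<le> Im (cauchy_transform M (complex_of_real r * z))"
    using eventually_gt_at_top[of 0]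
  proof eventually_elim
    case (elim r)
    then show ?case using Im_cauchy_transform_ge[of "complex_of_real r * z"] z by simp
  qed
  show "\<forall>\<^sub>F r in at_top. Im (cauchy_transform M (complex_of_real r * z)) \<le> 0"
    using eventually_gt_at_top[of 0]
  proof eventually_elim
    case (elim r)
    then show ?case using Im_cauchy_transform_neg[of "complex_of_real r * z"] z by simp
  qed
  show "((\<lambda>r. - (1 / (r * Im z))) \<longlongrightarrow> 0) at_top" using z by real_asymp
qed simp

section \<open>Tail weights and tightness\<close>

text \<open>The integral of \<open>x^2 / (x^2 + y^2)\<close>, a smooth substitute for the mass
  outside \<open>[-y, y]\<close>. It is written through the transform on the imaginary axis because
  the difference measures are known only through their transforms.\<close>

definition tail_weight :: "real \<Rightarrow> real" where
  "tail_weight y = 1 + y * Im (cauchy_transform M (Complex 0 y))"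

lemma tail_weight_eq:
  assumes "y > 0"
  shows "tail_weight y = (LINT x|M. x\<^sup>2 / (x\<^sup>2 + y\<^sup>2))" "integrable M (\<lambda>x. x\<^sup>2 / (x\<^sup>2 + y\<^sup>2))"
proof -
  have eq: "x\<^sup>2 / (x\<^sup>2 + y\<^sup>2) = 1 - y * cauchy_height (Complex 0 y) x" for x
  proof -
    define s where "s = x\<^sup>2 + y\<^sup>2"
    have "s > 0" unfolding s_def using assms by (intro add_nonneg_pos) auto
    moreover have "x\<^sup>2 = s - y\<^sup>2" by (simp add: s_def)
    ultimately have "x\<^sup>2 / s = 1 - y\<^sup>2 / s" by (simp add: diff_divide_distrib)
    then show ?thesis by (simp add: cauchy_height_def s_def power2_eq_square)
  qed
  have int: "integrable M (cauchy_height (Complex 0 y))" using assms by (intro integrable_cauchy_height) simp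
  show "integrable M (\<lambda>x. x\<^sup>2 / (x\<^sup>2 + y\<^sup>2))" unfolding eq
    using int by (intro Bochner_Integration.integrable_diff integrable_mult_right) auto
  show "tail_weight y = (LINT x|M. x\<^sup>2 / (x\<^sup>2 + y\<^sup>2))"
    unfolding eq tail_weight_def using assms int prob_space
    by (subst Bochner_Integration.integral_diff) (auto simp: Im_cauchy_transform intro!: integrable_mult_right)
qed

text \<open>Where \<open>\<bar>x\<bar> \<ge> y\<close> the integrand of the tail weight is at least
  one half, hence the factor 2.\<close>

lemma measure_tail_le:
  assumes "y > 0"
  shows "measure M {x. \<bar>x\<bar> \<ge> y} \<le> 2 * tail_weight y"
proof -
  have "measure M {x. \<bar>x\<bar> \<ge> y} = (LINT x|M. indicator {x. \<bar>x\<bar> \<ge> y} x)"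
    by simp
  also have "\<dots> \<le> (LINT x|M. 2 * (x\<^sup>2 / (x\<^sup>2 + y\<^sup>2)))"
  proof (rule integral_mono)
    show "integrable M (indicat_real {x. y \<le> \<bar>x\<bar>})"
      by (rule integrable_const_bound[where B = 1]) (auto simp: indicator_def)
    show "integrable M (\<lambda>x. 2 * (x\<^sup>2 / (x\<^sup>2 + y\<^sup>2)))"
      using tail_weight_eq(2)[OF assms] by (rule integrable_mult_right)
    fix x
    show "indicator {x. \<bar>x\<bar> \<ge> y} x \<le> 2 * (x\<^sup>2 / (x\<^sup>2 + y\<^sup>2))"
    proof (cases "\<bar>x\<bar> \<ge> y")
      case True
      then have "y\<^sup>2 \<le> x\<^sup>2" using assms abs_le_square_iff[of y x] by simp
      moreover have "x\<^sup>2 + y\<^sup>2 > 0" using assms by (intro add_nonneg_pos) auto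
      ultimately show ?thesis using True by (simp add: field_simps)
    qed simp
  qed
  also have "\<dots> = 2 * tail_weight y"
    by (simp only: integral_mult_right_zero tail_weight_eq(1)[OF assms])
  finally show ?thesis .
qed

lemma tail_weight_tendsto_0: "(\<lambda>n. tail_weight (real (Suc n))) \<longlonglongrightarrow> 0"
proof -
  have "(\<lambda>n. LINT x|M. x\<^sup>2 / (x\<^sup>2 + (real (Suc n))\<^sup>2)) \<longlonglongrightarrow> (LINT x|M. 0)"
  proof (rule integral_dominated_convergence[where w = "\<lambda>_. 1"])
    show "AE x in M. (\<lambda>n. x\<^sup>2 / (x\<^sup>2 + (real (Suc n))\<^sup>2)) \<longlonglongrightarrow> 0"
      by (intro AE_I2) real_asymp
    have "x\<^sup>2 / (x\<^sup>2 + (real (Suc n))\<^sup>2) \<le> 1" for x n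
      by (rule divide_le_eq_1_pos[THEN iffD2]) (auto intro!: add_nonneg_pos)
    then show "AE x in M. norm (x\<^sup>2 / (x\<^sup>2 + (real (Suc n))\<^sup>2)) \<le> 1" for n by simp
  qed auto
  then show ?thesis by (simp add: tail_weight_eq)
qed

text \<open>The left-hand side is \<open>t - 1\<close> times the tail weight of the difference
  measure, so division by \<open>t - 1\<close> leaves a bound independent of \<open>t\<close>.
  Pointwise, \<open>q - p = (t^2 - 1) * y^2\<close> is at most \<open>3 * (t - 1) * q\<close>
  because \<open>t + 1 \<le> 3 * t^2\<close>; the remaining \<open>t - 1\<close> comes from the
  factor \<open>t\<close> of the first term.\<close>

lemma tail_weight_scaling:
  assumes t: "1 < t" "t \<le> 2" and y: "y > 0"
  shows "(t * tail_weight y - tail_weight (t * y)) \<le> 4 * (t - 1) * tail_weight y"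
proof -
  have ty: "t * y > 0" using assms by simp
  note tw = tail_weight_eq[OF y] tail_weight_eq[OF ty]
  have "t * tail_weight y - tail_weight (t * y) = 
      (LINT x|M. t * (x\<^sup>2 / (x\<^sup>2 + y\<^sup>2)) - x\<^sup>2 / (x\<^sup>2 + (t * y)\<^sup>2))"
    by (subst Bochner_Integration.integral_diff[OF integrable_mult_right[OF tw(2)] tw(4)])
      (simp only: integral_mult_right_zero tw)
  also have "\<dots> \<le> (LINT x|M. 4 * (t - 1) * (x\<^sup>2 / (x\<^sup>2 + y\<^sup>2)))"
  proof (rule integral_mono)
    show "integrable M (\<lambda>x. t * (x\<^sup>2 / (x\<^sup>2 + y\<^sup>2)) - x\<^sup>2 / (x\<^sup>2 + (t * y)\<^sup>2))"
      "integrable M (\<lambda>x. 4 * (t - 1) * (x\<^sup>2 / (x\<^sup>2 + y\<^sup>2)))"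
      using tw by (intro Bochner_Integration.integrable_diff integrable_mult_right; simp)+
    fix x
    define p where "p = x\<^sup>2 + y\<^sup>2"
    define q where "q = x\<^sup>2 + (t * y)\<^sup>2"
    have pq: "p > 0" "q > 0" unfolding p_def q_def using y ty by (auto intro!: add_nonneg_pos)
    have "(t + 1) * y\<^sup>2 \<le> 3 * (t * y)\<^sup>2"
    proof -
      have "t * 1 \<le> t * t" using t by (intro mult_left_mono) auto
      then have "t + 1 \<le> 3 * t\<^sup>2" using t unfolding power2_eq_square by linarith
      then have "(t + 1) * y\<^sup>2 \<le> 3 * t\<^sup>2 * y\<^sup>2" by (intro mult_right_mono) auto
      then show ?thesis by (simp add: power_mult_distrib)
    qed
    then have "(t + 1) * y\<^sup>2 \<le> 3 * q" unfolding q_def by (smt (verit) zero_le_power2)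
    then have "(t - 1) * ((t + 1) * y\<^sup>2) \<le> (t - 1) * (3 * q)" using t by (intro mult_left_mono) auto
    then have "q - p \<le> 3 * (t - 1) * q" unfolding p_def q_def by (simp add: power2_eq_square algebra_simps)
    then have "(q - p) / (p * q) \<le> 3 * (t - 1) * q / (p * q)" using pq by (intro divide_right_mono) auto
    moreover have "(q - p) / (p * q) = 1 / p - 1 / q" using pq by (simp add: field_simps)
    moreover have "3 * (t - 1) * q / (p * q) = 3 * (t - 1) * (1 / p)" using pq by simp
    ultimately have "1 / p - 1 / q \<le> 3 * (t - 1) * (1 / p)" by (simp only:)
    then have "x\<^sup>2 * (1 / p - 1 / q) \<le> x\<^sup>2 * (3 * (t - 1) * (1 / p))" by (intro mult_left_mono) auto
    moreover have "x\<^sup>2 * (1 / p - 1 / q) = x\<^sup>2 / p - x\<^sup>2 / q" by (simp add: right_diff_distrib)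
    moreover have "x\<^sup>2 * (3 * (t - 1) * (1 / p)) = 3 * (t - 1) * (x\<^sup>2 / p)" by simp
    moreover have "t * (x\<^sup>2 / p) - x\<^sup>2 / q = (x\<^sup>2 / p - x\<^sup>2 / q) + (t - 1) * (x\<^sup>2 / p)"
      by (simp only: left_diff_distrib)
    moreover have "4 * (t - 1) * r = 3 * (t - 1) * r + (t - 1) * r" for r
      by (simp add: algebra_simps)
    ultimately have "t * (x\<^sup>2 / p) - x\<^sup>2 / q \<le> 4 * (t - 1) * (x\<^sup>2 / p)" by (metis add_right_mono)
    then show "t * (x\<^sup>2 / (x\<^sup>2 + y\<^sup>2)) - x\<^sup>2 / (x\<^sup>2 + (t * y)\<^sup>2) \<le> 4 * (t - 1) * (x\<^sup>2 / (x\<^sup>2 + y\<^sup>2))"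
      by (simp add: p_def q_def)
  qed
  also have "\<dots> = 4 * (t - 1) * tail_weight y" by (simp only: integral_mult_right_zero tw)
  finally show ?thesis .
qed

end

lemma ex_radial_derivative_distribution:
  assumes "real_distribution M" and sub: "subscaling M"
  shows "\<exists>N. real_distribution N \<and> 
    (\<forall>z. Im z > 0 \<longrightarrow> Im (z * deriv (cauchy_transform M) z) = - Im (cauchy_transform N z))"
proof -
  interpret M: real_distribution M by fact
  define t where "t n = 1 + inverse (real (Suc n))" for n
  have t: "1 < t n" "t n \<le> 2" for n by (auto simp: t_def field_simps)
  obtain N where N: "\<And>n. real_distribution (N n)"
    and Neq: "\<And>n z. Im z > 0 \<Longrightarrow> (t n - 1) * Im (cauchy_transform (N n) z) = 
      t n * (Im (cauchy_transform M z) - Im (cauchy_transform M (complex_of_real (t n) * z)))"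
    using M.scaling_difference[OF sub t(1)] by metis
  \<comment> \<open>Uniform in \<open>n\<close>: this is the estimate that gives tightness.\<close>
  have tail: "real_distribution.tail_weight (N n) y \<le> 4 * M.tail_weight y" if y: "y > 0" for n y
  proof -
    interpret N: real_distribution "N n" by fact
    have "complex_of_real (t n) * Complex 0 y = Complex 0 (t n * y)" by (simp add: complex_eq_iff)
    then have "(t n - 1) * N.tail_weight y = (t n - 1) + y * (t n * (Im (cauchy_transform M (Complex 0 y))
         - Im (cauchy_transform M (Complex 0 (t n * y)))))"
      using Neq[of "Complex 0 y" n] y unfolding N.tail_weight_def
      by (simp add: distrib_left mult.left_commute[of _ y])
    also have "\<dots> = t n * M.tail_weight y - M.tail_weight (t n * y)"
      unfolding M.tail_weight_def by (simp add: algebra_simps)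
    also have "\<dots> \<le> 4 * (t n - 1) * M.tail_weight y"
      by (rule M.tail_weight_scaling[OF t y])
    finally have "(t n - 1) * N.tail_weight y \<le> (t n - 1) * (4 * M.tail_weight y)"
      by (simp only: mult.assoc mult.left_commute)
    then show ?thesis using t(1)[of n] by (subst (asm) mult_le_cancel_left_pos) auto
  qed
  have "tight N"
    unfolding tight_def
  proof (intro conjI allI impI N)
    fix e :: real assume e: "e > 0"
    \<comment> \<open>The factor 8 is 2 from replacing tails by tail weights times 4 from the
      uniform bound.\<close>
    obtain m where "\<forall>n\<ge>m. norm (M.tail_weight (real (Suc n)) - 0) < e / 8"
      using LIMSEQ_D[OF M.tail_weight_tendsto_0, of "e / 8"] e by auto
    then have "norm (M.tail_weight (real (Suc m)) - 0) < e / 8" by blast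
    then have m: "M.tail_weight (real (Suc m)) < e / 8" by (simp only: real_norm_def diff_zero abs_less_iff)
    define y where "y = real (Suc m)"
    have y: "y > 0" by (simp add: y_def)
    have "1 - e < measure (N n) {- y<..y}" for n
    proof -
      interpret N: real_distribution "N n" by fact
      have "measure (N n) {x. \<bar>x\<bar> \<ge> y} \<le> 2 * N.tail_weight y" by (rule N.measure_tail_le[OF y])
      also have "\<dots> \<le> 8 * M.tail_weight y" using tail[OF y, of n] by simp
      also have "\<dots> < e" using m by (simp add: y_def)
      finally have *: "measure (N n) {x. \<bar>x\<bar> \<ge> y} < e" .
      have "1 - measure (N n) {x. \<bar>x\<bar> \<ge> y} = measure (N n) (space (N n) - {x. \<bar>x\<bar> \<ge> y})"
        by (subst N.prob_compl) auto
      also have "\<dots> \<le> measure (N n) {- y<..y}" by (rule N.finite_measure_mono) auto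
      finally show ?thesis using * by simp
    qed
    then show "\<exists>a b. a < b \<and> (\<forall>n. 1 - e < measure (N n) {a<..b})"
      using y by (intro exI[of _ "-y"] exI[of _ y]) auto
  qed
  then obtain r L where r: "strict_mono (r :: nat \<Rightarrow> nat)" and L: "real_distribution L"
    and conv: "weak_conv_m (N \<circ> id \<circ> r) L"
    using tight_imp_convergent_subsubsequence[of N id] by (auto simp: strict_mono_def)
  interpret L: real_distribution L by fact
  show ?thesis
  proof (intro exI[of _ L] conjI L allI impI)
    fix z assume z: "Im z > 0"
    have "(\<lambda>n. LINT x|(N \<circ> id \<circ> r) n. cauchy_height z x) \<longlonglongrightarrow> (LINT x|L. cauchy_height z x)"
    proof (rule weak_conv_imp_integral_bdd_continuous_conv[OF _ L conv])
      show "norm (cauchy_height z x) \<le> 1 / Im z" for x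
        using cauchy_height_le[OF z] cauchy_height_nonneg[OF z] by simp
    qed (use N continuous_cauchy_height[OF z] in auto)
    then have "(\<lambda>n. - Im (cauchy_transform (N (r n)) z)) \<longlonglongrightarrow> - Im (cauchy_transform L z)"
      using z by (simp add: real_distribution.Im_cauchy_transform[OF N] L.Im_cauchy_transform)
    moreover have "(\<lambda>n. - Im (cauchy_transform (N (r n)) z)) \<longlonglongrightarrow> Im (z * deriv (cauchy_transform M) z)"
    proof -
      \<comment> \<open>\<open>Im (cauchy_transform (N (r n)) z)\<close> equals
        \<open>- t (r n)\<close> times the difference quotient of \<open>u\<close> at 1, so its
        limit is minus the radial derivative.\<close>
      define u where "u s = Im (cauchy_transform M (complex_of_real s * z))" for s
      have "(u has_real_derivative Im (z * deriv (cauchy_transform M) z)) (at 1)"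
        using M.DERIV_Im_cauchy_transform_radial[OF z, of 1] by (simp add: u_def[abs_def])
      then have D: "(\<lambda>h. (u (1 + h) - u 1) / h) \<midarrow>0\<rightarrow> Im (z * deriv (cauchy_transform M) z)"
        by (simp add: DERIV_def)
      have h0: "(\<lambda>n. inverse (real (Suc (r n)))) \<longlonglongrightarrow> 0"
        using LIMSEQ_subseq_LIMSEQ[OF LIMSEQ_inverse_real_of_nat r] by (simp add: comp_def)
      have "filterlim (\<lambda>n. inverse (real (Suc (r n)))) (at 0) sequentially"
        using h0 by (simp add: filterlim_at)
      from filterlim_compose[OF D this]
      have "(\<lambda>n. (u (t (r n)) - u 1) / (t (r n) - 1)) \<longlonglongrightarrow> Im (z * deriv (cauchy_transform M) z)"
        by (simp add: t_def)
      moreover have "(\<lambda>n. t (r n)) \<longlonglongrightarrow> 1 + 0"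
        unfolding t_def by (intro tendsto_intros h0)
      ultimately have "(\<lambda>n. t (r n) * ((u (t (r n)) - u 1) / (t (r n) - 1))) \<longlonglongrightarrow> (1 + 0) * Im (z * deriv (cauchy_transform M) z)"
        by (intro tendsto_mult)
      moreover have "t (r n) * ((u (t (r n)) - u 1) / (t (r n) - 1)) = - Im (cauchy_transform (N (r n)) z)" for n
      proof -
        have "(t (r n) - 1) * Im (cauchy_transform (N (r n)) z) = t (r n) * (u 1 - u (t (r n)))"
          using Neq[OF z, of "r n"] by (simp add: u_def)
        then have "Im (cauchy_transform (N (r n)) z) = t (r n) * (u 1 - u (t (r n))) / (t (r n) - 1)"
          using t(1)[of "r n"] by (simp add: field_simps)
        then show ?thesis by (simp add: minus_divide_left right_diff_distrib)
      qed
      ultimately show ?thesis by simp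
    qed
    ultimately show "Im (z * deriv (cauchy_transform M) z) = - Im (cauchy_transform L z)"
      using LIMSEQ_unique by blast
  qed
qed

section \<open>Uniform mixtures and their radial derivative\<close>

definition uniform_mixture :: "real measure \<Rightarrow> real measure" where
  "uniform_mixture N = distr (N \<Otimes>\<^sub>M uniform_measure lborel {0<..<1}) borel (\<lambda>(x, u). u * x)"

lemma prob_space_uniform_unit: "prob_space (uniform_measure lborel {0<..<1::real})"
  by (rule prob_space_uniform_measure) auto

lemma real_distribution_uniform_mixture:
  assumes "real_distribution N"
  shows "real_distribution (uniform_mixture N)"
proof -
  interpret N: real_distribution N by fact
  interpret U: prob_space "uniform_measure lborel {0<..<1::real}" by (rule prob_space_uniform_unit)
  interpret P: pair_prob_space N "uniform_measure lborel {0<..<1::real}" ..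
  show ?thesis unfolding uniform_mixture_def
    by (rule P.real_distribution_distr) measurable
qed

lemma integral_uniform_unit:
  fixes f :: "real \<Rightarrow> 'a::euclidean_space"
  assumes "\<And>x. 0 \<le> x \<Longrightarrow> x \<le> 1 \<Longrightarrow> (F has_vector_derivative f x) (at x within {0..1})"
    and cont: "continuous_on {0..1} f" and [measurable]: "f \<in> borel_measurable borel"
  shows "(LINT u|uniform_measure lborel {0<..<1}. f u) = F 1 - F 0"
proof -
  have "uniform_measure lborel {0<..<1::real} = density lborel (\<lambda>u. ennreal (indicator {0<..<1} u))"
    unfolding uniform_measure_def by (intro density_cong) (auto simp: indicator_def divide_ennreal_def)
  then have "(LINT u|uniform_measure lborel {0<..<1}. f u) = (LINT u|lborel. indicator {0<..<1} u *\<^sub>R f u)"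
    by (simp add: integral_density)
  also have "\<dots> = (LINT u|lborel. indicator {0..1} u *\<^sub>R f u)"
  proof (rule integral_cong_AE)
    show "AE u in lborel. indicator {0<..<1} u *\<^sub>R f u = indicator {0..1} u *\<^sub>R f u"
      using AE_lborel_singleton[of "0::real"] AE_lborel_singleton[of "1::real"]
      by eventually_elim (auto simp: indicator_def)
  qed auto
  also have "\<dots> = F 1 - F 0"
    by (rule integral_FTC_Icc) (use assms in auto)
  finally show ?thesis .
qed

text \<open>In the variable \<open>u\<close>, the function \<open>u / (z * (z - u * x))\<close> is a
  primitive of \<open>1 / (z - u * x)^2\<close> and vanishes at 0. Averaging the differentiated
  kernel over \<open>u\<close> therefore returns the kernel at \<open>x\<close> divided by
  \<open>- z\<close>. Fubini applies because the differentiated kernel is bounded by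
  \<open>1 / (Im z)^2\<close>.\<close>

lemma deriv_cauchy_transform_uniform_mixture:
  assumes N: "real_distribution N" and z: "Im z > 0"
  shows "z * deriv (cauchy_transform (uniform_mixture N)) z = - cauchy_transform N z"
proof -
  interpret N: real_distribution N by fact
  interpret L: real_distribution "uniform_mixture N" by (rule real_distribution_uniform_mixture[OF N])
  interpret U: prob_space "uniform_measure lborel {0<..<1::real}" by (rule prob_space_uniform_unit)
  interpret P: pair_prob_space N "uniform_measure lborel {0<..<1::real}" ..
  have nz: "z - complex_of_real x \<noteq> 0" for x
    using z by (auto simp: complex_eq_iff)
  have nz': "z - complex_of_real u * complex_of_real x \<noteq> 0" for u x
    using nz[of "u * x"] by simp
  have z0: "z \<noteq> 0" using z by auto
  have inner: "(LINT u|uniform_measure lborel {0<..<1}. - 1 / (z - complex_of_real (u * x))\<^sup>2)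
      = - (1 / z) * (1 / (z - complex_of_real x))" for x
  proof -
    have "(LINT u|uniform_measure lborel {0<..<1}. - 1 / (z - complex_of_real (u * x))\<^sup>2)
      = - (complex_of_real 1 / (z * (z - complex_of_real 1 * complex_of_real x)))
         - (- (complex_of_real 0 / (z * (z - complex_of_real 0 * complex_of_real x))))"
    proof (rule integral_uniform_unit)
      fix u :: real
      have "((\<lambda>w. - (w / (z * (z - w * complex_of_real x)))) has_field_derivative 
           - 1 / (z - complex_of_real (u * x))\<^sup>2) (at (complex_of_real u))"
        using z0 nz'[of u x]
        by (auto intro!: derivative_eq_intros simp: divide_simps; simp add: power2_eq_square algebra_simps)
      moreover have "((\<lambda>u. complex_of_real u) has_vector_derivative 1) (at u within {0..1})"
        by (auto intro!: derivative_eq_intros simp: has_vector_derivative_def scaleR_conv_of_real)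
      ultimately show "((\<lambda>u. - (complex_of_real u / (z * (z - complex_of_real u * complex_of_real x))))
          has_vector_derivative - 1 / (z - complex_of_real (u * x))\<^sup>2) (at u within {0..1})"
        using field_vector_diff_chain_within[of complex_of_real 1 u "{0..1}" 
           "\<lambda>w. - (w / (z * (z - w * complex_of_real x)))" "- 1 / (z - complex_of_real (u * x))\<^sup>2"]
        by (auto simp: comp_def intro: has_field_derivative_at_within)
    next
      show "continuous_on {0..1} (\<lambda>u. - 1 / (z - complex_of_real (u * x))\<^sup>2)"
        by (intro continuous_intros ballI) (metis nz power_not_zero)
    qed measurable
    then show ?thesis by simp
  qed
  have "deriv (cauchy_transform (uniform_mixture N)) z 
      = (LINT y|uniform_mixture N. - 1 / (z - complex_of_real y)\<^sup>2)"
    by (rule L.deriv_cauchy_transform[OF z])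
  also have "\<dots> = (LINT p|(N \<Otimes>\<^sub>M uniform_measure lborel {0<..<1}). - 1 / (z - complex_of_real (snd p * fst p))\<^sup>2)"
    unfolding uniform_mixture_def by (subst integral_distr) (auto simp: split_beta')
  also have "\<dots> = (LINT x|N. (LINT u|uniform_measure lborel {0<..<1}. - 1 / (z - complex_of_real (u * x))\<^sup>2))"
  proof -
    have bnd: "norm (- 1 / (z - complex_of_real y)\<^sup>2) \<le> 1 / (Im z)\<^sup>2" for y
    proof -
      have "(Im z)\<^sup>2 \<le> (norm (z - complex_of_real y))\<^sup>2"
        using norm_diff_of_real_ge[of z y] z by (intro power_mono) auto
      then show ?thesis using z nz[of y] unfolding norm_divide norm_power
        by (simp add: frac_le)
    qed
    have "integrable (N \<Otimes>\<^sub>M uniform_measure lborel {0<..<1}) (\<lambda>(x, u). - 1 / (z - complex_of_real (u * x))\<^sup>2)"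
      by (rule P.integrable_const_bound[where B = "1 / (Im z)\<^sup>2"]) (intro AE_I2, simp only: split_beta' bnd, measurable)
    from P.integral_fst'[OF this] show ?thesis by (simp add: split_beta')
  qed
  also have "\<dots> = - (1 / z) * cauchy_transform N z"
    unfolding inner cauchy_transform_def by (rule integral_mult_right_zero)
  finally show ?thesis using z0 by simp
qed

text \<open>The difference of the two imaginary parts is constant along each ray and tends to 0 at
  infinity, hence vanishes; inversion then identifies the measures.\<close>

lemma eq_uniform_mixture_if_subscaling:
  assumes M: "real_distribution M" and sub: "subscaling M"
  shows "\<exists>N. real_distribution N \<and> M = uniform_mixture N"
proof -
  obtain N where N: "real_distribution N"
    and eq: "\<And>z. Im z > 0 \<Longrightarrow> Im (z * deriv (cauchy_transform M) z) = - Im (cauchy_transform N z)"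
    using ex_radial_derivative_distribution[OF assms] by blast
  define L where "L = uniform_mixture N"
  interpret M: real_distribution M by fact
  interpret L: real_distribution L unfolding L_def by (rule real_distribution_uniform_mixture[OF N])
  have "M = L"
  proof (rule real_distribution_eqI_Im_cauchy_transform)
    fix z assume z: "Im z > 0"
    define d where "d r = Im (cauchy_transform M (complex_of_real r * z)) - Im (cauchy_transform L (complex_of_real r * z))" for r
    have D: "(d has_real_derivative 0) (at r)" if r: "r > 0" for r
    proof -
      have rz: "Im (complex_of_real r * z) > 0" using r z by simp
      have "Im (complex_of_real r * z * deriv (cauchy_transform M) (complex_of_real r * z))
         = Im (complex_of_real r * z * deriv (cauchy_transform L) (complex_of_real r * z))"
        using eq[OF rz] deriv_cauchy_transform_uniform_mixture[OF N rz] by (simp add: L_def)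
      then have "Im (z * deriv (cauchy_transform M) (complex_of_real r * z))
         = Im (z * deriv (cauchy_transform L) (complex_of_real r * z))"
        using r by (simp add: mult.assoc)
      then show ?thesis
        using DERIV_diff[OF M.DERIV_Im_cauchy_transform_radial[OF z r] L.DERIV_Im_cauchy_transform_radial[OF z r]]
        by (simp add: d_def[abs_def])
    qed
    have const: "d r = d 1" if "r > 1" for r
      using that D by (intro DERIV_isconst2[of 1 r d r]) (auto intro!: DERIV_continuous_on DERIV_subset[OF D])
    have "(d \<longlongrightarrow> 0 - 0) at_top" unfolding d_def
      by (intro tendsto_intros M.Im_cauchy_transform_radial_tendsto_0 L.Im_cauchy_transform_radial_tendsto_0 z)
    moreover have "(d \<longlongrightarrow> d 1) at_top"
      by (intro tendsto_eventually eventually_mono[OF eventually_gt_at_top[of 1]] const)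
    ultimately have "d 1 = 0" by (metis tendsto_unique trivial_limit_at_top_linorder diff_zero)
    then show "Im (cauchy_transform M z) = Im (cauchy_transform L z)" by (simp add: d_def)
  qed (use M L.real_distribution_axioms in auto)
  then show ?thesis using N by (auto simp: L_def)
qed

section \<open>The scaling inequality from the derivative condition and from unimodality\<close>

lemma subscaling_if_Im_deriv_nonneg:
  assumes M: "real_distribution M"
    and nonneg: "\<And>z. Im z > 0 \<Longrightarrow> Im (z * deriv (cauchy_transform M) z) \<ge> 0"
  shows "subscaling M"
  unfolding subscaling_def
proof (intro allI impI)
  interpret M: real_distribution M by fact
  fix t a b :: real assume t: "1 < t" and ab: "a \<le> b"
  define B where "B = distr M borel (\<lambda>x. x / t)"
  interpret B: real_distribution B
    unfolding B_def by (intro M.real_distribution_distr) simp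
  have "measure B {a<..b} \<le> t * measure M {a<..b}"
  proof (rule measure_Ioc_le_of_height_le[OF B.real_distribution_axioms M _ ab])
    fix z assume z: "Im z > 0"
    then have tz: "Im (complex_of_real t * z) > 0" using t by simp
    have "- Im (cauchy_transform B z) = (LINT x|M. cauchy_height z (x / t))"
      unfolding B.Im_cauchy_transform[OF z] by (simp add: B_def integral_distr)
    also have "\<dots> = t * (- Im (cauchy_transform M (complex_of_real t * z)))"
      using t by (simp add: cauchy_height_scale M.Im_cauchy_transform[OF tz])
    also have "\<dots> \<le> t * (- Im (cauchy_transform M z))"
    proof -
      have "Im (cauchy_transform M (complex_of_real 1 * z)) \<le> Im (cauchy_transform M (complex_of_real t * z))"
      proof (rule DERIV_nonneg_imp_nondecreasing[of 1 t "\<lambda>r. Im (cauchy_transform M (complex_of_real r * z))"])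
        fix r :: real assume r: "1 \<le> r" "r \<le> t"
        then have rz: "Im (complex_of_real r * z) > 0" using z by simp
        have "r * Im (z * deriv (cauchy_transform M) (complex_of_real r * z)) \<ge> 0"
          using nonneg[OF rz] by (simp add: mult.assoc)
        then have "Im (z * deriv (cauchy_transform M) (complex_of_real r * z)) \<ge> 0"
          using r by (simp add: zero_le_mult_iff)
        then show "\<exists>y. ((\<lambda>r. Im (cauchy_transform M (complex_of_real r * z))) has_real_derivative y) (at r) \<and> 0 \<le> y"
          using M.DERIV_Im_cauchy_transform_radial[OF z, of r] r by auto
      qed (use t in simp)
      then show ?thesis using t by simp
    qed
    finally show "- Im (cauchy_transform B z) \<le> t * (- Im (cauchy_transform M z))" .
  qed (use t in simp)
  moreover have "measure B {a<..b} = measure M {t * a<..t * b}"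
  proof -
    have "(\<lambda>x. x / t) -` {a<..b} = {t * a<..t * b}" using t by (auto simp: field_simps)
    then show ?thesis unfolding B_def by (subst measure_distr) auto
  qed
  ultimately show "measure M {t * a<..t * b} \<le> t * measure M {a<..b}" by simp
qed

lemma Im_deriv_uniform_mixture_pos:
  assumes "real_distribution N" "Im z > 0"
  shows "Im (z * deriv (cauchy_transform (uniform_mixture N)) z) > 0"
  using deriv_cauchy_transform_uniform_mixture[OF assms] real_distribution.Im_cauchy_transform_neg[OF assms] by simp

text \<open>Both one-sided densities become one measurable density with value 0 at the mode. Since
  \<open>f\<close> and \<open>g\<close> are monotone only on their half-lines and arbitrary
  elsewhere, measurability is claimed only after cutting off by indicators.\<close>

lemma unimodal_emeasure:
  assumes "unimodal M 0"
  obtains f g m where "\<And>x. x < 0 \<Longrightarrow> 0 \<le> f x" "mono_on {..<0} f" "\<And>x. x > 0 \<Longrightarrow> 0 \<le> g x" "antimono_on {0<..} g"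
    "\<And>A. A \<in> sets borel \<Longrightarrow> emeasure M A = 
        (\<integral>\<^sup>+x. (ennreal (f x) * indicator {..<0} x + ennreal (g x) * indicator {0<..} x) * indicator A x \<partial>lborel)
        + m * indicator A (0::real)"
    "(\<lambda>x. ennreal (f x) * indicator {..<0::real} x + ennreal (g x) * indicator {0<..} x) \<in> borel_measurable borel"
proof -
  obtain f g :: "real \<Rightarrow> real" and m :: ennreal where fg: "\<And>x. x < 0 \<Longrightarrow> 0 \<le> f x" "mono_on {..<0} f" "\<And>x. x > 0 \<Longrightarrow> 0 \<le> g x" "antimono_on {0<..} g"
    and em: "\<And>A. A \<in> sets borel \<Longrightarrow> emeasure M A = 
      (\<integral>\<^sup>+x\<in>A. (ennreal (f x) * indicator {..<0} x) \<partial>lborel)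
             + m * emeasure (return borel 0) A
             + (\<integral>\<^sup>+x\<in>A. (ennreal (g x) * indicator {0<..} x) \<partial>lborel)"
    using assms unfolding unimodal_def by blast
  have "f \<in> borel_measurable (restrict_space borel {..<0})"
    using fg(2) by (intro borel_measurable_mono_on_fnc)
  then have "(\<lambda>x. ennreal (f x)) \<in> borel_measurable (restrict_space borel {..<0})" by simp
  then have mf: "(\<lambda>x. ennreal (f x) * indicator {..<0} x) \<in> borel_measurable borel"
    by (subst (asm) borel_measurable_restrict_space_iff_ennreal) auto
  have "mono_on {0<..} (\<lambda>x. - g x)"
    using fg(4) by (auto simp: monotone_on_def)
  then have "(\<lambda>x. - g x) \<in> borel_measurable (restrict_space borel {0<..})"
    by (intro borel_measurable_mono_on_fnc)
  then have "(\<lambda>x. - (- g x)) \<in> borel_measurable (restrict_space borel {0<..})"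
    by (rule borel_measurable_uminus)
  then have "(\<lambda>x. ennreal (g x)) \<in> borel_measurable (restrict_space borel {0<..})" by simp
  then have mg: "(\<lambda>x. ennreal (g x) * indicator {0<..} x) \<in> borel_measurable borel"
    by (subst (asm) borel_measurable_restrict_space_iff_ennreal) auto
  show ?thesis
  proof (rule that[OF fg])
    show "(\<lambda>x. ennreal (f x) * indicator {..<0::real} x + ennreal (g x) * indicator {0<..} x) \<in> borel_measurable borel"
      using mf mg by (rule borel_measurable_add)
    fix A :: "real set" assume A: "A \<in> sets borel"
    have "(\<integral>\<^sup>+x. (ennreal (f x) * indicator {..<0} x + ennreal (g x) * indicator {0<..} x) * indicator A x \<partial>lborel)
      = (\<integral>\<^sup>+x\<in>A. (ennreal (f x) * indicator {..<0} x) \<partial>lborel) + (\<integral>\<^sup>+x\<in>A. (ennreal (g x) * indicator {0<..} x) \<partial>lborel)"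
      unfolding distrib_right using mf mg A by (intro nn_integral_add) auto
    then show "emeasure M A = 
        (\<integral>\<^sup>+x. (ennreal (f x) * indicator {..<0} x + ennreal (g x) * indicator {0<..} x) * indicator A x \<partial>lborel)
        + m * indicator A (0::real)"
      using em[OF A] A by (simp add: ac_simps)
  qed
qed

lemma subscaling_if_unimodal:
  assumes M: "real_distribution M" and "unimodal M 0"
  shows "subscaling M"
  unfolding subscaling_def
proof (intro allI impI)
  interpret M: real_distribution M by fact
  fix t a b :: real assume t: "1 < t" and ab: "a \<le> b"
  obtain f g m where fg: "\<And>x. x < 0 \<Longrightarrow> 0 \<le> f x" "mono_on {..<0} f" "\<And>x. x > 0 \<Longrightarrow> 0 \<le> g x" "antimono_on {0<..} g"
    and em: "\<And>A. A \<in> sets borel \<Longrightarrow> emeasure M A = 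
        (\<integral>\<^sup>+x. (ennreal (f x) * indicator {..<0} x + ennreal (g x) * indicator {0<..} x) * indicator A x \<partial>lborel)
        + m * indicator A (0::real)"
    and meas: "(\<lambda>x. ennreal (f x) * indicator {..<0::real} x + ennreal (g x) * indicator {0<..} x) \<in> borel_measurable borel"
    using unimodal_emeasure[OF \<open>unimodal M 0\<close>] by blast
  define h where "h x = ennreal (f x) * indicator {..<0::real} x + ennreal (g x) * indicator {0<..} x" for x
  \<comment> \<open>Multiplication by \<open>t > 1\<close> moves a nonzero point away from the mode
    without changing its side.\<close>
  have h: "h (t * x) \<le> h x" for x
  proof -
    consider "x = 0" | "x < 0" | "x > 0" by linarith
    then show ?thesis
    proof cases
      case 2
      then have "t * x \<le> x" "t * x < 0" using t by (auto simp: mult_le_cancel_right1 mult_less_0_iff)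
      then have "f (t * x) \<le> f x" using fg(2) 2 by (auto simp: monotone_on_def)
      then show ?thesis using 2 \<open>t * x < 0\<close> by (simp add: h_def ennreal_leI)
    next
      case 3
      then have "x \<le> t * x" "t * x > 0" using t by (auto simp: mult_le_cancel_right1)
      then have "g (t * x) \<le> g x" using fg(4) 3 by (auto simp: monotone_on_def)
      then show ?thesis using 3 \<open>t * x > 0\<close> by (simp add: h_def ennreal_leI)
    qed (simp add: h_def)
  qed
  have [measurable]: "h \<in> borel_measurable borel" using meas by (simp add: h_def[abs_def])
  have "emeasure M {t * a<..t * b} = (\<integral>\<^sup>+x. h x * indicator {t * a<..t * b} x \<partial>lborel) + m * indicator {t * a<..t * b} 0"
    by (subst em) (auto simp: h_def)
  also have "(\<integral>\<^sup>+x. h x * indicator {t * a<..t * b} x \<partial>lborel) 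
     = ennreal t * (\<integral>\<^sup>+x. h (t * x) * indicator {t * a<..t * b} (t * x) \<partial>lborel)"
    using t by (subst nn_integral_real_affine[where c = t and t = 0]) auto
  also have "\<dots> \<le> ennreal t * (\<integral>\<^sup>+x. h x * indicator {a<..b} x \<partial>lborel)"
    using h t by (intro mult_left_mono nn_integral_mono) (auto simp: indicator_def)
  \<comment> \<open>As \<open>t > 0\<close>, the point 0 lies in both intervals or in neither, and
    \<open>m \<le> t * m\<close>.\<close>
  also have "m * indicator {t * a<..t * b} 0 \<le> ennreal t * (m * indicator {a<..b} (0::real))"
    using t mult_right_mono[of 1 "ennreal t" m]
    by (auto simp: indicator_def zero_less_mult_iff mult_less_0_iff zero_le_mult_iff)
  also have "ennreal t * (\<integral>\<^sup>+x. h x * indicator {a<..b} x \<partial>lborel) + ennreal t * (m * indicator {a<..b} (0::real))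
    = ennreal t * emeasure M {a<..b}"
    by (subst em) (auto simp: h_def distrib_left)
  finally have "ennreal (measure M {t * a<..t * b}) \<le> ennreal (t * measure M {a<..b})"
    using t by (simp add: M.emeasure_eq_measure ennreal_mult add_left_mono add_right_mono)
  then show "measure M {t * a<..t * b} \<le> t * measure M {a<..b}"
    using t by (subst (asm) ennreal_le_iff) auto
qed

section \<open>Scaled uniform laws and densities of uniform mixtures\<close>

lemma real_distribution_scaled_uniform_imp:
  assumes "scaled_uniform_law M 0"
  shows "\<exists>N. real_distribution N \<and> M = uniform_mixture N"
proof -
  obtain W :: "(real \<times> real) measure" and X U where W: "scaled_uniform_on W X U M 0"
    using assms unfolding scaled_uniform_law_def by blast
  then interpret W: prob_space W by (simp add: scaled_uniform_on_def)
  have ind: "W.indep_var borel X borel U"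
    and U: "distr W borel U = uniform_measure lborel {0<..<1}"
    and M: "M = distr W borel (\<lambda>\<omega>. U \<omega> * X \<omega> + 0)"
    using W by (auto simp: scaled_uniform_on_def)
  have [measurable]: "X \<in> borel_measurable W" "U \<in> borel_measurable W"
    using ind by (auto dest: W.indep_var_rv1 W.indep_var_rv2)
  define N where "N = distr W borel X"
  have N: "real_distribution N" unfolding N_def by (rule W.real_distribution_distr) measurable
  have "distr W (borel \<Otimes>\<^sub>M borel) (\<lambda>\<omega>. (X \<omega>, U \<omega>)) = N \<Otimes>\<^sub>M uniform_measure lborel {0<..<1}"
    using ind unfolding W.indep_var_distribution_eq N_def U by simp
  then have "uniform_mixture N = distr (distr W (borel \<Otimes>\<^sub>M borel) (\<lambda>\<omega>. (X \<omega>, U \<omega>))) borel (\<lambda>(x, u). u * x)"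
    by (simp add: uniform_mixture_def)
  also have "\<dots> = M"
    unfolding M by (subst distr_distr) (auto simp: comp_def split_beta')
  finally show ?thesis using N by auto
qed

lemma scaled_uniform_law_uniform_mixture:
  assumes "real_distribution N"
  shows "scaled_uniform_law (uniform_mixture N) 0"
proof -
  interpret N: real_distribution N by fact
  let ?U = "uniform_measure lborel {0<..<1::real}"
  interpret U: prob_space ?U by (rule prob_space_uniform_unit)
  interpret P: pair_prob_space N ?U ..
  have dist: "distr (N \<Otimes>\<^sub>M ?U) borel fst = N" "distr (N \<Otimes>\<^sub>M ?U) borel snd = ?U"
    "distr (N \<Otimes>\<^sub>M ?U) (borel \<Otimes>\<^sub>M borel) (\<lambda>x. (fst x, snd x)) = N \<Otimes>\<^sub>M ?U"
  proof -
    have "distr (N \<Otimes>\<^sub>M ?U) borel fst = distr (N \<Otimes>\<^sub>M ?U) N fst" by (rule distr_cong) auto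
    then show "distr (N \<Otimes>\<^sub>M ?U) borel fst = N" by (simp add: U.distr_pair_fst)
    have "distr (N \<Otimes>\<^sub>M ?U) borel snd = distr (N \<Otimes>\<^sub>M ?U) ?U snd" by (rule distr_cong) auto
    also have "\<dots> = ?U"
    proof (rule measure_eqI)
      fix A assume A: "A \<in> sets (distr (N \<Otimes>\<^sub>M ?U) ?U snd)"
      then have "emeasure (distr (N \<Otimes>\<^sub>M ?U) ?U snd) A = emeasure (N \<Otimes>\<^sub>M ?U) (space N \<times> A)"
        by (subst emeasure_distr) (auto simp: space_pair_measure intro!: arg_cong2[where f = emeasure])
      also have "\<dots> = emeasure ?U A" using A by (subst U.emeasure_pair_measure_Times) (auto simp: N.emeasure_space_1[simplified])
      finally show "emeasure (distr (N \<Otimes>\<^sub>M ?U) ?U snd) A = emeasure ?U A" .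
    qed simp
    finally show "distr (N \<Otimes>\<^sub>M ?U) borel snd = ?U" .
    have "distr (N \<Otimes>\<^sub>M ?U) (borel \<Otimes>\<^sub>M borel) (\<lambda>x. (fst x, snd x)) = distr (N \<Otimes>\<^sub>M ?U) (N \<Otimes>\<^sub>M ?U) (\<lambda>x. x)"
      by (rule distr_cong) (auto intro!: sets_pair_measure_cong)
    then show "distr (N \<Otimes>\<^sub>M ?U) (borel \<Otimes>\<^sub>M borel) (\<lambda>x. (fst x, snd x)) = N \<Otimes>\<^sub>M ?U" by simp
  qed
  have "scaled_uniform_on (N \<Otimes>\<^sub>M ?U) fst snd (uniform_mixture N) 0"
    unfolding scaled_uniform_on_def P.indep_var_distribution_eq dist
    by (auto simp: P.prob_space_axioms uniform_mixture_def split_beta')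
  then show ?thesis unfolding scaled_uniform_law_def by blast
qed

lemma emeasure_uniform_mixture:
  assumes "real_distribution N" and [measurable]: "A \<in> sets borel"
  shows "emeasure (uniform_mixture N) A = (\<integral>\<^sup>+x. (\<integral>\<^sup>+u. indicator A (u * x) * indicator {0<..<1} u \<partial>lborel) \<partial>N)"
proof -
  interpret N: real_distribution N by fact
  let ?U = "uniform_measure lborel {0<..<1::real}"
  interpret U: prob_space ?U by (rule prob_space_uniform_unit)
  have "emeasure (uniform_mixture N) A = (\<integral>\<^sup>+y. indicator A y \<partial>uniform_mixture N)"
    by (simp add: uniform_mixture_def)
  also have "\<dots> = (\<integral>\<^sup>+p. indicator A (snd p * fst p) \<partial>(N \<Otimes>\<^sub>M ?U))"
    unfolding uniform_mixture_def by (subst nn_integral_distr) (auto simp: split_beta')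
  also have "\<dots> = (\<integral>\<^sup>+x. (\<integral>\<^sup>+u. indicator A (u * x) \<partial>?U) \<partial>N)"
    by (subst U.nn_integral_fst[symmetric]) auto
  also have "\<dots> = (\<integral>\<^sup>+x. (\<integral>\<^sup>+u. indicator A (u * x) * indicator {0<..<1} u \<partial>lborel) \<partial>N)"
    by (subst nn_integral_uniform_measure) (auto simp: divide_ennreal_def)
  finally show ?thesis .
qed

text \<open>The density at \<^term>\<open>v\<close> of the law of \<^term>\<open>u * x\<close> with \<^term>\<open>u\<close> uniform on the unit interval.\<close>
definition segment_density :: "real \<Rightarrow> real \<Rightarrow> real" where
  "segment_density v x = (if 0 < v \<and> v < x \<or> x < v \<and> v < 0 then 1 / \<bar>x\<bar> else 0)"

lemma measurable_segment_density [measurable]: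
  "(\<lambda>(v, x). segment_density v x) \<in> borel_measurable (borel \<Otimes>\<^sub>M borel)"
  unfolding segment_density_def split_beta' by measurable

lemma segment_density_integral:
  assumes [measurable]: "A \<in> sets borel" and x: "x \<noteq> 0"
  shows "(\<integral>\<^sup>+u. indicator A (u * x) * indicator {0<..<1} u \<partial>lborel)
    = (\<integral>\<^sup>+v. ennreal (segment_density v x) * indicator A v \<partial>lborel)"
proof -
  have "(\<integral>\<^sup>+v. ennreal (segment_density v x) * indicator A v \<partial>lborel)
     = ennreal \<bar>x\<bar> * (\<integral>\<^sup>+u. ennreal (segment_density (0 + x * u) x) * indicator A (0 + x * u) \<partial>lborel)"
    using x by (intro nn_integral_real_affine) (auto simp: segment_density_def)
  also have "\<dots> = (\<integral>\<^sup>+u. ennreal \<bar>x\<bar> * (ennreal (segment_density (0 + x * u) x) * indicator A (0 + x * u)) \<partial>lborel)"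
    by (rule nn_integral_cmult[symmetric]) (auto simp: segment_density_def)
  also have "\<dots> = (\<integral>\<^sup>+u. indicator A (u * x) * indicator {0<..<1} u \<partial>lborel)"
  proof (intro nn_integral_cong)
    fix u
    have "segment_density (x * u) x = (if 0 < u \<and> u < 1 then 1 / \<bar>x\<bar> else 0)"
      using x unfolding segment_density_def
      by (cases "x > 0") (auto simp: zero_less_mult_iff mult_less_0_iff mult_less_cancel_left1 mult_less_cancel_left2 not_less)
    then show "ennreal \<bar>x\<bar> * (ennreal (segment_density (0 + x * u) x) * indicator A (0 + x * u))
       = indicator A (u * x) * indicator {0<..<1} u"
      using x by (auto simp: indicator_def ennreal_mult[symmetric] mult.commute[of u])
  qed
  finally show ?thesis by simp
qed

text \<open>Given \<open>x \<noteq> 0\<close>, the product is uniform between 0 and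
  \<open>x\<close>, with a density that is monotone on either side of 0. Averaging over
  \<open>N\<close> preserves this, and the mass of \<open>N\<close> at 0 becomes the atom.\<close>

lemma unimodal_uniform_mixture:
  assumes N: "real_distribution N"
  shows "unimodal (uniform_mixture N) 0"
proof -
  interpret N: real_distribution N by fact
  interpret P: pair_sigma_finite lborel N ..
  define h where "h v = (LINT x|N. segment_density v x)" for v
  \<comment> \<open>A nonzero value forces \<open>\<bar>x\<bar> > \<bar>w\<bar>\<close>. Away from
    \<open>v = 0\<close> the kernel is thus bounded, although \<open>1 / \<bar>x\<bar>\<close> may
    fail to be integrable.\<close>
  have bound: "\<bar>segment_density w x\<bar> \<le> 1 / \<bar>v\<bar>" if "v \<noteq> 0" "\<bar>v\<bar> \<le> \<bar>w\<bar>" for v w x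
    using that unfolding segment_density_def by (auto simp: field_simps intro!: divide_left_mono)
  have int: "integrable N (segment_density v)" if "v \<noteq> 0" for v
    using bound[OF that order_refl] by (intro N.integrable_const_bound[where B = "1 / \<bar>v\<bar>"]) (auto simp: segment_density_def)
  have hn: "h v \<ge> 0" for v
    unfolding h_def by (intro Bochner_Integration.integral_nonneg) (simp add: segment_density_def)
  have hnn: "(\<integral>\<^sup>+x. ennreal (segment_density v x) \<partial>N) = ennreal (h v)" if "v \<noteq> 0" for v
    unfolding h_def by (rule nn_integral_eq_integral[OF int[OF that]]) (simp add: segment_density_def)
  have mono: "mono_on {..<0} h"
  proof (rule mono_onI)
    fix v w :: real assume "v \<in> {..<0}" "w \<in> {..<0}" "v \<le> w"
    then show "h v \<le> h w" unfolding h_def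
      by (intro integral_mono int) (auto simp: segment_density_def)
  qed
  have anti: "antimono_on {0<..} h"
  proof (rule monotone_onI)
    fix v w :: real assume "v \<in> {0<..}" "w \<in> {0<..}" "v \<le> w"
    then show "h v \<ge> h w" unfolding h_def
      by (intro integral_mono int) (auto simp: segment_density_def)
  qed
  have mh [measurable]: "(\<lambda>v. \<integral>\<^sup>+x. ennreal (segment_density v x) \<partial>N) \<in> borel_measurable borel"
    by (rule N.borel_measurable_nn_integral) (auto simp: split_beta' segment_density_def)
  have "emeasure (uniform_mixture N) A =
         (\<integral>\<^sup>+x\<in>A. (ennreal (h x) * indicator {..<0} x) \<partial>lborel)
         + emeasure N {0} * emeasure (return borel 0) A
         + (\<integral>\<^sup>+x\<in>A. (ennreal (h x) * indicator {0<..} x) \<partial>lborel)" if A [measurable]: "A \<in> sets borel" for A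
  proof -
    have "emeasure (uniform_mixture N) A = 
       (\<integral>\<^sup>+x. (\<integral>\<^sup>+v. ennreal (segment_density v x) * indicator A v \<partial>lborel) + indicator A 0 * indicator {0} x \<partial>N)"
      unfolding emeasure_uniform_mixture[OF N A]
    proof (intro nn_integral_cong)
      fix x
      show "(\<integral>\<^sup>+u. indicator A (u * x) * indicator {0<..<1} u \<partial>lborel) =
         (\<integral>\<^sup>+v. ennreal (segment_density v x) * indicator A v \<partial>lborel) + indicator A 0 * indicator {0} x"
      proof (cases "x = 0")
        case True
        have "segment_density v 0 = 0" for v by (auto simp: segment_density_def)
        then show ?thesis using True by (simp add: nn_integral_cmult_indicator)
      qed (simp add: segment_density_integral)
    qed
    also have "\<dots> = (\<integral>\<^sup>+x. (\<integral>\<^sup>+v. ennreal (segment_density v x) * indicator A v \<partial>lborel) \<partial>N) + indicator A 0 * emeasure N {0}"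
      by (subst nn_integral_add) (auto simp: nn_integral_cmult segment_density_def split_beta')
    also have "(\<integral>\<^sup>+x. (\<integral>\<^sup>+v. ennreal (segment_density v x) * indicator A v \<partial>lborel) \<partial>N)
       = (\<integral>\<^sup>+v. (\<integral>\<^sup>+x. ennreal (segment_density v x) * indicator A v \<partial>N) \<partial>lborel)"
      by (rule P.Fubini') (auto simp: split_beta' segment_density_def)
    also have "\<dots> = (\<integral>\<^sup>+v. (\<integral>\<^sup>+x. ennreal (segment_density v x) \<partial>N) * indicator A v \<partial>lborel)"
      by (intro nn_integral_cong nn_integral_multc) (auto simp: segment_density_def)
    also have "\<dots> = (\<integral>\<^sup>+v. ennreal (h v) * indicator {..<0} v * indicator A v + ennreal (h v) * indicator {0<..} v * indicator A v \<partial>lborel)"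
    proof (rule nn_integral_cong_AE)
      show "AE v in lborel. (\<integral>\<^sup>+x. ennreal (segment_density v x) \<partial>N) * indicator A v = 
         ennreal (h v) * indicator {..<0} v * indicator A v + ennreal (h v) * indicator {0<..} v * indicator A v"
        using AE_lborel_singleton[of "0::real"]
      proof eventually_elim
        case (elim v)
        then show ?case using hnn[OF elim] by (auto simp: indicator_def)
      qed
    qed
    also have "\<dots> = (\<integral>\<^sup>+v. ennreal (h v) * indicator {..<0} v * indicator A v \<partial>lborel) + 
       (\<integral>\<^sup>+v. ennreal (h v) * indicator {0<..} v * indicator A v \<partial>lborel)"
    proof (rule nn_integral_add)
      have "(\<lambda>v. ennreal (h v) * indicator {..<0} v) = (\<lambda>v. (\<integral>\<^sup>+x. ennreal (segment_density v x) \<partial>N) * indicator {..<0} v)"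
        using hnn by (auto simp: fun_eq_iff indicator_def)
      then have "(\<lambda>v. ennreal (h v) * indicator {..<0} v) \<in> borel_measurable borel" by simp
      then show "(\<lambda>v. ennreal (h v) * indicator {..<0} v * indicator A v) \<in> borel_measurable lborel" by simp
      have "(\<lambda>v. ennreal (h v) * indicator {0<..} v) = (\<lambda>v. (\<integral>\<^sup>+x. ennreal (segment_density v x) \<partial>N) * indicator {0<..} v)"
        using hnn by (auto simp: fun_eq_iff indicator_def)
      then have "(\<lambda>v. ennreal (h v) * indicator {0<..} v) \<in> borel_measurable borel" by simp
      then show "(\<lambda>v. ennreal (h v) * indicator {0<..} v * indicator A v) \<in> borel_measurable lborel" by simp
    qed
    finally show ?thesis using A by (simp add: ac_simps)
  qed
  then show ?thesis
    unfolding unimodal_def using hn mono anti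
    by (auto simp: uniform_mixture_def intro!: exI[of _ h] exI[of _ "emeasure N {0}"])
qed

section \<open>Separation by level sets\<close>

text \<open>A path in \<open>D\<close> between two points of the slice may leave the slice. Its
  first and last points at an intermediate level have the same imaginary part, so the horizontal
  segment between them lies in \<open>D\<close> and replaces the excursion. The factor
  \<open>s\<close> serves upper slices with 1 and lower slices with -1.\<close>

lemma connected_Int_height_gt:
  assumes D: "open D" "connected D" "horizontally_convex D" and s: "s \<noteq> 0"
  shows "connected (D \<inter> {w. s * Im w > c})"
  unfolding connected_iff_connected_component
proof (intro ballI)
  fix w1 w2 assume w: "w1 \<in> D \<inter> {w. s * Im w > c}" "w2 \<in> D \<inter> {w. s * Im w > c}"
  have "path_connected D" using D connected_open_path_connected by blast
  then obtain g where g: "path g" "path_image g \<subseteq> D" "pathstart g = w1" "pathfinish g = w2"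
    using w unfolding path_connected_def by blast
  have gc: "continuous_on {0..1} g" using g(1) by (simp add: path_def)
  define h where "h x = s * Im (g x)" for x
  have hc: "continuous_on {0..1} h" unfolding h_def by (intro continuous_intros gc)
  have h01: "h 0 > c" "h 1 > c" using w g by (auto simp: h_def pathstart_def pathfinish_def)
  \<comment> \<open>The detour runs strictly above \<open>c\<close> and strictly below both ends, so
    it stays in the open slice and the path must cross its level.\<close>
  define c' where "c' = (c + min (h 0) (h 1)) / 2"
  have c': "c < c'" "c' < h 0" "c' < h 1" using h01 by (auto simp: c'_def min_def)
  define K where "K = {x \<in> {0..1}. h x \<le> c'}"
  show "connected_component (D \<inter> {w. s * Im w > c}) w1 w2"
  proof (cases "K = {}")
    case True
    then have "path_image g \<subseteq> D \<inter> {w. s * Im w > c}"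
      using g(2) c' by (force simp: K_def h_def path_image_def)
    moreover have "w1 \<in> path_image g" "w2 \<in> path_image g"
      using g(3,4) by (metis pathstart_in_path_image pathfinish_in_path_image)+
    ultimately show ?thesis
      unfolding connected_component_def using connected_path_image[OF g(1)] by blast
  next
    case False
    have "compact K"
    proof -
      have "closed K" unfolding K_def
        using continuous_closed_preimage[OF hc, of "{..c'}"] by (simp add: vimage_def Int_def)
      moreover have "bounded K" by (rule bounded_subset[of "{0..1}"]) (auto simp: K_def)
      ultimately show ?thesis by (simp add: compact_eq_bounded_closed)
    qed
    then obtain t1 t2 where t1: "t1 \<in> K" "\<And>x. x \<in> K \<Longrightarrow> t1 \<le> x" and t2: "t2 \<in> K" "\<And>x. x \<in> K \<Longrightarrow> x \<le> t2"
      using False compact_attains_inf compact_attains_sup by metis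
    have t01: "0 \<le> t1" "t1 \<le> 1" "0 \<le> t2" "t2 \<le> 1" using t1(1) t2(1) by (auto simp: K_def)
    have "h t1 = c'"
    proof -
      have "\<exists>x. 0 \<le> x \<and> x \<le> t1 \<and> h x = c'"
        using t1(1) c' t01 by (intro IVT2') (auto simp: K_def intro: continuous_on_subset[OF hc])
      then obtain x where "0 \<le> x" "x \<le> t1" "h x = c'" by blast
      moreover then have "x \<in> K" using t01 by (simp add: K_def)
      ultimately show ?thesis using t1(2) by fastforce
    qed
    moreover have "h t2 = c'"
    proof -
      have "\<exists>x. t2 \<le> x \<and> x \<le> 1 \<and> h x = c'"
        using t2(1) c' t01 by (intro IVT') (auto simp: K_def intro: continuous_on_subset[OF hc])
      then obtain x where "t2 \<le> x" "x \<le> 1" "h x = c'" by blast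
      moreover then have "x \<in> K" using t01 by (simp add: K_def)
      ultimately show ?thesis using t2(2) by fastforce
    qed
    ultimately have Im_eq: "Im (g t1) = Im (g t2)" "s * Im (g t1) = c'" using s by (auto simp: h_def)
    have gD: "g t1 \<in> D" "g t2 \<in> D" using g(2) t01 by (auto simp: path_image_def)
    have seg: "closed_segment (g t1) (g t2) \<subseteq> D"
    proof
      fix w assume "w \<in> closed_segment (g t1) (g t2)"
      then obtain u :: real where u: "0 \<le> u" "u \<le> 1" "w = (1 - u) *\<^sub>R g t1 + u *\<^sub>R g t2"
        by (auto simp: in_segment)
      then consider "u = 0" | "u = 1" | "0 < u" "u < 1" by linarith
      then show "w \<in> D"
      proof cases
        case 3
        then show ?thesis using D(3) gD Im_eq(1) unfolding horizontally_convex_def u(3) scaleR_conv_of_real by blast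
      qed (use u gD in auto)
    qed
    have segc: "s * Im w = c'" if "w \<in> closed_segment (g t1) (g t2)" for w
    proof -
      obtain u :: real where "w = (1 - u) *\<^sub>R g t1 + u *\<^sub>R g t2" using \<open>w \<in> _\<close> by (auto simp: in_segment)
      then have "Im w = (1 - u) * Im (g t1) + u * Im (g t1)" using Im_eq by simp
      also have "\<dots> = Im (g t1)" by (simp add: algebra_simps)
      finally show ?thesis using Im_eq by simp
    qed
    \<comment> \<open>The path up to its first visit to level \<open>c'\<close>, the horizontal
      shortcut, and the path after its last visit.\<close>
    define T where "T = g ` {0..t1} \<union> closed_segment (g t1) (g t2) \<union> g ` {t2..1}"
    have "connected T" unfolding T_def
    proof (intro connected_Un connected_continuous_image connected_segment)
      show "g ` {0..t1} \<inter> closed_segment (g t1) (g t2) \<noteq> {}"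
        using t01 by (metis IntI atLeastAtMost_iff empty_iff ends_in_segment(1) imageI order_refl)
      have "g t2 \<in> (g ` {0..t1} \<union> closed_segment (g t1) (g t2)) \<inter> g ` {t2..1}"
        using t01 by auto
      then show "(g ` {0..t1} \<union> closed_segment (g t1) (g t2)) \<inter> g ` {t2..1} \<noteq> {}" by blast
    qed (use t01 in \<open>auto intro: continuous_on_subset[OF gc]\<close>)
    moreover have "T \<subseteq> D \<inter> {w. s * Im w > c}"
    proof -
      have "h x > c" if "x \<in> {0..t1} \<union> {t2..1}" for x
      proof (cases "x \<in> K")
        case True
        then have "x = t1 \<or> x = t2" using t1(2)[OF True] t2(2)[OF True] that by auto
        then show ?thesis using \<open>h t1 = c'\<close> \<open>h t2 = c'\<close> c' by auto
      next
        case False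
        then show ?thesis using that t01 c' by (auto simp: K_def)
      qed
      moreover have "g x \<in> D" if "x \<in> {0..t1} \<union> {t2..1}" for x
        using g(2) that t01 by (auto simp: path_image_def)
      ultimately show ?thesis using seg segc c' unfolding T_def h_def by fastforce
    qed
    moreover have "w1 \<in> T" "w2 \<in> T"
      using g(3,4) t01 by (auto simp: T_def pathstart_def pathfinish_def)
    ultimately show ?thesis unfolding connected_component_def by blast
  qed
qed

text \<open>Univalence makes the image open and the inverse holomorphic, so the continuous inverse
  carries connected slices of the image back to the half-plane.\<close>

lemma connected_height_sets:
  assumes "univalent_on G upper_half_plane" "horizontally_convex (G ` upper_half_plane)" "s \<noteq> 0"
  shows "connected {z \<in> upper_half_plane. s * Im (G z) > c}"
proof -
  have H: "open upper_half_plane" "connected upper_half_plane"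
    unfolding upper_half_plane_def
    by (auto intro: open_halfspace_Im_gt convex_connected convex_halfspace_Im_gt)
  have hol: "G holomorphic_on upper_half_plane" and inj: "inj_on G upper_half_plane"
    using assms by (auto simp: univalent_on_def)
  have "G constant_on upper_half_plane \<Longrightarrow> False"
    using inj_onD[OF inj, of "\<i>" "2 * \<i>"] by (auto simp: constant_on_def upper_half_plane_def)
  then have opn: "open (G ` upper_half_plane)"
    using open_mapping_thm3[OF hol H(1) inj] by blast
  have conn: "connected (G ` upper_half_plane)"
    by (rule connected_continuous_image[OF holomorphic_on_imp_continuous_on[OF hol] H(2)])
  obtain F where F: "F holomorphic_on (G ` upper_half_plane)"
     "\<And>z. z \<in> upper_half_plane \<Longrightarrow> F (G z) = z"
    using holomorphic_has_inverse[OF hol H(1) inj] by metis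
  have "connected (F ` (G ` upper_half_plane \<inter> {w. s * Im w > c}))"
    by (intro connected_continuous_image connected_Int_height_gt opn conn assms
        continuous_on_subset[OF holomorphic_on_imp_continuous_on[OF F(1)]]) auto
  moreover have "F ` (G ` upper_half_plane \<inter> {w. s * Im w > c}) = {z \<in> upper_half_plane. s * Im (G z) > c}"
    using F(2) by (force simp: image_iff)
  ultimately show ?thesis by simp
qed

section \<open>Crosscuts of the half-plane\<close>

lemma closed_segment_Complex_vertical:
  assumes "w \<in> closed_segment (Complex x y1) (Complex x y2)" "y1 \<le> y2"
  shows "Re w = x \<and> y1 \<le> Im w \<and> Im w \<le> y2"
proof -
  obtain u where u: "0 \<le> u" "u \<le> 1" "w = (1 - u) *\<^sub>R Complex x y1 + u *\<^sub>R Complex x y2"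
    using assms(1) by (auto simp: in_segment)
  have "Re w = x" "Im w = y1 + u * (y2 - y1)" unfolding u(3) by (simp_all add: algebra_simps)
  moreover have "0 \<le> u * (y2 - y1)" "u * (y2 - y1) \<le> y2 - y1"
    using u assms(2) by (auto intro: mult_left_le_one_le)
  ultimately show ?thesis by simp
qed

lemma closed_segment_Complex_horizontal:
  assumes "w \<in> closed_segment (Complex x1 y) (Complex x2 y)" "x1 \<le> x2"
  shows "Im w = y \<and> x1 \<le> Re w \<and> Re w \<le> x2"
proof -
  obtain u where u: "0 \<le> u" "u \<le> 1" "w = (1 - u) *\<^sub>R Complex x1 y + u *\<^sub>R Complex x2 y"
    using assms(1) by (auto simp: in_segment)
  have "Im w = y" "Re w = x1 + u * (x2 - x1)" unfolding u(3) by (simp_all add: algebra_simps)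
  moreover have "0 \<le> u * (x2 - x1)" "u * (x2 - x1) \<le> x2 - x1"
    using u assms(2) by (auto intro: mult_left_le_one_le)
  ultimately show ?thesis by simp
qed

text \<open>\<open>U\<close> contains a crosscut from \<open>a\<close> to infinity. A point of \<open>V\<close> low above \<open>j1..j2\<close> would be joined
  inside \<open>V\<close> to points near \<open>0\<close>, on the other side of that crosscut.\<close>
lemma crosscut_separation:
  assumes U: "path_connected U" "U \<subseteq> {z. Im z > 0}" and V: "path_connected V" "V \<subseteq> {z. Im z > 0}"
    and disj: "U \<inter> V = {}"
    and a: "a > 0" "y0 > 0" "\<And>y. 0 < y \<Longrightarrow> y \<le> y0 \<Longrightarrow> Complex a y \<in> U"
    and Y: "Y > 0" "\<And>y. y \<ge> Y \<Longrightarrow> Complex 0 y \<in> U"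
    and z: "\<And>n. z n \<in> V" "z \<longlonglongrightarrow> 0"
    and j: "a < j1" "j1 \<le> j2"
  shows "\<exists>r>0. \<forall>x y. j1 \<le> x \<longrightarrow> x \<le> j2 \<longrightarrow> 0 < y \<longrightarrow> y < r \<longrightarrow> Complex x y \<notin> V"
proof -
  obtain p where p: "path p" "path_image p \<subseteq> U" "pathstart p = Complex a y0" "pathfinish p = Complex 0 Y"
    using U(1) a(3)[of y0] a(2) Y(2)[of Y] unfolding path_connected_def by blast
  \<comment> \<open>The crosscut: up from the boundary point \<open>a\<close>, then inside
    \<open>U\<close> to the imaginary axis at height \<open>Y\<close>. It touches the real line only
    at \<open>a\<close>.\<close>
  define q where "q = linepath (Complex a 0) (Complex a y0) +++ p"
  have q: "path q" "pathstart q = Complex a 0" "pathfinish q = Complex 0 Y"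
    using p by (auto simp: q_def)
  have qU: "path_image q \<subseteq> insert (Complex a 0) U"
  proof
    fix w assume "w \<in> path_image q"
    then consider "w \<in> closed_segment (Complex a 0) (Complex a y0)" | "w \<in> path_image p"
      using p by (auto simp: q_def path_image_join)
    then show "w \<in> insert (Complex a 0) U"
    proof cases
      case 1
      then have w: "Re w = a" "0 \<le> Im w" "Im w \<le> y0" using closed_segment_Complex_vertical a(2) by fastforce+
      then have "w = Complex a (Im w)" by (simp add: complex_eq_iff)
      then show ?thesis using a(3)[of "Im w"] w by (cases "Im w = 0") auto
    qed (use p in auto)
  qed
  then have q_real: "w = Complex a 0" if "w \<in> path_image q" "Im w \<le> 0" for w
    using that U(2) by force
  have cq: "compact (path_image q)" by (rule compact_path_image[OF q(1)])
  have "path_image q \<inter> complex_of_real ` {j1..j2} = {}"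
    using q_real j by (fastforce simp: complex_eq_iff)
  moreover have "compact (complex_of_real ` {j1..j2})"
    by (intro compact_continuous_image continuous_intros) auto
  ultimately obtain d1 where d1: "d1 > 0" "\<And>x w. j1 \<le> x \<Longrightarrow> x \<le> j2 \<Longrightarrow> w \<in> path_image q \<Longrightarrow> d1 \<le> dist w (complex_of_real x)"
    using separate_compact_closed[OF cq, of "complex_of_real ` {j1..j2}"] compact_imp_closed
    by (metis atLeastAtMost_iff imageI)
  have "0 \<notin> path_image q" using q_real[of 0] a by (auto simp: complex_eq_iff)
  then obtain d2 where d2: "d2 > 0" "\<And>w. w \<in> path_image q \<Longrightarrow> d2 \<le> dist 0 w"
    using separate_point_closed[OF compact_imp_closed[OF cq], of 0] by blast
  \<comment> \<open>Below \<open>d1\<close> the vertical segment from \<open>Complex x y\<close>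
    down to the axis misses the crosscut \<open>q\<close>; below \<open>Y\<close> it misses the part
    continued upwards from \<open>Complex 0 Y\<close>.\<close>
  define r where "r = min d1 Y"
  show ?thesis
  proof (intro exI[of _ r] conjI allI impI notI)
    show "r > 0" using d1 Y by (simp add: r_def)
    fix x y assume x: "j1 \<le> x" "x \<le> j2" and y: "0 < y" "y < r" and inV: "Complex x y \<in> V"
    obtain n where "norm (z n) < min d2 Y"
      using LIMSEQ_D[OF z(2), of "min d2 Y"] d2 Y by auto
    then obtain z0 where z0: "z0 \<in> V" "norm z0 < d2" "norm z0 < Y" using z(1)[of n] by auto
    obtain v where v: "path v" "path_image v \<subseteq> V" "pathstart v = z0" "pathfinish v = Complex x y"
      using V(1) z0(1) inV unfolding path_connected_def by blast
    have "bounded (path_image q \<union> path_image v)" using q v by (simp add: bounded_path_image)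
    then obtain B where B: "B > 0" "\<And>w. w \<in> path_image q \<union> path_image v \<Longrightarrow> norm w \<le> B"
      unfolding bounded_pos by blast
    define N where "N = B + Y + \<bar>x\<bar> + \<bar>y\<bar>"
    define Box where "Box = cbox (Complex (-N) 0) (Complex N N)"
    have inBox: "w \<in> Box \<longleftrightarrow> - N \<le> Re w \<and> Re w \<le> N \<and> 0 \<le> Im w \<and> Im w \<le> N" for w
      by (auto simp: Box_def in_cbox_complex_iff)
    have cvx: "convex Box" by (simp add: Box_def)
    have N: "N > 0" using B Y by (simp add: N_def)
    have big: "w \<in> Box" if "w \<in> path_image q \<union> path_image v" for w
    proof -
      have "norm w \<le> N" using B(2)[OF that] Y by (simp add: N_def)
      moreover have "Im w \<ge> 0"
      proof -
        have "w \<in> insert (Complex a 0) U \<union> V" using that subsetD[OF qU] subsetD[OF v(2)] by (meson Un_iff)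
        then consider "w = Complex a 0" | "w \<in> U" | "w \<in> V" by (meson Un_iff insert_iff)
        then show ?thesis
        proof cases
          case 2 then show ?thesis using subsetD[OF U(2)] by fastforce
        next
          case 3 then show ?thesis using subsetD[OF V(2)] by fastforce
        qed simp
      qed
      ultimately show ?thesis unfolding inBox using abs_Re_le_cmod[of w] abs_Im_le_cmod[of w] by linarith
    qed
    \<comment> \<open>\<open>f\<close> joins the left side of the box to the right side: along the
      axis to 0, to \<open>z0\<close>, through \<open>V\<close> to \<open>Complex x y\<close>, down
      to the axis, and onwards. \<open>g\<close> joins the bottom at \<open>a\<close> to the top.
      Such paths must cross, yet each piece of \<open>f\<close> avoids \<open>g\<close>.\<close>
    define f where "f = linepath (Complex (-N) 0) 0 +++ linepath 0 z0 +++ v +++ linepath (Complex x y) (Complex x 0) +++ linepath (Complex x 0) (Complex N 0)"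
    define g where "g = q +++ linepath (Complex 0 Y) (Complex 0 N)"
    have pf: "path f" "path g" using v q by (auto simp: f_def g_def)
    have imf: "path_image f = closed_segment (Complex (-N) 0) 0 \<union> closed_segment 0 z0 \<union> path_image v \<union>
        closed_segment (Complex x y) (Complex x 0) \<union> closed_segment (Complex x 0) (Complex N 0)"
      unfolding f_def using v by (simp add: path_image_join Un_assoc)
    have img: "path_image g = path_image q \<union> closed_segment (Complex 0 Y) (Complex 0 N)"
      unfolding g_def using q by (simp add: path_image_join)
    have seg: "closed_segment p1 p2 \<subseteq> Box" if "p1 \<in> Box" "p2 \<in> Box" for p1 p2
      by (rule closed_segment_subset[OF that cvx])
    have ends: "z0 \<in> Box" "Complex x y \<in> Box" "Complex 0 Y \<in> Box"
      using big[OF UnI2[OF pathstart_in_path_image[of v]]] big[OF UnI2[OF pathfinish_in_path_image[of v]]]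
        big[OF UnI1[OF pathfinish_in_path_image[of q]]] unfolding v(3,4) q(3) .
    have corners: "Complex (-N) 0 \<in> Box" "0 \<in> Box" "Complex x 0 \<in> Box" "Complex N 0 \<in> Box" "Complex 0 N \<in> Box"
      unfolding inBox N_def using B(1) Y(1) by (simp_all, linarith)
    have qv: "path_image q \<subseteq> Box" "path_image v \<subseteq> Box" using big by blast+
    have fB: "path_image f \<subseteq> Box" unfolding imf by (intro Un_least seg ends corners qv)
    have gB: "path_image g \<subseteq> Box" unfolding img by (intro Un_least seg ends corners qv)
    have disjoint: "path_image f \<inter> path_image g = {}"
    proof (rule equals0I)
      fix w assume "w \<in> path_image f \<inter> path_image g"
      then have wf: "w \<in> path_image f" and wg: "w \<in> path_image g" by auto
      have NY: "Y \<le> N" using B by (simp add: N_def)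
      have wg': "w \<in> path_image q \<or> (Re w = 0 \<and> Im w \<ge> Y)"
        using wg closed_segment_Complex_vertical[OF _ NY, of w 0] unfolding img by blast
      have wgU: "w = Complex a 0 \<or> w \<in> U"
      proof (cases "w \<in> path_image q")
        case False
        then have "w = Complex 0 (Im w)" "Im w \<ge> Y" using wg' by (auto simp: complex_eq_iff)
        then show ?thesis using Y(2) by metis
      qed (use qU in blast)
      consider "w \<in> closed_segment (Complex (-N) 0) 0" | "w \<in> closed_segment 0 z0" | "w \<in> path_image v"
        | "w \<in> closed_segment (Complex x y) (Complex x 0)" | "w \<in> closed_segment (Complex x 0) (Complex N 0)"
        using wf unfolding imf by (meson Un_iff)
      then show False
      proof cases
        case 1
        then have "w \<in> closed_segment (Complex (-N) 0) (Complex 0 0)" by (simp add: zero_complex.code)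
        then have "Im w = 0" "Re w \<le> 0" using N closed_segment_Complex_horizontal[of w "-N" 0 0] by auto
        then show False using wg' q_real[of w] a Y by auto
      next
        case 2
        then have "norm w \<le> norm z0" by (auto simp: in_segment norm_mult mult_left_le_one_le)
        then show False using wg' d2(2)[of w] z0 abs_Im_le_cmod[of w] by auto
      next
        case 3
        then show False using wgU v(2) V(2) disj by auto
      next
        case 4
        then have "Re w = x" "0 \<le> Im w" "Im w \<le> y" 
          using closed_segment_Complex_vertical[of w x 0 y] y by (auto simp: closed_segment_commute)
        moreover from this have "dist w (complex_of_real x) = Im w"
          by (simp add: dist_norm cmod_def)
        ultimately show False using wg' d1(2)[OF x, of w] y by (auto simp: r_def)
      next
        case 5
        have "x \<le> N" using B Y by (simp add: N_def)
        then have "Im w = 0" "Re w \<ge> x" using closed_segment_Complex_horizontal[OF 5] by auto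
        then show False using wg' q_real[of w] j x Y by auto
      qed
    qed
    \<comment> \<open>The crossing theorem \<open>fashoda\<close> is stated in
      \<open>real^2\<close>, so the plane is carried over coordinatewise.\<close>
    define \<phi> :: "complex \<Rightarrow> real^2" where "\<phi> w = (\<chi> i. if i = 1 then Re w else Im w)" for w
    have \<phi>c: "continuous_on S \<phi>" for S
      unfolding \<phi>_def
    proof (rule continuous_on_vec_lambda)
      show "continuous_on S (\<lambda>w. if i = 1 then Re w else Im w)" for i :: 2
        by (cases "i = 1") (auto intro!: continuous_intros)
    qed
    have \<phi>1: "\<phi> w $ 1 = Re w" "\<phi> w $ 2 = Im w" for w by (auto simp: \<phi>_def)
    have \<phi>inj: "w = w'" if "\<phi> w = \<phi> w'" for w w'
      using \<phi>1[of w] \<phi>1[of w'] that by (simp add: complex_eq_iff)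
    have \<phi>B: "\<phi> ` Box \<subseteq> cbox (\<phi> (Complex (-N) 0)) (\<phi> (Complex N N))"
      by (auto simp: mem_box_cart inBox forall_2 \<phi>1)
    obtain w where "w \<in> path_image (\<phi> \<circ> f)" "w \<in> path_image (\<phi> \<circ> g)"
    proof (rule fashoda[of "\<phi> \<circ> f" "\<phi> \<circ> g" "\<phi> (Complex (-N) 0)" "\<phi> (Complex N N)"])
      show "path (\<phi> \<circ> f)" "path (\<phi> \<circ> g)"
        using pf \<phi>c by (auto intro: path_continuous_image)
      show "path_image (\<phi> \<circ> f) \<subseteq> cbox (\<phi> (Complex (- N) 0)) (\<phi> (Complex N N))"
        "path_image (\<phi> \<circ> g) \<subseteq> cbox (\<phi> (Complex (- N) 0)) (\<phi> (Complex N N))"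
        using fB gB \<phi>B by (auto simp: path_image_compose)
    qed (use q in \<open>auto simp: pathstart_compose pathfinish_compose \<phi>1 f_def g_def\<close>)
    then show False using disjoint \<phi>inj by (auto simp: path_image_compose)
  qed
qed

section \<open>Poisson averages and points of small density\<close>

text \<open>Displays the kernel as a mixture of indicators of centred intervals, with weight minus
  the derivative of \<open>y / (r^2 + y^2)\<close>. Bounds on masses of balls thereby become bounds
  on heights.\<close>

lemma poisson_layer_cake:
  assumes "y > 0"
  shows "(\<integral>\<^sup>+r. ennreal (2 * y * r / (r\<^sup>2 + y\<^sup>2)\<^sup>2) * indicator {\<bar>u\<bar>..} r \<partial>lborel) = ennreal (y / (u\<^sup>2 + y\<^sup>2))"
proof -
  have pos: "r\<^sup>2 + y\<^sup>2 > 0" for r using assms by (intro add_nonneg_pos) auto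
  have "(\<integral>\<^sup>+r. ennreal (2 * y * r / (r\<^sup>2 + y\<^sup>2)\<^sup>2) * indicator {\<bar>u\<bar>..} r \<partial>lborel) = ennreal (0 - (- (y / (\<bar>u\<bar>\<^sup>2 + y\<^sup>2))))"
  proof (rule nn_integral_FTC_atLeast)
    fix r assume r: "\<bar>u\<bar> \<le> r"
    show "((\<lambda>r. - (y / (r\<^sup>2 + y\<^sup>2))) has_real_derivative 2 * y * r / (r\<^sup>2 + y\<^sup>2)\<^sup>2) (at r)"
      using pos[of r] by (auto intro!: derivative_eq_intros simp: power2_eq_square)
    show "0 \<le> 2 * y * r / (r\<^sup>2 + y\<^sup>2)\<^sup>2" using assms r by simp
  next
    show "((\<lambda>r. - (y / (r\<^sup>2 + y\<^sup>2))) \<longlongrightarrow> 0) at_top" by real_asymp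
  qed measurable
  then show ?thesis by simp
qed

text \<open>The layer weights tested against Lebesgue measure, where a ball has length
  \<open>2 * r\<close>; the value pi is the total integral of
  \<open>y / (u^2 + y^2)\<close>.\<close>

lemma poisson_layer_mass:
  assumes "y > 0"
  shows "(\<integral>\<^sup>+r. ennreal (4 * y * r\<^sup>2 / (r\<^sup>2 + y\<^sup>2)\<^sup>2) * indicator {0..} r \<partial>lborel) = ennreal pi"
proof -
  have pos: "r\<^sup>2 + y\<^sup>2 > 0" for r using assms by (intro add_nonneg_pos) auto
  have "(\<integral>\<^sup>+r. ennreal (4 * y * r\<^sup>2 / (r\<^sup>2 + y\<^sup>2)\<^sup>2) * indicator {0..} r \<partial>lborel)
      = ennreal (pi - (2 * arctan (0 / y) - 2 * 0 * y / (0\<^sup>2 + y\<^sup>2)))"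
  proof (rule nn_integral_FTC_atLeast)
    fix r :: real
    define s where "s = r\<^sup>2 + y\<^sup>2"
    have s: "s > 0" using pos by (simp add: s_def)
    have D: "((\<lambda>r. 2 * arctan (r / y) - 2 * r * y / (r\<^sup>2 + y\<^sup>2)) has_real_derivative 
       2 * (inverse (1 + (r / y)\<^sup>2) * (1 / y)) - (2 * y * s - 2 * r * y * (2 * r)) / (s * s)) (at r)"
      using s assms unfolding s_def by (auto intro!: derivative_eq_intros simp: power2_eq_square)
    have e1: "inverse (1 + (r / y)\<^sup>2) * (1 / y) = y / s"
    proof -
      have "1 + (r / y)\<^sup>2 = s / y\<^sup>2" using assms by (simp add: s_def field_simps power2_eq_square)
      then show ?thesis using assms s by (simp add: power2_eq_square)
    qed
    have e2: "2 * (y / s) - (2 * y * s - 2 * r * y * (2 * r)) / (s * s) = 4 * y * r\<^sup>2 / s\<^sup>2"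
      using s by (simp add: field_simps power2_eq_square)
    show "((\<lambda>r. 2 * arctan (r / y) - 2 * r * y / (r\<^sup>2 + y\<^sup>2)) has_real_derivative 4 * y * r\<^sup>2 / (r\<^sup>2 + y\<^sup>2)\<^sup>2) (at r)"
      using D unfolding e1 e2 by (simp only: s_def)
    show "0 \<le> 4 * y * r\<^sup>2 / (r\<^sup>2 + y\<^sup>2)\<^sup>2" using assms by simp
  next
    have "((\<lambda>r. 2 * arctan (r / y)) \<longlongrightarrow> 2 * (pi / 2)) at_top"
      using assms by (intro tendsto_intros filterlim_compose[OF tendsto_arctan_at_top]) real_asymp
    moreover have "((\<lambda>r. 2 * r * y / (r\<^sup>2 + y\<^sup>2)) \<longlongrightarrow> 0) at_top" using assms by real_asymp
    ultimately have "((\<lambda>r. 2 * arctan (r / y) - 2 * r * y / (r\<^sup>2 + y\<^sup>2)) \<longlongrightarrow> 2 * (pi / 2) - 0) at_top"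
      by (rule tendsto_diff)
    then show "((\<lambda>r. 2 * arctan (r / y) - 2 * r * y / (r\<^sup>2 + y\<^sup>2)) \<longlongrightarrow> pi) at_top" by simp
  qed measurable
  then show ?thesis by simp
qed

context real_distribution
begin

text \<open>Layers of radius below \<open>d\<close> contribute at most what density \<open>l\<close>
  would, namely \<open>l * pi\<close>. In the larger layers the mass is at most 1, and their weights
  integrate to \<open>y / (d^2 + y^2)\<close>.\<close>

lemma height_le_of_ball_measure_le:
  assumes d: "d > 0" and l: "l \<ge> 0" and y: "y > 0"
    and ball: "\<And>r. 0 < r \<Longrightarrow> r < d \<Longrightarrow> measure M (cball a r) \<le> 2 * l * r"
  shows "- Im (cauchy_transform M (Complex a y)) \<le> l * pi + y / d\<^sup>2"
proof -
  interpret P: pair_sigma_finite lborel M ..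
  define w where "w r = 2 * y * r / (r\<^sup>2 + y\<^sup>2)\<^sup>2" for r
  have w: "w r \<ge> 0" if "r \<ge> 0" for r using that y by (simp add: w_def)
  have [measurable]: "w \<in> borel_measurable borel" unfolding w_def by measurable
  have "ennreal (- Im (cauchy_transform M (Complex a y))) = (\<integral>\<^sup>+x. ennreal (cauchy_height (Complex a y) x) \<partial>M)"
    using y by (simp add: nn_integral_cauchy_height)
  also have "\<dots> = (\<integral>\<^sup>+x. (\<integral>\<^sup>+r. ennreal (w r) * indicator {\<bar>a - x\<bar>..} r \<partial>lborel) \<partial>M)"
    unfolding w_def poisson_layer_cake[OF y] by (simp add: cauchy_height_def)
  also have "\<dots> = (\<integral>\<^sup>+r. (\<integral>\<^sup>+x. ennreal (w r) * indicator {\<bar>a - x\<bar>..} r \<partial>M) \<partial>lborel)"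
    by (rule P.Fubini') (auto simp: split_beta' indicator_def)
  also have "\<dots> \<le> (\<integral>\<^sup>+r. ennreal l * (ennreal (4 * y * r\<^sup>2 / (r\<^sup>2 + y\<^sup>2)\<^sup>2) * indicator {0..} r) 
      + ennreal (w r) * indicator {\<bar>d\<bar>..} r \<partial>lborel)"
  proof (rule nn_integral_mono_AE)
    show "AE r in lborel. (\<integral>\<^sup>+x. ennreal (w r) * indicator {\<bar>a - x\<bar>..} r \<partial>M) 
       \<le> ennreal l * (ennreal (4 * y * r\<^sup>2 / (r\<^sup>2 + y\<^sup>2)\<^sup>2) * indicator {0..} r) + ennreal (w r) * indicator {\<bar>d\<bar>..} r"
      using AE_lborel_singleton[of "0::real"]
    proof eventually_elim
      case (elim r)
      have "(\<integral>\<^sup>+x. ennreal (w r) * indicator {\<bar>a - x\<bar>..} r \<partial>M) = (\<integral>\<^sup>+x. ennreal (w r) * indicator (cball a r) x \<partial>M)"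
        by (intro nn_integral_cong) (auto simp: indicator_def dist_real_def)
      also have "\<dots> = ennreal (w r) * ennreal (measure M (cball a r))"
        by (subst nn_integral_cmult_indicator) (auto simp: emeasure_eq_measure)
      finally have eq: "(\<integral>\<^sup>+x. ennreal (w r) * indicator {\<bar>a - x\<bar>..} r \<partial>M) = ennreal (w r) * ennreal (measure M (cball a r))" .
      consider "r < 0" | "0 < r" "r < d" | "r \<ge> d" using elim by linarith
      then have "ennreal (w r) * ennreal (measure M (cball a r))
        \<le> ennreal l * (ennreal (4 * y * r\<^sup>2 / (r\<^sup>2 + y\<^sup>2)\<^sup>2) * indicator {0..} r) + ennreal (w r) * indicator {\<bar>d\<bar>..} r"
      proof cases
        case 1 then show ?thesis by (simp add: cball_empty)
      next
        case 2
        have "w r * measure M (cball a r) \<le> w r * (2 * l * r)"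
          using ball[OF 2] w 2 by (intro mult_left_mono) auto
        also have "\<dots> = l * (4 * y * r\<^sup>2 / (r\<^sup>2 + y\<^sup>2)\<^sup>2)" by (simp add: w_def power2_eq_square)
        finally have "ennreal (w r * measure M (cball a r)) \<le> ennreal (l * (4 * y * r\<^sup>2 / (r\<^sup>2 + y\<^sup>2)\<^sup>2))"
          by (rule ennreal_leI)
        then show ?thesis using 2 w[of r] unfolding ennreal_mult'[OF l] ennreal_mult'[OF w[OF less_imp_le[OF 2(1)]]] by simp
      next
        case 3
        have "ennreal (w r) * ennreal (measure M (cball a r)) \<le> ennreal (w r) * 1"
          by (intro mult_left_mono) (auto simp: ennreal_le_1)
        then show ?thesis using 3 d by (simp add: add_increasing)
      qed
      then show ?case by (simp only: eq)
    qed
  qed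
  also have "\<dots> = ennreal l * ennreal pi + ennreal (y / (d\<^sup>2 + y\<^sup>2))"
    using poisson_layer_mass[OF y] poisson_layer_cake[OF y, of d]
    by (subst nn_integral_add) (auto simp: nn_integral_cmult w_def[abs_def])
  also have "\<dots> = ennreal (l * pi + y / (d\<^sup>2 + y\<^sup>2))"
    using l y by (simp add: ennreal_mult)
  finally have "- Im (cauchy_transform M (Complex a y)) \<le> l * pi + y / (d\<^sup>2 + y\<^sup>2)"
    using l y by (subst (asm) ennreal_le_iff) auto
  also have "y / (d\<^sup>2 + y\<^sup>2) \<le> y / d\<^sup>2"
    using d y by (intro divide_left_mono) (auto intro!: mult_pos_pos add_pos_nonneg)
  finally show ?thesis by simp
qed

text \<open>Otherwise every point of the interval is the centre of arbitrarily small balls of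
  density above a fixed \<open>l'\<close> that exceeds the average density. A disjoint Vitali
  subfamily fills the interval up to a null set, and its total mass is too large. The conclusion
  keeps \<open>l' < l\<close> because the height estimate needs room for its tail term.\<close>

lemma ex_small_density_point:
  assumes i: "i1 < i2" and lt: "measure M {i1<..<i2} < l * (i2 - i1)"
  shows "\<exists>a l' d. i1 < a \<and> a < i2 \<and> 0 \<le> l' \<and> l' < l \<and> 0 < d \<and> (\<forall>r. 0 < r \<longrightarrow> r < d \<longrightarrow> measure M (cball a r) \<le> 2 * l' * r)"
proof (rule ccontr)
  assume contr: "\<not> ?thesis"
  have "measure M {i1<..<i2} / (i2 - i1) < l" using i lt by (simp add: field_simps)
  then obtain l' where l': "measure M {i1<..<i2} / (i2 - i1) < l'" "l' < l" using dense by blast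
  have l'0: "0 \<le> l'" using l'(1) i by (smt (verit) divide_nonneg_pos measure_nonneg)
  define I where "I = {i1<..<i2}"
  define K where "K = {(a, r). a \<in> I \<and> 0 < r \<and> cball a r \<subseteq> I \<and> 2 * l' * r < measure M (cball a r)}"
  have ex: "\<exists>i. i \<in> K \<and> x \<in> cball (fst i) (snd i) \<and> snd i < d" if x: "x \<in> I" and d: "0 < d" for x d
  proof -
    have "open I" by (simp add: I_def)
    then obtain e where e: "e > 0" "cball x e \<subseteq> I" using x open_contains_cball[of I] by blast
    obtain r where r: "0 < r" "r < min d e" "2 * l' * r < measure M (cball x r)"
      using contr x l' l'0 d e unfolding I_def by (metis greaterThanLessThan_iff min_less_iff_conj not_less)
    then have "cball x r \<subseteq> I" using e(2) subset_cball[of r e x] by auto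
    then show ?thesis using r x by (intro exI[of _ "(x, r)"]) (auto simp: K_def)
  qed
  obtain C where C: "countable C" "C \<subseteq> K"
     "pairwise (\<lambda>i j. disjnt (cball (fst i) (snd i)) (cball (fst j) (snd j))) C"
     "negligible (I - (\<Union>i\<in>C. cball (fst i) (snd i)))"
    by (rule Vitali_covering_theorem_cballs[of K snd I fst, OF _ ex])
      (auto simp only: K_def split_beta mem_Collect_eq)
  define B where "B i = cball (fst i) (snd i)" for i :: "real \<times> real"
  have disj: "disjoint_family_on B C"
    using C(3) by (auto simp: disjoint_family_on_def pairwise_def disjnt_def B_def)
  have Bs: "B i \<in> sets borel" for i by (simp add: B_def)
  have UB [measurable]: "(\<Union>i\<in>C. B i) \<in> sets borel"
    by (intro sets.countable_UN' C(1)) (auto simp: B_def)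
  have "B i \<subseteq> I" if "i \<in> C" for i
  proof -
    have "i \<in> K" using that C(2) by blast
    then show ?thesis by (cases i) (simp add: K_def B_def)
  qed
  then have UI: "(\<Union>i\<in>C. B i) \<subseteq> I" by (rule UN_least)
  have lenB: "emeasure lborel (B i) = ennreal (2 * snd i)" if "i \<in> C" for i
  proof -
    have "snd i > 0" using that C(2) by (auto simp: K_def)
    then show ?thesis unfolding B_def cball_eq_atLeastAtMost by simp
  qed
  have "I - (\<Union>i\<in>C. B i) \<in> null_sets lborel"
  proof -
    have "I - (\<Union>i\<in>C. B i) \<in> null_sets lebesgue" 
      using C(4) by (simp add: negligible_iff_null_sets B_def)
    then show ?thesis by (auto simp: null_sets_def I_def)
  qed
  then have "emeasure lborel ((\<Union>i\<in>C. B i) \<union> (I - (\<Union>i\<in>C. B i))) = emeasure lborel (\<Union>i\<in>C. B i)"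
    by (intro emeasure_Un_null_set) auto
  moreover have "emeasure lborel I \<le> emeasure lborel ((\<Union>i\<in>C. B i) \<union> (I - (\<Union>i\<in>C. B i)))"
    by (rule emeasure_mono) (auto simp: I_def)
  ultimately have "emeasure lborel I \<le> emeasure lborel (\<Union>i\<in>C. B i)" by simp
  also have "\<dots> = (\<integral>\<^sup>+i. emeasure lborel (B i) \<partial>count_space C)"
    by (rule emeasure_UN_countable) (simp_all add: C(1) disj Bs)
  finally have len: "emeasure lborel I \<le> (\<integral>\<^sup>+i. emeasure lborel (B i) \<partial>count_space C)" .
  have "ennreal (l' * (i2 - i1)) = ennreal l' * emeasure lborel I"
    using i l'0 by (simp add: I_def ennreal_mult)
  also have "\<dots> \<le> ennreal l' * (\<integral>\<^sup>+i. emeasure lborel (B i) \<partial>count_space C)"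
    using len by (rule mult_left_mono) simp
  also have "\<dots> = (\<integral>\<^sup>+i. ennreal l' * emeasure lborel (B i) \<partial>count_space C)"
    by (rule nn_integral_cmult[symmetric]) simp
  also have "\<dots> \<le> (\<integral>\<^sup>+i. emeasure M (B i) \<partial>count_space C)"
  proof (rule nn_integral_mono)
    fix i assume "i \<in> space (count_space C)"
    then have i: "i \<in> C" by simp
    then have "2 * l' * snd i \<le> measure M (B i)" using C(2) by (auto simp: K_def B_def)
    then show "ennreal l' * emeasure lborel (B i) \<le> emeasure M (B i)"
      unfolding lenB[OF i] emeasure_eq_measure using l'0 by (simp add: ennreal_mult'[symmetric] ennreal_leI ac_simps)
  qed
  also have "\<dots> = emeasure M (\<Union>i\<in>C. B i)"
    by (rule emeasure_UN_countable[symmetric]) (simp_all add: C(1) disj Bs)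
  also have "\<dots> \<le> emeasure M I" using UI by (intro emeasure_mono) (auto simp: I_def)
  finally have "ennreal (l' * (i2 - i1)) \<le> ennreal (measure M I)" by (simp add: emeasure_eq_measure)
  then have "l' * (i2 - i1) \<le> measure M I" by (subst (asm) ennreal_le_iff) auto
  then show False using l'(1) i by (simp add: I_def field_simps)
qed

end

section \<open>Decreasing averages from connected height sets\<close>

text \<open>The consequence of the fourth condition that is used, in a form inherited by the
  reflected measure. The last clause says that the heights at \<open>z n\<close> tend to their
  supremum, finite or not, without extended reals.\<close>

definition connected_heights_at_0 :: "real measure \<Rightarrow> bool" where
  "connected_heights_at_0 M \<longleftrightarrow>
    (\<forall>c. connected {z. Im z > 0 \<and> - Im (cauchy_transform M z) < c}) \<and>
    (\<forall>c. connected {z. Im z > 0 \<and> - Im (cauchy_transform M z) > c}) \<and>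
    (\<exists>z :: nat \<Rightarrow> complex. (\<forall>n. Im (z n) > 0) \<and> z \<longlonglongrightarrow> 0 \<and>
      (\<forall>w c. Im w > 0 \<longrightarrow> c < - Im (cauchy_transform M w) \<longrightarrow>
         (\<forall>\<^sub>F n in sequentially. c < - Im (cauchy_transform M (z n)))))"

context real_distribution
begin

lemma continuous_on_Im_cauchy_transform:
  "continuous_on {z. Im z > 0} (\<lambda>z. - Im (cauchy_transform M z))"
  using holomorphic_on_imp_continuous_on[OF holomorphic_cauchy_transform]
  unfolding upper_half_plane_def by (intro continuous_intros)

lemma open_height_sets:
  "open {z. Im z > 0 \<and> - Im (cauchy_transform M z) < c}"
  "open {z. Im z > 0 \<and> - Im (cauchy_transform M z) > c}"
  using continuous_on_open_vimage[THEN iffD1, OF open_halfspace_Im_gt continuous_on_Im_cauchy_transform, rule_format, of "{..<c}"]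
    continuous_on_open_vimage[THEN iffD1, OF open_halfspace_Im_gt continuous_on_Im_cauchy_transform, rule_format, of "{c<..}"]
  by (simp_all add: vimage_def Int_def conj_commute)

text \<open>For every \<open>l\<close> above the average density on the first interval, a crosscut
  starting in that interval keeps the set of heights above \<open>pi * l\<close> away from the axis
  over the second one, so the second average is at most \<open>l\<close>. Letting \<open>l\<close>
  decrease gives the claim.\<close>

lemma measure_Ioo_ratio_le:
  assumes conn: "connected_heights_at_0 M"
    and ord: "0 \<le> i1" "i1 < i2" "i2 \<le> j1" "j1 < j2"
  shows "measure M {j1<..<j2} * (i2 - i1) \<le> measure M {i1<..<i2} * (j2 - j1)"
proof -
  have key: "measure M {j1<..<j2} \<le> l * (j2 - j1)" if lt: "measure M {i1<..<i2} < l * (i2 - i1)" for l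
  proof -
    have l: "l > 0" using lt ord measure_nonneg[of M "{i1<..<i2}"]
      by (smt (verit) mult_nonpos_nonneg)
    define U where "U = {z. Im z > 0 \<and> - Im (cauchy_transform M z) < pi * l}"
    define V where "V = {z. Im z > 0 \<and> - Im (cauchy_transform M z) > pi * l}"
    have "\<exists>r>0. \<forall>x y. j1 \<le> x \<longrightarrow> x \<le> j2 \<longrightarrow> 0 < y \<longrightarrow> y < r \<longrightarrow> Complex x y \<notin> V"
    \<comment> \<open>If \<open>V\<close> is nonempty, it has a height above the level
      \<open>pi * l\<close>, and hence the points \<open>z n\<close> eventually lie in
      \<open>V\<close>.\<close>
    proof (cases "V = {}")
      case True
      then show ?thesis by (intro exI[of _ 1]) auto
    next
      case False
      then obtain w where w: "Im w > 0" "pi * l < - Im (cauchy_transform M w)" by (auto simp: V_def)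
      obtain z where z: "\<And>n. Im (z n) > 0" "z \<longlonglongrightarrow> 0"
        and zev: "\<forall>\<^sub>F n in sequentially. pi * l < - Im (cauchy_transform M (z n))"
        using conn w unfolding connected_heights_at_0_def by blast
      obtain n0 where n0: "\<And>n. n \<ge> n0 \<Longrightarrow> pi * l < - Im (cauchy_transform M (z n))"
        using zev unfolding eventually_sequentially by blast
      obtain a l' d where a: "i1 < a" "a < i2" "0 \<le> l'" "l' < l" "0 < d"
        "\<And>r. 0 < r \<Longrightarrow> r < d \<Longrightarrow> measure M (cball a r) \<le> 2 * l' * r"
        using ex_small_density_point[OF ord(2) lt] by blast
      \<comment> \<open>Chosen so that the tail term \<open>y / d^2\<close> uses at most half of the
        gap \<open>pi * (l - l')\<close>.\<close>
      define y0 where "y0 = d\<^sup>2 * (pi * (l - l')) / 2"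
      have y0: "y0 > 0" unfolding y0_def using a by (intro divide_pos_pos mult_pos_pos) auto
      \<comment> \<open>Heights at \<open>Complex 0 y\<close> are at most \<open>1 / y\<close>,
        which is below \<open>pi * l\<close> from here on.\<close>
      define Y where "Y = 1 / (pi * l) + 1"
      have Y: "Y > 0" using l by (simp add: Y_def add_pos_pos)
      show ?thesis
      proof (rule crosscut_separation[of U V a y0 Y "\<lambda>n. z (n + n0)" j1 j2])
        show "path_connected U" "path_connected V"
          unfolding U_def V_def
          by (intro connected_open_path_connected open_height_sets; use conn in \<open>simp add: connected_heights_at_0_def\<close>)+
        show "Complex a y \<in> U" if y: "0 < y" "y \<le> y0" for y
        proof -
          have "- Im (cauchy_transform M (Complex a y)) \<le> l' * pi + y / d\<^sup>2"
            using height_le_of_ball_measure_le[OF a(5) a(3) y(1) a(6)] .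
          also have "y / d\<^sup>2 \<le> pi * (l - l') / 2"
            using y a by (simp add: y0_def field_simps)
          also have "l' * pi + pi * (l - l') / 2 < pi * l"
          proof -
            have "pi * (l - l') > 0" using a by simp
            moreover have "pi * l = l' * pi + pi * (l - l')" by (simp add: algebra_simps)
            ultimately show ?thesis by linarith
          qed
          finally show ?thesis using y by (simp add: U_def)
        qed
        show "Complex 0 y \<in> U" if y: "Y \<le> y" for y
        proof -
          have "y > 0" using y Y by simp
          then have "- Im (cauchy_transform M (Complex 0 y)) \<le> 1 / y"
            using Im_cauchy_transform_ge[of "Complex 0 y"] by simp
          also have "1 / y < pi * l"
          proof -
            have "1 / (pi * l) < y" using y by (simp add: Y_def)
            then show ?thesis using \<open>y > 0\<close> l by (simp add: field_simps)
          qed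
          finally show ?thesis using \<open>y > 0\<close> by (simp add: U_def)
        qed
        show "z (n + n0) \<in> V" for n using z n0 by (simp add: V_def)
        show "(\<lambda>n. z (n + n0)) \<longlonglongrightarrow> 0" by (rule LIMSEQ_ignore_initial_segment[OF z(2)])
      qed (use a ord y0 Y in \<open>auto simp: U_def V_def\<close>)
    qed
    then obtain r where r: "r > 0" "\<And>x y. j1 \<le> x \<Longrightarrow> x \<le> j2 \<Longrightarrow> 0 < y \<Longrightarrow> y < r \<Longrightarrow> Complex x y \<notin> V"
      by blast
    have "pi * measure M {j1<..<j2} \<le> pi * l * (j2 - j1)"
      using r ord l by (intro measure_Ioo_le_of_height_le[of j1 j2 r]) (auto simp: V_def not_less)
    then show ?thesis by (simp add: mult.assoc)
  qed
  have "measure M {j1<..<j2} / (j2 - j1) \<le> measure M {i1<..<i2} / (i2 - i1)"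
  proof (rule dense_ge)
    fix l assume "measure M {i1<..<i2} / (i2 - i1) < l"
    then have "measure M {i1<..<i2} < l * (i2 - i1)" using ord by (simp add: field_simps)
    from key[OF this] show "measure M {j1<..<j2} / (j2 - j1) \<le> l" using ord by (simp add: field_simps)
  qed
  then show ?thesis using ord by (simp add: field_simps)
qed

text \<open>An atom would give arbitrarily large averages on small intervals around
  \<open>x\<close>, but these are bounded by the average on \<open>{0<..<x / 2}\<close>, which lies
  to their left when \<open>e < x / 2\<close>.\<close>

lemma measure_singleton_eq_0:
  assumes "connected_heights_at_0 M" and x: "x > 0"
  shows "measure M {x} = 0"
proof -
  have "measure M {x} * x \<le> 4 * e" if e: "0 < e" "e < x / 2" for e
  proof -
    have "measure M {x} * (x / 2) \<le> measure M {x - e<..<x + e} * (x / 2 - 0)"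
      using e x by (intro mult_mono finite_measure_mono) auto
    also have "\<dots> \<le> measure M {0<..<x / 2} * (x + e - (x - e))"
      using e x by (intro measure_Ioo_ratio_le assms(1)) auto
    also have "\<dots> \<le> 1 * (2 * e)" using e by (intro mult_mono) auto
    finally show ?thesis by simp
  qed
  then have "measure M {x} * x / 4 \<le> e" if "0 < e" "e < x / 2" for e using that by fastforce
  then have "measure M {x} * x / 4 \<le> 0"
    using x by (intro dense_ge_bounded[of 0 "x / 2"]) auto
  then have "measure M {x} * x \<le> 0" by simp
  then show ?thesis using x measure_nonneg[of M "{x}"] by (simp add: mult_le_0_iff)
qed

text \<open>If the scaled interval starts after \<open>b\<close>, averages are compared directly.
  Otherwise the intervals overlap, and the comparison goes through the pieces cut by
  \<open>a\<close>, \<open>t * a\<close>, \<open>b\<close> and \<open>t * b\<close>.\<close>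

lemma measure_Ioc_scale_le:
  assumes conn: "connected_heights_at_0 M" and t: "t > 1" and ab: "0 \<le> a" "a < b"
  shows "measure M {t * a<..t * b} \<le> t * measure M {a<..b}"
proof -
  define F where "F = cdf M"
  have Ioo: "measure M {p<..<q} = F q - F p" if "0 \<le> p" "p < q" for p q
  proof -
    have "measure M ({p<..<q} \<union> {q}) = measure M {p<..<q} + measure M {q}"
      by (rule finite_measure_Union) auto
    moreover have "{p<..<q} \<union> {q} = {p<..q}" using that by auto
    ultimately show ?thesis
      using cdf_diff_eq[OF that(2)] measure_singleton_eq_0[OF conn, of q] that by (simp add: F_def)
  qed
  have R: "(F s - F r) * (q - p) \<le> (F q - F p) * (s - r)" if "0 \<le> p" "p < q" "q \<le> r" "r < s" for p q r s
    using measure_Ioo_ratio_le[OF conn that] Ioo[of p q] Ioo[of r s] that by simp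
  have tab: "t * a < t * b" "a \<le> t * a" "b < t * b" using t ab by (auto simp: mult_le_cancel_right1)
  have "F (t * b) - F (t * a) \<le> t * (F b - F a)"
  proof (cases "b \<le> t * a")
    case True
    have "(F (t * b) - F (t * a)) * (b - a) \<le> (F b - F a) * (t * b - t * a)"
      by (rule R) (use ab True tab in auto)
    also have "\<dots> = t * (F b - F a) * (b - a)" by (simp add: algebra_simps)
    finally show ?thesis using ab by (simp add: mult_le_cancel_right)
  next
    case False
    \<comment> \<open>the increments over three consecutive intervals have decreasing slopes\<close>
    define m1 m2 m3 where "m1 = F (t * a) - F a" and "m2 = F b - F (t * a)" and "m3 = F (t * b) - F b"
    have 1: "m3 * (b - t * a) \<le> m2 * (t * b - b)"
      unfolding m2_def m3_def by (rule R) (use ab False tab t in auto)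
    have 2: "m3 * (t * a) \<le> m1 * (t * b)"
    proof (cases "a = 0")
      case False
      then have "a > 0" using ab by simp
      then have "m3 * (t * a - a) \<le> m1 * (t * b - b)"
        unfolding m1_def m3_def by (intro R) (use ab \<open>\<not> b \<le> t * a\<close> tab t in auto)
      then have "(t - 1) * (m3 * a) \<le> (t - 1) * (m1 * b)" by (simp add: algebra_simps)
      then have "m3 * a \<le> m1 * b" using t by (simp add: mult_le_cancel_left)
      then have "t * (m3 * a) \<le> t * (m1 * b)" using t by (intro mult_left_mono) auto
      then show ?thesis by (simp add: ac_simps)
    qed (simp add: m1_def)
    \<comment> \<open>The sum of the two estimates: the weights \<open>b - t * a\<close> and
      \<open>t * a\<close> add up to \<open>b\<close>.\<close>
    have "m3 * b \<le> (t * m1 + (t - 1) * m2) * b" using 1 2 by (simp add: algebra_simps)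
    then have "m3 \<le> t * m1 + (t - 1) * m2" using ab by (simp add: mult_le_cancel_right)
    then show ?thesis by (simp add: m1_def m2_def m3_def algebra_simps)
  qed
  then show ?thesis
    using cdf_diff_eq[OF ab(2)] cdf_diff_eq[OF tab(1)] by (simp add: F_def)
qed

end

section \<open>Reflection and the negative half-line\<close>

lemma Im_cauchy_transform_reflect:
  assumes "real_distribution M" "Im z > 0"
  shows "Im (cauchy_transform (distr M borel uminus) z) = Im (cauchy_transform M (- cnj z))"
proof -
  interpret M: real_distribution M by fact
  interpret N: real_distribution "distr M borel uminus" by (intro M.real_distribution_distr) simp
  have "cauchy_height z (- x) = cauchy_height (- cnj z) x" for x
    by (simp add: cauchy_height_def power2_eq_square algebra_simps)
  then show ?thesis using assms(2)
    by (simp add: N.Im_cauchy_transform M.Im_cauchy_transform integral_distr)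
qed

lemma connected_heights_at_0_reflect:
  assumes "real_distribution M" "connected_heights_at_0 M"
  shows "connected_heights_at_0 (distr M borel uminus)"
proof -
  note eq = Im_cauchy_transform_reflect[OF assms(1)]
  have c: "continuous_on S (\<lambda>z. - cnj z)" for S by (intro continuous_intros)
  have img: "(\<lambda>z. - cnj z) ` {z. Im z > 0 \<and> P (Im (cauchy_transform M z))}
    = {z. Im z > 0 \<and> P (Im (cauchy_transform (distr M borel uminus) z))}" for P
  proof -
    have "z \<in> (\<lambda>z. - cnj z) ` {z. Im z > 0 \<and> P (Im (cauchy_transform M z))}"
      if "Im z > 0" "P (Im (cauchy_transform (distr M borel uminus) z))" for z
      using that eq[of z] by (intro image_eqI[of _ _ "- cnj z"]) auto
    then show ?thesis using eq by auto
  qed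
  obtain z where z: "\<And>n :: nat. Im (z n) > 0" "z \<longlonglongrightarrow> 0" 
    "\<And>w c. Im w > 0 \<Longrightarrow> c < - Im (cauchy_transform M w) \<Longrightarrow>
         \<forall>\<^sub>F n in sequentially. c < - Im (cauchy_transform M (z n))"
    using assms(2) unfolding connected_heights_at_0_def by blast
  show ?thesis unfolding connected_heights_at_0_def
  proof (intro conjI allI exI[of _ "\<lambda>n. - cnj (z n)"] impI)
    show "connected {z. Im z > 0 \<and> - Im (cauchy_transform (distr M borel uminus) z) < c}" for c
      unfolding img[of "\<lambda>v. - v < c", symmetric]
      using assms(2) by (intro connected_continuous_image c) (simp add: connected_heights_at_0_def)
    show "connected {z. Im z > 0 \<and> - Im (cauchy_transform (distr M borel uminus) z) > c}" for c
      unfolding img[of "\<lambda>v. - v > c", symmetric]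
      using assms(2) by (intro connected_continuous_image c) (simp add: connected_heights_at_0_def)
    show "Im (- cnj (z n)) > 0" for n using z(1) by simp
    have "(\<lambda>n. - cnj (z n)) \<longlonglongrightarrow> - cnj 0" by (intro tendsto_intros z(2))
    then show "(\<lambda>n. - cnj (z n)) \<longlonglongrightarrow> 0" by simp
    show "\<forall>\<^sub>F n in sequentially. c < - Im (cauchy_transform (distr M borel uminus) (- cnj (z n)))"
      if "Im w > 0" "c < - Im (cauchy_transform (distr M borel uminus) w)" for w c
      using z(3)[of "- cnj w" c] that z(1) by (simp add: eq)
  qed
qed

text \<open>Intervals to the right of 0 are compared by averages, those to the left after
  reflection, and an interval across 0 is cut there. An atom at 0 may occur and is counted
  once.\<close>

lemma subscaling_if_connected_heights:
  assumes M: "real_distribution M" and conn: "connected_heights_at_0 M"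
  shows "subscaling M"
  unfolding subscaling_def
proof (intro allI impI)
  fix t a b :: real assume t: "1 < t" and "a \<le> b"
  interpret M: real_distribution M by fact
  define N where "N = distr M borel uminus"
  interpret N: real_distribution N unfolding N_def by (intro M.real_distribution_distr) simp
  have connN: "connected_heights_at_0 N" unfolding N_def by (rule connected_heights_at_0_reflect[OF M conn])
  have Nm: "measure N A = measure M (uminus ` A)" if "A \<in> sets borel" for A
  proof -
    have "uminus -` A = uminus ` A" by (force simp: image_iff)
    then show ?thesis unfolding N_def using that by (subst measure_distr) auto
  qed
  have neg: "measure M {t * a<..t * b} \<le> t * measure M {a<..b}" if "a < b" "b \<le> 0" for a b
  proof -
    have ta: "t * a < t * b" "t * b \<le> 0" using that t by (auto simp: mult_le_0_iff)
    have "uminus ` {- q..<- p} = {p<..q}" for p q :: real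
      by force
    then have Mq: "measure M {p<..q} = measure N {- q..<- p}" for p q using Nm[of "{- q..<- p}"] by simp
    \<comment> \<open>Reflection moves the closed end of the interval to the other side. Points
      other than 0 carry no mass, so only an endpoint at 0 makes a difference.\<close>
    have Nq: "measure N {- q..<- p} = measure N {- q<..- p} + (if q = 0 then measure N {0} else 0)"
      if "p < q" "q \<le> 0" for p q
    proof -
      have "measure N ({- q} \<union> {- q<..<- p}) = measure N {- q} + measure N {- q<..<- p}"
        by (rule N.finite_measure_Union) auto
      moreover have "measure N ({- q<..<- p} \<union> {- p}) = measure N {- q<..<- p} + measure N {- p}"
        by (rule N.finite_measure_Union) auto
      moreover have "{- q} \<union> {- q<..<- p} = {- q..<- p}" "{- q<..<- p} \<union> {- p} = {- q<..- p}" using that by auto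
      moreover have "measure N {- p} = 0" using that by (intro N.measure_singleton_eq_0 connN) auto
      moreover have "q \<noteq> 0 \<Longrightarrow> measure N {- q} = 0" using that by (intro N.measure_singleton_eq_0 connN) auto
      ultimately show ?thesis by auto
    qed
    have "measure N {- (t * b)<..- (t * a)} \<le> t * measure N {- b<..- a}"
      using N.measure_Ioc_scale_le[OF connN t, of "- b" "- a"] that by simp
    moreover have "measure N {0} \<le> t * measure N {0}"
      using t by (simp add: mult_le_cancel_right1)
    ultimately show ?thesis
      unfolding Mq Nq[OF that] Nq[OF ta] using t by (auto simp: distrib_left)
  qed
  consider "a = b" | "a < b" "0 \<le> a" | "a < b" "b \<le> 0" | "a < 0" "0 < b" using \<open>a \<le> b\<close> by linarith
  then show "measure M {t * a<..t * b} \<le> t * measure M {a<..b}"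
  proof cases
    case 4
    have split: "measure M {p<..q} = measure M {p<..0} + measure M {0<..q}" if "p < 0" "0 < q" for p q
    proof -
      have "measure M ({p<..0} \<union> {0<..q}) = measure M {p<..0} + measure M {0<..q}"
        by (rule M.finite_measure_Union) auto
      moreover have "{p<..0} \<union> {0<..q} = {p<..q}" using that by auto
      ultimately show ?thesis by simp
    qed
    have "t * a < 0" "0 < t * b" using 4 t by (auto simp: mult_less_0_iff)
    then show ?thesis
      using neg[of a 0] M.measure_Ioc_scale_le[OF conn t, of 0 b] 4 t split by (simp add: distrib_left)
  qed (use neg M.measure_Ioc_scale_le[OF conn t] in auto)
qed

section \<open>Level curves for unimodal measures\<close>

text \<open>The Noshiro--Warschawski criterion for \<open>w \<mapsto> G (exp w)\<close> on the convex strip \<open>0 < Im w < pi\<close>.\<close>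
lemma inj_on_if_Im_radial_deriv_pos:
  assumes hol: "G holomorphic_on upper_half_plane"
    and pos: "\<And>z. Im z > 0 \<Longrightarrow> Im (z * deriv G z) > 0"
  shows "inj_on G upper_half_plane"
proof (rule inj_onI, rule ccontr)
  fix z1 z2 assume z: "z1 \<in> upper_half_plane" "z2 \<in> upper_half_plane" "G z1 = G z2" "z1 \<noteq> z2"
  then have z0: "z1 \<noteq> 0" "z2 \<noteq> 0" and zp: "Im z1 > 0" "Im z2 > 0" by (auto simp: upper_half_plane_def)
  define w1 w2 where "w1 = Ln z1" and "w2 = Ln z2"
  have ex: "exp w1 = z1" "exp w2 = z2" using z0 by (simp_all add: w1_def w2_def)
  define d where "d = w2 - w1"
  have d: "d \<noteq> 0" using ex z(4) by (auto simp: d_def)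
  \<comment> \<open>Logarithms of points of the half-plane lie in this convex strip, so the segment
    between them is mapped by \<open>exp\<close> back into the half-plane.\<close>
  have strip: "0 < Im w1" "Im w1 < pi" "0 < Im w2" "Im w2 < pi"
    using Im_Ln_pos_lt[OF z0(1)] Im_Ln_pos_lt[OF z0(2)] zp by (auto simp: w1_def w2_def)
  define \<zeta> where "\<zeta> x = exp (w1 + complex_of_real x * d)" for x
  have \<zeta>: "Im (\<zeta> x) > 0" if "0 \<le> x" "x \<le> 1" for x
  proof -
    have "convex {0<..<pi}" by simp
    then have "(1 - x) *\<^sub>R Im w1 + x *\<^sub>R Im w2 \<in> {0<..<pi}"
      using strip that by (intro convexD) auto
    moreover have "Im (w1 + complex_of_real x * d) = (1 - x) *\<^sub>R Im w1 + x *\<^sub>R Im w2"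
      by (simp add: d_def algebra_simps)
    ultimately have "0 < Im (w1 + complex_of_real x * d)" "Im (w1 + complex_of_real x * d) < pi" by auto
    then show ?thesis unfolding \<zeta>_def Im_exp by (intro mult_pos_pos sin_gt_zero) auto
  qed
  \<comment> \<open>Division by the direction \<open>d\<close> cancels the chain-rule factor: the
    derivative along the segment becomes \<open>\<zeta> x * deriv G (\<zeta> x)\<close>, whose
    imaginary part is positive.\<close>
  have "Im (G (\<zeta> 0) / d) < Im (G (\<zeta> 1) / d)"
  proof (rule DERIV_pos_imp_increasing[of 0 1 "\<lambda>x. Im (G (\<zeta> x) / d)"])
    fix x :: real assume x: "0 \<le> x" "x \<le> 1"
    have opn: "open upper_half_plane" by (simp add: upper_half_plane_def open_halfspace_Im_gt)
    have "(\<zeta> has_vector_derivative d * \<zeta> x) (at x)"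
    proof -
      have "((\<lambda>w. exp (w1 + w * d)) has_field_derivative d * exp (w1 + complex_of_real x * d)) (at (complex_of_real x))"
        by (auto intro!: derivative_eq_intros)
      moreover have "((\<lambda>x. complex_of_real x) has_vector_derivative 1) (at x)"
        by (auto intro!: derivative_eq_intros simp: has_vector_derivative_def scaleR_conv_of_real)
      ultimately show ?thesis
        using field_vector_diff_chain_at[of complex_of_real 1 x "\<lambda>w. exp (w1 + w * d)"]
        by (simp add: comp_def \<zeta>_def[abs_def])
    qed
    moreover have "(G has_field_derivative deriv G (\<zeta> x)) (at (\<zeta> x))"
      using holomorphic_derivI[OF hol opn] \<zeta>[OF x] by (simp add: upper_half_plane_def)
    ultimately have "((G \<circ> \<zeta>) has_vector_derivative d * \<zeta> x * deriv G (\<zeta> x)) (at x)"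
      by (rule field_vector_diff_chain_at)
    then have "((\<lambda>x. G (\<zeta> x) / d) has_vector_derivative d * \<zeta> x * deriv G (\<zeta> x) / d) (at x)"
      unfolding comp_def by (rule has_vector_derivative_divide)
    then have "((\<lambda>x. Im (G (\<zeta> x) / d)) has_vector_derivative Im (\<zeta> x * deriv G (\<zeta> x))) (at x)"
      using d bounded_linear.has_vector_derivative[OF bounded_linear_Im] by fastforce
    then show "\<exists>y. ((\<lambda>x. Im (G (\<zeta> x) / d)) has_real_derivative y) (at x) \<and> 0 < y"
      using pos[OF \<zeta>[OF x]] by (auto simp: has_real_derivative_iff_has_vector_derivative)
  qed simp
  moreover have "\<zeta> 0 = z1" "\<zeta> 1 = z2" by (simp_all add: \<zeta>_def d_def ex)
  ultimately show False using z(3) by simp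
qed

lemma continuous_on_implicit_decreasing:
  fixes \<phi> :: "real \<Rightarrow> real \<Rightarrow> real"
  assumes cont: "\<And>r. 0 < r \<Longrightarrow> continuous_on S (\<lambda>x. \<phi> x r)"
    and dec: "\<And>x r s. x \<in> S \<Longrightarrow> 0 < r \<Longrightarrow> r < s \<Longrightarrow> \<phi> x s < \<phi> x r"
    and \<rho>: "\<And>x. x \<in> S \<Longrightarrow> 0 < \<rho> x" "\<And>x. x \<in> S \<Longrightarrow> \<phi> x (\<rho> x) = c"
  shows "continuous_on S \<rho>"
  unfolding continuous_on_def
proof (intro ballI order_tendstoI)
  fix x assume x: "x \<in> S"
  have inS: "\<forall>\<^sub>F x' in at x within S. x' \<in> S" by (simp add: eventually_at_filter)
  have lim: "((\<lambda>x. \<phi> x r) \<longlongrightarrow> \<phi> x r) (at x within S)" if "r > 0" for r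
    using cont[OF that] x by (simp add: continuous_on_def)
  show "\<forall>\<^sub>F x' in at x within S. a < \<rho> x'" if "a < \<rho> x" for a
  proof (cases "a \<le> 0")
    case True
    show ?thesis using inS by eventually_elim (use True \<rho>(1) in force)
  next
    case False
    then have "c < \<phi> x a" using dec[OF x, of a "\<rho> x"] \<rho>(2)[OF x] that by simp
    then have "\<forall>\<^sub>F x' in at x within S. c < \<phi> x' a" using lim[of a] False order_tendstoD(1) by fastforce
    with inS show ?thesis
    proof eventually_elim
      case (elim x')
      then show ?case using dec[OF elim(1), of "\<rho> x'" a] \<rho>[OF elim(1)] False
        by (metis less_asym linorder_neqE_linordered_idom order_less_irrefl)
    qed
  qed
  show "\<forall>\<^sub>F x' in at x within S. \<rho> x' < a" if "\<rho> x < a" for a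
  proof -
    have a: "a > 0" using \<rho>(1)[OF x] that by simp
    then have "\<phi> x a < c" using dec[OF x, of "\<rho> x" a] \<rho>[OF x] that by simp
    then have "\<forall>\<^sub>F x' in at x within S. \<phi> x' a < c" using lim[of a] a order_tendstoD(2) by fastforce
    with inS show ?thesis
    proof eventually_elim
      case (elim x')
      then show ?case using dec[OF elim(1), of a "\<rho> x'"] \<rho>[OF elim(1)] a
        by (metis less_asym linorder_neqE_linordered_idom order_less_irrefl)
    qed
  qed
qed

text \<open>The substitution \<open>u = r * (v + x)\<close> turns the kernel into
  \<open>1 / (1 + v^2)\<close>. The radius then occurs only in the argument of \<open>h\<close> and
  in the atom term, both monotone in \<open>r\<close> for a unimodal measure.\<close>

lemma height_ray_eq:
  assumes "real_distribution M"
    and em: "\<And>A. A \<in> sets borel \<Longrightarrow> emeasure M A = (\<integral>\<^sup>+x. h x * indicator A x \<partial>lborel) + m * indicator A (0::real)"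
    and [measurable]: "h \<in> borel_measurable borel" and r: "r > 0"
  shows "ennreal (- Im (cauchy_transform M (Complex (r * x) r)))
    = (\<integral>\<^sup>+v. h (r * (v + x)) * ennreal (1 / (1 + v\<^sup>2)) \<partial>lborel) + m * ennreal (1 / (r * (1 + x\<^sup>2)))"
proof -
  interpret M: real_distribution M by fact
  let ?z = "Complex (r * x) r"
  have "ennreal (- Im (cauchy_transform M ?z)) = (\<integral>\<^sup>+u. ennreal (cauchy_height ?z u) \<partial>M)"
    using r by (simp add: M.nn_integral_cauchy_height)
  also have "\<dots> = (\<integral>\<^sup>+u. ennreal (cauchy_height ?z u) \<partial>density lborel h) + (\<integral>\<^sup>+u. ennreal (cauchy_height ?z u) \<partial>scale_measure m (return borel 0))"
    by (rule nn_integral_add_measure) (auto simp: em emeasure_density)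
  also have "(\<integral>\<^sup>+u. ennreal (cauchy_height ?z u) \<partial>scale_measure m (return borel 0)) = m * ennreal (1 / (r * (1 + x\<^sup>2)))"
  proof -
    have "cauchy_height ?z 0 = r / (r * (r * (1 + x\<^sup>2)))"
      by (simp add: cauchy_height_def power2_eq_square algebra_simps)
    then have "cauchy_height ?z 0 = 1 / (r * (1 + x\<^sup>2))" using r by simp
    then show ?thesis by (simp add: nn_integral_scale_measure nn_integral_return)
  qed
  also have "(\<integral>\<^sup>+u. ennreal (cauchy_height ?z u) \<partial>density lborel h) = (\<integral>\<^sup>+u. h u * ennreal (cauchy_height ?z u) \<partial>lborel)"
    by (subst nn_integral_density) auto
  also have "\<dots> = ennreal \<bar>r\<bar> * (\<integral>\<^sup>+v. h (r * x + r * v) * ennreal (cauchy_height ?z (r * x + r * v)) \<partial>lborel)"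
    using r by (intro nn_integral_real_affine) auto
  also have "\<dots> = (\<integral>\<^sup>+v. ennreal r * (h (r * x + r * v) * ennreal (cauchy_height ?z (r * x + r * v))) \<partial>lborel)"
    using r by (subst nn_integral_cmult) auto
  also have "\<dots> = (\<integral>\<^sup>+v. h (r * (v + x)) * ennreal (1 / (1 + v\<^sup>2)) \<partial>lborel)"
  proof (intro nn_integral_cong)
    fix v
    have "cauchy_height ?z (r * x + r * v) = r / (r * (r * (1 + v\<^sup>2)))"
      by (simp add: cauchy_height_def power2_eq_square algebra_simps)
    then have "r * cauchy_height ?z (r * x + r * v) = 1 / (1 + v\<^sup>2)" using r by simp
    then have "ennreal r * ennreal (cauchy_height ?z (r * x + r * v)) = ennreal (1 / (1 + v\<^sup>2))"
      using r by (simp add: ennreal_mult'[symmetric])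
    then show "ennreal r * (h (r * x + r * v) * ennreal (cauchy_height ?z (r * x + r * v))) = h (r * (v + x)) * ennreal (1 / (1 + v\<^sup>2))"
      by (simp only: mult.left_commute[of "ennreal r"] distrib_left add.commute)
  qed
  finally show ?thesis .
qed

text \<open>As \<open>r\<close> decreases to \<open>0\<close>, the heights along the ray through \<open>x + \<i>\<close> increase to the integral of
  a two-valued step density, which is monotone in \<open>x\<close>; hence superlevel sets in \<open>x\<close> are intervals.\<close>
lemma height_ray_intermediate:
  assumes M: "real_distribution M" and uni: "unimodal M 0"
    and x: "x1 < x0" "x0 < x2" and r: "r1 > 0" "r2 > 0"
    and gt: "c < - Im (cauchy_transform M (Complex (r1 * x1) r1))" "c < - Im (cauchy_transform M (Complex (r2 * x2) r2))"
  shows "\<exists>r>0. c < - Im (cauchy_transform M (Complex (r * x0) r))"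
proof -
  interpret M: real_distribution M by fact
  obtain f g m where fg: "\<And>x. x < 0 \<Longrightarrow> 0 \<le> f x" "mono_on {..<0} f" "\<And>x. x > 0 \<Longrightarrow> 0 \<le> g x" "antimono_on {0<..} g"
    and em0: "\<And>A. A \<in> sets borel \<Longrightarrow> emeasure M A = 
        (\<integral>\<^sup>+x. (ennreal (f x) * indicator {..<0} x + ennreal (g x) * indicator {0<..} x) * indicator A x \<partial>lborel)
        + m * indicator A (0::real)"
    and meas: "(\<lambda>x. ennreal (f x) * indicator {..<0::real} x + ennreal (g x) * indicator {0<..} x) \<in> borel_measurable borel"
    using unimodal_emeasure[OF uni] by blast
  define h where "h x = ennreal (f x) * indicator {..<0::real} x + ennreal (g x) * indicator {0<..} x" for x
  have hm [measurable]: "h \<in> borel_measurable borel" using meas by (simp add: h_def[abs_def])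
  have em: "\<And>A. A \<in> sets borel \<Longrightarrow> emeasure M A = (\<integral>\<^sup>+x. h x * indicator A x \<partial>lborel) + m * indicator A (0::real)"
    using em0 by (simp add: h_def)
  have hf: "h u \<le> h v" if "u \<le> v" "v < 0" for u v
    using that fg(2) by (auto simp: h_def monotone_on_def intro!: ennreal_leI)
  have hg: "h v \<le> h u" if "u \<le> v" "0 < u" for u v
    using that fg(4) by (auto simp: h_def monotone_on_def intro!: ennreal_leI)
  have h0: "h 0 = 0" by (simp add: h_def)
  define s where "s n = inverse (real (Suc n))" for n
  have s: "s n > 0" for n by (simp add: s_def)
  have s_small: "\<exists>n. s n < e" if "e > 0" for e
    using reals_Archimedean[OF that] by (simp add: s_def)
  have ray: "ennreal (- Im (cauchy_transform M (Complex (r * x) r)))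
    = (\<integral>\<^sup>+v. h (r * (v + x)) * ennreal (1 / (1 + v\<^sup>2)) \<partial>lborel) + m * ennreal (1 / (r * (1 + x\<^sup>2)))"
    if "r > 0" for r x
    by (rule height_ray_eq[OF M _ hm that]) (rule em)
  \<comment> \<open>Shrinking the radius moves the argument towards the mode.\<close>
  have inc: "h (s n * u) \<le> h (s n' * u)" if "n \<le> n'" for n n' u
  proof -
    have le: "s n' \<le> s n" using that by (simp add: s_def)
    consider "u = 0" | "u < 0" | "u > 0" by linarith
    then show ?thesis
    proof cases
      case 2
      then show ?thesis using le s[of n'] by (intro hf) (auto simp: mult_le_cancel_right mult_pos_neg)
    next
      case 3
      then show ?thesis using le s[of n'] by (intro hg) (auto simp: mult_le_cancel_right)
    qed simp
  qed
  \<comment> \<open>Without an atom, it suffices to dominate the density on a given ray pointwise by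
    the density on the ray through \<open>x0\<close> at some smaller radii, which may depend on
    \<open>v\<close>. Monotone convergence then selects one radius.\<close>
  have dominate: "\<exists>r>0. c < - Im (cauchy_transform M (Complex (r * x0) r))"
    if m: "m = 0" and r': "r' > 0" and gt': "c < - Im (cauchy_transform M (Complex (r' * x') r'))"
      and dom: "\<And>v. v + x0 \<noteq> 0 \<Longrightarrow> \<exists>n. h (r' * (v + x')) \<le> h (s n * (v + x0))" for r' x'
  proof (cases "c < 0")
    case True
    then show ?thesis using M.Im_cauchy_transform_neg[of "Complex (1 * x0) 1"] by (intro exI[of _ 1]) auto
  next
    case False
    have "ennreal c < ennreal (- Im (cauchy_transform M (Complex (r' * x') r')))"
      using gt' False by (simp add: ennreal_lessI)
    also have "\<dots> = (\<integral>\<^sup>+v. h (r' * (v + x')) * ennreal (1 / (1 + v\<^sup>2)) \<partial>lborel)"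
      using ray[OF r', of x'] m by simp
    also have "\<dots> \<le> (\<integral>\<^sup>+v. (SUP n. h (s n * (v + x0)) * ennreal (1 / (1 + v\<^sup>2))) \<partial>lborel)"
    proof (rule nn_integral_mono_AE)
      show "AE v in lborel. h (r' * (v + x')) * ennreal (1 / (1 + v\<^sup>2)) \<le> (SUP n. h (s n * (v + x0)) * ennreal (1 / (1 + v\<^sup>2)))"
        using AE_lborel_singleton[of "- x0"]
      proof eventually_elim
        case (elim v)
        then have "v + x0 \<noteq> 0" by simp
        then obtain n where "h (r' * (v + x')) \<le> h (s n * (v + x0))" using dom by blast
        then show ?case by (intro SUP_upper2[of n]) (auto intro: mult_right_mono)
      qed
    qed
    also have "\<dots> = (SUP n. \<integral>\<^sup>+v. h (s n * (v + x0)) * ennreal (1 / (1 + v\<^sup>2)) \<partial>lborel)"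
      by (intro nn_integral_monotone_convergence_SUP) (auto simp: incseq_def le_fun_def intro!: mult_right_mono inc)
    finally obtain n where "ennreal c < (\<integral>\<^sup>+v. h (s n * (v + x0)) * ennreal (1 / (1 + v\<^sup>2)) \<partial>lborel)"
      unfolding less_SUP_iff by blast
    also have "\<dots> = ennreal (- Im (cauchy_transform M (Complex (s n * x0) (s n))))"
      using ray[OF s[of n], of x0] m by simp
    finally have "c < - Im (cauchy_transform M (Complex (s n * x0) (s n)))"
      using False by (simp add: ennreal_less_iff)
    then show ?thesis using s by blast
  qed
  show ?thesis
  proof (cases "m = 0")
    case False
    \<comment> \<open>The atom alone contributes \<open>m / (r * (1 + x0^2))\<close>, unbounded as
      \<open>r\<close> tends to 0, so every ray exceeds \<open>c\<close>. A finite \<open>e\<close>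
      replaces the extended-valued \<open>m\<close>, and \<open>r\<close> is chosen to make its
      contribution equal to \<open>\<bar>c\<bar> + 1\<close>.\<close>
    have "\<exists>e>0. ennreal e \<le> m"
    proof (cases m)
      case (real e)
      then show ?thesis using False by (intro exI[of _ e]) (auto simp: less_le)
    next
      case top
      then show ?thesis by (intro exI[of _ 1]) simp
    qed
    then obtain e where e: "0 < e" "ennreal e \<le> m" by blast
    define r where "r = e / ((\<bar>c\<bar> + 1) * (1 + x0\<^sup>2))"
    have p: "1 + x0\<^sup>2 > 0" by (intro add_pos_nonneg) auto
    have r0: "r > 0" unfolding r_def using e p by (intro divide_pos_pos mult_pos_pos) auto
    have "ennreal e * ennreal (1 / (r * (1 + x0\<^sup>2))) \<le> m * ennreal (1 / (r * (1 + x0\<^sup>2)))"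
      using e by (intro mult_right_mono) auto
    also have "\<dots> \<le> ennreal (- Im (cauchy_transform M (Complex (r * x0) r)))"
      unfolding ray[OF r0] by simp
    finally have "ennreal (e * (1 / (r * (1 + x0\<^sup>2)))) \<le> ennreal (- Im (cauchy_transform M (Complex (r * x0) r)))"
      using e by (subst ennreal_mult') auto
    moreover have "e * (1 / (r * (1 + x0\<^sup>2))) = \<bar>c\<bar> + 1"
    proof -
      have "k * (1 / (k / (C * q) * q)) = C" if "k > 0" "q > 0" for k C q :: real
        using that by simp
      then show ?thesis unfolding r_def using e p by blast
    qed
    ultimately have "\<bar>c\<bar> + 1 \<le> - Im (cauchy_transform M (Complex (r * x0) r))"
      using M.Im_cauchy_transform_neg[of "Complex (r * x0) r"] r0 by (subst (asm) ennreal_le_iff) auto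
    then show ?thesis using r0 by (intro exI[of _ r]) auto
  next
    case m: True
    show ?thesis
    \<comment> \<open>Either every value of \<open>h\<close> on the left is dominated by a value on
      the right, or some value on the left dominates all values on the right. In the first case the
      ray through \<open>x1\<close> is used: passing from \<open>v + x1\<close> to
      \<open>v + x0\<close> can only change the sign from negative to positive. In the second case
      \<open>x2\<close> is used, with the signs exchanged.\<close>
    proof (cases "\<forall>u<0. \<exists>v>0. h u \<le> h v")
      case True
      show ?thesis
      proof (rule dominate[OF m r(1) gt(1)])
        fix v assume "v + x0 \<noteq> 0"
        then consider "v + x0 < 0" | "v + x1 < 0" "v + x0 > 0" | "v + x1 > 0" "v + x0 > 0" | "v + x1 = 0"
          using x by linarith
        then show "\<exists>n. h (r1 * (v + x1)) \<le> h (s n * (v + x0))"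
        proof cases
          case 1
          then have "r1 * (v + x1) / (v + x0) > 0" using r x by (intro divide_neg_neg mult_pos_neg) auto
          then obtain n where "s n < r1 * (v + x1) / (v + x0)" using s_small by blast
          then have "r1 * (v + x1) \<le> s n * (v + x0)" using 1 by (simp add: field_simps)
          then show ?thesis using 1 s[of n] by (intro exI[of _ n] hf) (auto simp: mult_pos_neg)
        next
          case 2
          then have "r1 * (v + x1) < 0" using r by (simp add: mult_pos_neg)
          then obtain w where w: "w > 0" "h (r1 * (v + x1)) \<le> h w" using True by blast
          obtain n where "s n < w / (v + x0)" using s_small[of "w / (v + x0)"] w 2 by auto
          then have "s n * (v + x0) \<le> w" using 2 by (simp add: field_simps)
          then have "h w \<le> h (s n * (v + x0))" using 2 s[of n] by (intro hg) auto
          then show ?thesis using w order_trans by blast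
        next
          case 3
          then have "r1 * (v + x1) / (v + x0) > 0" using r by (intro divide_pos_pos mult_pos_pos) auto
          then obtain n where "s n < r1 * (v + x1) / (v + x0)" using s_small by blast
          then have "s n * (v + x0) \<le> r1 * (v + x1)" using 3 by (simp add: field_simps)
          then show ?thesis using 3 s[of n] by (intro exI[of _ n] hg) auto
        qed (simp add: h0)
      qed
    next
      case False
      then obtain u where u: "u < 0" "\<And>v. v > 0 \<Longrightarrow> h v \<le> h u" by (meson linear)
      show ?thesis
      proof (rule dominate[OF m r(2) gt(2)])
        fix v assume "v + x0 \<noteq> 0"
        then consider "v + x0 > 0" | "v + x2 > 0" "v + x0 < 0" | "v + x2 < 0" "v + x0 < 0" | "v + x2 = 0"
          using x by linarith
        then show "\<exists>n. h (r2 * (v + x2)) \<le> h (s n * (v + x0))"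
        proof cases
          case 1
          then have "r2 * (v + x2) / (v + x0) > 0" using r x by (intro divide_pos_pos mult_pos_pos) auto
          then obtain n where "s n < r2 * (v + x2) / (v + x0)" using s_small by blast
          then have "s n * (v + x0) \<le> r2 * (v + x2)" using 1 by (simp add: field_simps)
          then show ?thesis using 1 s[of n] by (intro exI[of _ n] hg) auto
        next
          case 2
          then have "h (r2 * (v + x2)) \<le> h u" using r by (intro u) auto
          moreover obtain n where "s n < u / (v + x0)"
            using s_small[of "u / (v + x0)"] u 2 by (auto intro: divide_neg_neg)
          then have "u \<le> s n * (v + x0)" using 2 by (simp add: field_simps)
          then have "h u \<le> h (s n * (v + x0))" using 2 s[of n] by (intro hf) (auto simp: mult_pos_neg)
          ultimately show ?thesis using order_trans by blast
        next
          case 3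
          then have "r2 * (v + x2) / (v + x0) > 0" using r by (intro divide_neg_neg mult_pos_neg) auto
          then obtain n where "s n < r2 * (v + x2) / (v + x0)" using s_small by blast
          then have "r2 * (v + x2) \<le> s n * (v + x0)" using 3 by (simp add: field_simps)
          then show ?thesis using 3 s[of n] by (intro exI[of _ n] hf) (auto simp: mult_pos_neg)
        qed (simp add: h0)
      qed
    qed
  qed
qed

section \<open>Equivalence of the conditions\<close>

definition mode_condition :: "(complex \<Rightarrow> complex) \<Rightarrow> real \<Rightarrow> bool" where
  "mode_condition G c \<longleftrightarrow>
     univalent_on G upper_half_plane \<and> horizontally_convex (G ` upper_half_plane) \<and>
     (\<exists>z :: nat \<Rightarrow> complex. (\<forall>n. z n \<in> upper_half_plane) \<and> z \<longlonglongrightarrow> complex_of_real c \<and>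
        (\<lambda>n. ereal (Im (G (z n)))) \<longlonglongrightarrow> (INF w\<in>upper_half_plane. ereal (Im (G w))))"

lemma connected_heights_if_mode_condition:
  assumes "real_distribution M" "mode_condition (cauchy_transform M) 0"
  shows "connected_heights_at_0 M"
proof -
  let ?G = "cauchy_transform M"
  have uni: "univalent_on ?G upper_half_plane" and hc: "horizontally_convex (?G ` upper_half_plane)"
    using assms(2) by (auto simp: mode_condition_def)
  obtain z where z: "\<And>n :: nat. Im (z n) > 0" "z \<longlonglongrightarrow> 0"
    and lim: "(\<lambda>n. ereal (Im (?G (z n)))) \<longlonglongrightarrow> (INF w\<in>upper_half_plane. ereal (Im (?G w)))"
    using assms(2) by (auto simp: mode_condition_def upper_half_plane_def)
  show ?thesis
    unfolding connected_heights_at_0_def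
  proof (intro conjI allI exI[of _ z] impI z)
    show "connected {z. Im z > 0 \<and> - Im (?G z) < c}" for c
      using connected_height_sets[OF uni hc, of 1 "- c"]
      by (simp add: upper_half_plane_def minus_less_iff)
    show "connected {z. Im z > 0 \<and> - Im (?G z) > c}" for c
      using connected_height_sets[OF uni hc, of "-1" c]
      by (simp add: upper_half_plane_def)
    fix w c assume w: "Im w > 0" "c < - Im (?G w)"
    have "(INF w\<in>upper_half_plane. ereal (Im (?G w))) \<le> ereal (Im (?G w))"
      using w by (intro INF_lower) (simp add: upper_half_plane_def)
    also have "\<dots> < ereal (- c)" using w by simp
    finally have "\<forall>\<^sub>F n in sequentially. ereal (Im (?G (z n))) < ereal (- c)"
      using lim order_tendstoD(2) by blast
    then show "\<forall>\<^sub>F n in sequentially. c < - Im (?G (z n))"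
      by eventually_elim simp
  qed
qed

context real_distribution
begin

lemma height_ray_strict_decreasing:
  assumes pos: "\<And>z. Im z > 0 \<Longrightarrow> Im (z * deriv (cauchy_transform M) z) > 0"
    and z: "Im z > 0" and r: "0 < r" "r < s"
  shows "Im (cauchy_transform M (complex_of_real r * z)) < Im (cauchy_transform M (complex_of_real s * z))"
proof (rule DERIV_pos_imp_increasing[OF r(2)])
  fix t assume t: "r \<le> t" "t \<le> s"
  then have t0: "t > 0" using r by simp
  then have "t * Im (z * deriv (cauchy_transform M) (complex_of_real t * z)) > 0"
    using pos[of "complex_of_real t * z"] z by (simp add: mult.assoc)
  then have "Im (z * deriv (cauchy_transform M) (complex_of_real t * z)) > 0"
    using t0 by (simp add: zero_less_mult_iff)
  then show "\<exists>y. ((\<lambda>r. Im (cauchy_transform M (complex_of_real r * z))) has_real_derivative y) (at t) \<and> 0 < y"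
    using DERIV_Im_cauchy_transform_radial[OF z t0] by blast
qed

text \<open>Any minimizing sequence can be pulled towards 0 along its rays, since this only lowers
  Im G. The factor \<open>s n\<close> is small enough to beat \<open>norm (w n)\<close>.\<close>

lemma ex_minimizing_sequence_at_0:
  assumes pos: "\<And>z. Im z > 0 \<Longrightarrow> Im (z * deriv (cauchy_transform M) z) > 0"
  shows "\<exists>z :: nat \<Rightarrow> complex. (\<forall>n. z n \<in> upper_half_plane) \<and> z \<longlonglongrightarrow> 0 \<and>
     (\<lambda>n. ereal (Im (cauchy_transform M (z n)))) \<longlonglongrightarrow> (INF w\<in>upper_half_plane. ereal (Im (cauchy_transform M w)))"
proof -
  define L where "L = (INF w\<in>upper_half_plane. ereal (Im (cauchy_transform M w)))"
  have "upper_half_plane \<noteq> {}" using complex.sel(2)[of 0 1] by (auto simp: upper_half_plane_def intro: exI[of _ \<i>])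
  then obtain u where u: "\<And>n :: nat. u n \<in> (\<lambda>w. ereal (Im (cauchy_transform M w))) ` upper_half_plane" "u \<longlonglongrightarrow> L"
    unfolding L_def using Inf_as_limit[of "(\<lambda>w. ereal (Im (cauchy_transform M w))) ` upper_half_plane"] by blast
  have "\<forall>n. \<exists>w. w \<in> upper_half_plane \<and> u n = ereal (Im (cauchy_transform M w))" using u(1) by blast
  then obtain w where w: "\<And>n. w n \<in> upper_half_plane" "\<And>n. u n = ereal (Im (cauchy_transform M (w n)))"
    by metis
  define s where "s n = inverse (real (Suc n)) * inverse (1 + norm (w n))" for n
  have s: "0 < s n" "s n \<le> 1" for n
  proof -
    show "0 < s n" unfolding s_def by (intro mult_pos_pos) (auto intro: add_pos_nonneg)
    have "inverse (real (Suc n)) \<le> 1" by (simp add: field_simps)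
    moreover have "inverse (1 + norm (w n)) \<le> 1" by (simp add: inverse_le_1_iff)
    ultimately show "s n \<le> 1" unfolding s_def by (intro mult_le_one) auto
  qed
  define z where "z n = complex_of_real (s n) * w n" for n
  have zU: "z n \<in> upper_half_plane" for n
    using w(1)[of n] s(1)[of n] by (simp add: z_def upper_half_plane_def)
  have "norm (z n) \<le> inverse (real (Suc n))" for n
  proof -
    have "norm (z n) = s n * norm (w n)" using s(1)[of n] by (simp add: z_def norm_mult)
    also have "\<dots> = inverse (real (Suc n)) * (norm (w n) / (1 + norm (w n)))"
      by (simp add: s_def divide_inverse)
    also have "\<dots> \<le> inverse (real (Suc n)) * 1"
      by (intro mult_left_mono) (auto simp: divide_le_eq_1 add_pos_nonneg)
    finally show ?thesis by simp
  qed
  then have z0: "z \<longlonglongrightarrow> 0"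
    by (intro Lim_null_comparison[OF _ LIMSEQ_inverse_real_of_nat]) simp
  have "(\<lambda>n. ereal (Im (cauchy_transform M (z n)))) \<longlonglongrightarrow> L"
  proof (rule tendsto_sandwich[OF _ _ tendsto_const u(2)])
    show "\<forall>\<^sub>F n in sequentially. L \<le> ereal (Im (cauchy_transform M (z n)))"
      unfolding L_def by (intro always_eventually allI INF_lower zU)
    have "Im (cauchy_transform M (z n)) \<le> Im (cauchy_transform M (w n))" for n
    proof (cases "s n = 1")
      case False
      then have "s n < 1" using s(2)[of n] by simp
      then show ?thesis
        using height_ray_strict_decreasing[OF pos _ s(1)[of n], of "w n" 1] w(1)[of n] by (simp add: z_def upper_half_plane_def)
    qed (simp add: z_def)
    then show "\<forall>\<^sub>F n in sequentially. ereal (Im (cauchy_transform M (z n))) \<le> u n"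
      using w(2) by simp
  qed
  then show ?thesis using zU z0 unfolding L_def by blast
qed

text \<open>Each ray between those through \<open>z1\<close> and \<open>z2\<close> meets the level
  exactly once: heights exceed it at some radius, fall to it or below far out, and decrease
  strictly. The radius depends continuously on the ray, so Re G takes an interval of values along
  the curve.\<close>

lemma ex_level_point:
  assumes uni: "unimodal M 0"
    and pos: "\<And>z. Im z > 0 \<Longrightarrow> Im (z * deriv (cauchy_transform M) z) > 0"
    and z: "Im z1 > 0" "Im z2 > 0" "Im (cauchy_transform M z1) = Im (cauchy_transform M z2)"
    and ord: "Re z1 / Im z1 \<le> Re z2 / Im z2"
    and v: "v \<in> closed_segment (Re (cauchy_transform M z1)) (Re (cauchy_transform M z2))"
  shows "\<exists>z. Im z > 0 \<and> Im (cauchy_transform M z) = Im (cauchy_transform M z1) \<and> Re (cauchy_transform M z) = v"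
proof -
  define x1 x2 where "x1 = Re z1 / Im z1" and "x2 = Re z2 / Im z2"
  define c where "c = - Im (cauchy_transform M z1)"
  \<comment> \<open>Ray coordinates: \<open>x\<close> is the quotient of real and imaginary part and
    \<open>r\<close> is the imaginary part.\<close>
  define \<gamma> where "\<gamma> x r = Complex (r * x) r" for x r :: real
  define \<phi> where "\<phi> x r = - Im (cauchy_transform M (\<gamma> x r))" for x r
  have \<gamma>: "\<gamma> x r = complex_of_real r * Complex x 1" for x r by (simp add: \<gamma>_def complex_eq_iff)
  have zg: "z1 = \<gamma> x1 (Im z1)" "z2 = \<gamma> x2 (Im z2)" using z by (auto simp: \<gamma>_def x1_def x2_def complex_eq_iff)
  have dec: "\<phi> x s < \<phi> x r" if "0 < r" "r < s" for x r s
    using height_ray_strict_decreasing[OF pos _ that, of "Complex x 1"] by (simp add: \<phi>_def \<gamma>)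
  have \<phi>12: "\<phi> x1 (Im z1) = c" "\<phi> x2 (Im z2) = c" using zg z(3) by (auto simp: \<phi>_def c_def)
  have contG: "continuous_on {z. Im z > 0} (cauchy_transform M)"
    using holomorphic_on_imp_continuous_on[OF holomorphic_cauchy_transform] by (simp add: upper_half_plane_def)
  have cont\<gamma>: "continuous_on S (\<lambda>y. \<gamma> (f y) (g y))" if "continuous_on S f" "continuous_on S g" for S f and g :: "real \<Rightarrow> real"
    unfolding \<gamma> Complex_eq by (intro continuous_intros that)
  have contG\<gamma>: "continuous_on S (\<lambda>y. cauchy_transform M (\<gamma> (f y) (g y)))"
    if "continuous_on S f" "continuous_on S g" "\<And>y. y \<in> S \<Longrightarrow> g y > 0" for S f and g :: "real \<Rightarrow> real"
    by (rule continuous_on_compose2[OF contG cont\<gamma>[OF that(1,2)]]) (use that(3) in \<open>auto simp: \<gamma>_def\<close>)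
  have ex: "\<exists>r>0. \<phi> x r = c" if x: "x \<in> {x1..x2}" for x
  proof -
    consider "x = x1" | "x = x2" | "x1 < x" "x < x2" using x by force
    then show ?thesis
    proof cases
      case 3
      \<comment> \<open>Halving the radius at both ends supplies the strict inequalities that
        \<open>height_ray_intermediate\<close> requires.\<close>
      have half: "c < \<phi> x1 (Im z1 / 2)" "c < \<phi> x2 (Im z2 / 2)"
        using dec[of "Im z1 / 2" "Im z1" x1] dec[of "Im z2 / 2" "Im z2" x2] \<phi>12 z by auto
      have "\<exists>r>0. c < - Im (cauchy_transform M (Complex (r * x) r))"
        by (rule height_ray_intermediate[OF real_distribution_axioms uni 3, of "Im z1 / 2" "Im z2 / 2"])
          (use half z in \<open>auto simp: \<phi>_def \<gamma>_def\<close>)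
      then obtain r where r: "r > 0" "c < \<phi> x r" by (auto simp: \<phi>_def \<gamma>_def)
      have c0: "c > 0" using Im_cauchy_transform_neg[OF z(1)] by (simp add: c_def)
      define s where "s = max r (1 / c)"
      have s: "s > 0" "r \<le> s" "1 / c \<le> s" using r by (auto simp: s_def)
      have "\<phi> x s \<le> 1 / s"
        using Im_cauchy_transform_ge[of "\<gamma> x s"] s by (simp add: \<phi>_def \<gamma>_def)
      also have "\<dots> \<le> c" using s c0 by (simp add: field_simps)
      finally have "\<exists>y. r \<le> y \<and> y \<le> s \<and> \<phi> x y = c"
        using r s unfolding \<phi>_def by (intro IVT2' continuous_intros contG\<gamma>) auto
      then show ?thesis using r by (auto intro: less_le_trans)
    qed (use \<phi>12 z in blast)+
  qed
  then obtain \<rho> where \<rho>: "\<And>x. x \<in> {x1..x2} \<Longrightarrow> \<rho> x > 0" "\<And>x. x \<in> {x1..x2} \<Longrightarrow> \<phi> x (\<rho> x) = c"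
    by metis
  have uniq: "r = s" if "0 < r" "0 < s" "\<phi> x r = \<phi> x s" for x r s
    using dec[of r s x] dec[of s r x] that by (metis less_irrefl linorder_neqE_linordered_idom)
  have x12: "x1 \<in> {x1..x2}" "x2 \<in> {x1..x2}" using ord by (auto simp: x1_def x2_def)
  have ends: "\<rho> x1 = Im z1" "\<rho> x2 = Im z2"
    using uniq[of "\<rho> x1" "Im z1" x1] uniq[of "\<rho> x2" "Im z2" x2] \<rho> x12 \<phi>12 z by auto
  have "continuous_on {x1..x2} \<rho>"
  proof (rule continuous_on_implicit_decreasing[of _ \<phi>])
    show "continuous_on {x1..x2} (\<lambda>x. \<phi> x r)" if "0 < r" for r
      unfolding \<phi>_def using that by (intro continuous_intros contG\<gamma>) auto
  qed (use dec \<rho> in auto)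
  then have "continuous_on {x1..x2} (\<lambda>x. Re (cauchy_transform M (\<gamma> x (\<rho> x))))"
    by (intro continuous_intros contG\<gamma> \<rho>)
  then have "connected ((\<lambda>x. Re (cauchy_transform M (\<gamma> x (\<rho> x)))) ` {x1..x2})"
    by (intro connected_continuous_image) auto
  then have cvx: "convex ((\<lambda>x. Re (cauchy_transform M (\<gamma> x (\<rho> x)))) ` {x1..x2})"
    by (simp add: connected_convex_1)
  have "Re (cauchy_transform M z1) \<in> (\<lambda>x. Re (cauchy_transform M (\<gamma> x (\<rho> x)))) ` {x1..x2}"
    using zg(1) ends(1) x12(1) by (intro image_eqI[of _ _ x1]) auto
  moreover have "Re (cauchy_transform M z2) \<in> (\<lambda>x. Re (cauchy_transform M (\<gamma> x (\<rho> x)))) ` {x1..x2}"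
    using zg(2) ends(2) x12(2) by (intro image_eqI[of _ _ x2]) auto
  ultimately have "v \<in> (\<lambda>x. Re (cauchy_transform M (\<gamma> x (\<rho> x)))) ` {x1..x2}"
    using closed_segment_subset[OF _ _ cvx] v by blast
  then obtain x where x: "x \<in> {x1..x2}" "v = Re (cauchy_transform M (\<gamma> x (\<rho> x)))" by blast
  then show ?thesis
    using \<rho>[OF x(1)] by (intro exI[of _ "\<gamma> x (\<rho> x)"]) (auto simp: \<phi>_def c_def \<gamma>_def)
qed

lemma horizontally_convex_image:
  assumes uni: "unimodal M 0"
    and pos: "\<And>z. Im z > 0 \<Longrightarrow> Im (z * deriv (cauchy_transform M) z) > 0"
  shows "horizontally_convex (cauchy_transform M ` upper_half_plane)"
  unfolding horizontally_convex_def
proof (intro ballI impI allI)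
  fix w1 w2 and t :: real
  assume "w1 \<in> cauchy_transform M ` upper_half_plane" "w2 \<in> cauchy_transform M ` upper_half_plane"
    and Im: "Im w1 = Im w2" and t: "0 < t \<and> t < 1"
  then obtain z1 z2 where z: "Im z1 > 0" "w1 = cauchy_transform M z1" "Im z2 > 0" "w2 = cauchy_transform M z2"
    by (auto simp: upper_half_plane_def)
  define w where "w = complex_of_real (1 - t) * w1 + complex_of_real t * w2"
  have Imw: "Im w = Im w1" using Im by (simp add: w_def algebra_simps)
  have seg: "Re w \<in> closed_segment (Re w1) (Re w2)"
    using t by (auto simp: w_def in_segment intro!: exI[of _ t])
  have "\<exists>z. Im z > 0 \<and> Im (cauchy_transform M z) = Im w1 \<and> Re (cauchy_transform M z) = Re w"
  proof (cases "Re z1 / Im z1 \<le> Re z2 / Im z2")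
    case True
    then show ?thesis using ex_level_point[OF uni pos z(1,3) _ True, of "Re w"] Im seg z by simp
  next
    case False
    then show ?thesis using ex_level_point[OF uni pos z(3,1), of "Re w"] Im seg z by (simp add: closed_segment_commute)
  qed
  then obtain z0 where "Im z0 > 0" "cauchy_transform M z0 = w" using Imw by (auto simp: complex_eq_iff)
  then show "complex_of_real (1 - t) * w1 + complex_of_real t * w2 \<in> cauchy_transform M ` upper_half_plane"
    unfolding w_def[symmetric] by (auto simp: upper_half_plane_def)
qed

end

text \<open>All implications pass through the mixture representation: each condition gives it, and
  from it follow all conditions. In particular the derivative condition becomes strict, as
  univalence and the level curves require.\<close>

lemma equivalences_at_0:
  assumes M: "real_distribution M"
  shows "subscaling M \<longleftrightarrow> unimodal M 0"
    and "subscaling M \<longleftrightarrow> scaled_uniform_law M 0"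
    and "subscaling M \<longleftrightarrow> (\<forall>z\<in>upper_half_plane. Im (z * deriv (cauchy_transform M) z) \<ge> 0)"
    and "subscaling M \<longleftrightarrow> mode_condition (cauchy_transform M) 0"
proof -
  interpret M: real_distribution M by fact
  have "unimodal M 0 \<and> scaled_uniform_law M 0 \<and> (\<forall>z\<in>upper_half_plane. Im (z * deriv (cauchy_transform M) z) \<ge> 0)
     \<and> mode_condition (cauchy_transform M) 0" if mix: "\<exists>N. real_distribution N \<and> M = uniform_mixture N"
  proof -
    obtain N where N: "real_distribution N" "M = uniform_mixture N" using mix by blast
    have uni: "unimodal M 0" using unimodal_uniform_mixture[OF N(1)] N(2) by simp
    have pos: "Im (z * deriv (cauchy_transform M) z) > 0" if "Im z > 0" for z
      using Im_deriv_uniform_mixture_pos[OF N(1) that] N(2) by simp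
    have "mode_condition (cauchy_transform M) 0"
      unfolding mode_condition_def univalent_on_def
      using M.holomorphic_cauchy_transform inj_on_if_Im_radial_deriv_pos[OF M.holomorphic_cauchy_transform pos]
        M.horizontally_convex_image[OF uni pos] M.ex_minimizing_sequence_at_0[OF pos] by simp
    then show ?thesis
      using uni pos scaled_uniform_law_uniform_mixture[OF N(1)] N(2) by (auto simp: upper_half_plane_def less_imp_le)
  qed
  moreover have "subscaling M \<Longrightarrow> \<exists>N. real_distribution N \<and> M = uniform_mixture N"
    by (rule eq_uniform_mixture_if_subscaling[OF M])
  moreover have "scaled_uniform_law M 0 \<Longrightarrow> \<exists>N. real_distribution N \<and> M = uniform_mixture N"
    by (rule real_distribution_scaled_uniform_imp)
  moreover have "unimodal M 0 \<Longrightarrow> subscaling M" by (rule subscaling_if_unimodal[OF M])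
  moreover have "\<forall>z\<in>upper_half_plane. Im (z * deriv (cauchy_transform M) z) \<ge> 0 \<Longrightarrow> subscaling M"
    by (rule subscaling_if_Im_deriv_nonneg[OF M]) (simp add: upper_half_plane_def)
  moreover have "mode_condition (cauchy_transform M) 0 \<Longrightarrow> subscaling M"
    by (intro subscaling_if_connected_heights M connected_heights_if_mode_condition)
  ultimately show "subscaling M \<longleftrightarrow> unimodal M 0"
    "subscaling M \<longleftrightarrow> scaled_uniform_law M 0"
    "subscaling M \<longleftrightarrow> (\<forall>z\<in>upper_half_plane. Im (z * deriv (cauchy_transform M) z) \<ge> 0)"
    "subscaling M \<longleftrightarrow> mode_condition (cauchy_transform M) 0"
    by blast+
qed

section \<open>Translation of the mode to 0\<close>

definition translate :: "real \<Rightarrow> real measure \<Rightarrow> real measure" where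
  "translate d M = distr M borel (\<lambda>x. x + d)"

lemma translate_translate: "sets M = sets borel \<Longrightarrow> translate d (translate e M) = translate (e + d) M"
  unfolding translate_def by (subst distr_distr) (auto simp: comp_def add.assoc cong: measurable_cong_sets)

lemma translate_0: "sets M = sets borel \<Longrightarrow> translate 0 M = M"
  unfolding translate_def by (simp add: distr_id2)

lemma cauchy_transform_translate:
  assumes "sets M = sets borel"
  shows "cauchy_transform (translate d M) z = cauchy_transform M (z - complex_of_real d)"
proof -
  have [measurable_cong]: "sets M = sets borel" by fact
  show ?thesis unfolding cauchy_transform_def translate_def
    by (subst integral_distr) (auto simp: algebra_simps)
qed

lemma scaled_uniform_law_translate:
  assumes "scaled_uniform_law M c"
  shows "scaled_uniform_law (translate d M) (c + d)"
proof -
  obtain W :: "(real \<times> real) measure" and X U where W: "scaled_uniform_on W X U M c"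
    using assms unfolding scaled_uniform_law_def by blast
  then interpret W: prob_space W by (simp add: scaled_uniform_on_def)
  have "W.indep_var borel X borel U" using W by (simp add: scaled_uniform_on_def)
  then have [measurable]: "X \<in> borel_measurable W" "U \<in> borel_measurable W"
    by (auto dest: W.indep_var_rv1 W.indep_var_rv2)
  have "M = distr W borel (\<lambda>\<omega>. U \<omega> * X \<omega> + c)" using W by (simp add: scaled_uniform_on_def)
  then have "translate d M = distr W borel (\<lambda>\<omega>. U \<omega> * X \<omega> + (c + d))"
    unfolding translate_def by (simp add: distr_distr comp_def add.assoc)
  then have "scaled_uniform_on W X U (translate d M) (c + d)"
    using W unfolding scaled_uniform_on_def by simp
  then show ?thesis unfolding scaled_uniform_law_def by blast
qed

lemma unimodal_translate:
  assumes "unimodal M c"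
  shows "unimodal (translate d M) (c + d)"
proof -
  have [measurable_cong]: "sets M = sets borel" using assms by (simp add: unimodal_def)
  obtain f g :: "real \<Rightarrow> real" and m :: ennreal where fg: "\<And>x. x < c \<Longrightarrow> 0 \<le> f x" "mono_on {..<c} f" "\<And>x. x > c \<Longrightarrow> 0 \<le> g x" "antimono_on {c<..} g"
    and em: "\<And>A. A \<in> sets borel \<Longrightarrow> emeasure M A = 
      (\<integral>\<^sup>+x\<in>A. (ennreal (f x) * indicator {..<c} x) \<partial>lborel)
             + m * emeasure (return borel c) A
             + (\<integral>\<^sup>+x\<in>A. (ennreal (g x) * indicator {c<..} x) \<partial>lborel)"
    using assms unfolding unimodal_def by blast
  have "f \<in> borel_measurable (restrict_space borel {..<c})"
    using fg(2) by (intro borel_measurable_mono_on_fnc)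
  then have "(\<lambda>x. ennreal (f x)) \<in> borel_measurable (restrict_space borel {..<c})" by simp
  then have mf [measurable]: "(\<lambda>x. ennreal (f x) * indicator {..<c} x) \<in> borel_measurable borel"
    by (subst (asm) borel_measurable_restrict_space_iff_ennreal) auto
  have "mono_on {c<..} (\<lambda>x. - g x)"
    using fg(4) by (auto simp: monotone_on_def)
  then have "(\<lambda>x. - g x) \<in> borel_measurable (restrict_space borel {c<..})"
    by (intro borel_measurable_mono_on_fnc)
  then have "(\<lambda>x. - (- g x)) \<in> borel_measurable (restrict_space borel {c<..})"
    by (rule borel_measurable_uminus)
  then have "(\<lambda>x. ennreal (g x)) \<in> borel_measurable (restrict_space borel {c<..})" by simp
  then have mg [measurable]: "(\<lambda>x. ennreal (g x) * indicator {c<..} x) \<in> borel_measurable borel"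
    by (subst (asm) borel_measurable_restrict_space_iff_ennreal) auto
  have shift: "(\<integral>\<^sup>+x. h x * indicator ((\<lambda>x. x + d) -` A) x \<partial>lborel) = (\<integral>\<^sup>+x. h (x - d) * indicator A x \<partial>lborel)"
    if [measurable]: "h \<in> borel_measurable borel" "A \<in> sets borel" for h :: "real \<Rightarrow> ennreal" and A
    by (subst nn_integral_real_affine[where c = 1 and t = "- d"])
      (auto simp: measurable_sets_borel[of "\<lambda>x. x + d" borel A] indicator_def intro!: nn_integral_cong)
  show ?thesis
    unfolding unimodal_def
  proof (rule conjI, simp add: translate_def, rule exI[of _ "\<lambda>x. f (x - d)"], rule exI[of _ "\<lambda>x. g (x - d)"],
      rule exI[of _ m], intro conjI allI impI ballI)
    show "0 \<le> f (x - d)" if "x < c + d" for x using fg(1) that by simp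
    show "0 \<le> g (x - d)" if "x > c + d" for x using fg(3) that by simp
    show "mono_on {..<c + d} (\<lambda>x. f (x - d))" using fg(2) by (auto simp: monotone_on_def)
    show "antimono_on {c + d<..} (\<lambda>x. g (x - d))" using fg(4) by (auto simp: monotone_on_def)
    fix A :: "real set" assume A [measurable]: "A \<in> sets borel"
    have [measurable]: "(\<lambda>x. x + d) -` A \<in> sets borel" by (rule measurable_sets_borel[OF _ A]) simp
    have i: "indicator {..<c} (x - d) = (indicator {..<c + d} x :: ennreal)" "indicator {c<..} (x - d) = (indicator {c + d<..} x :: ennreal)"
       "indicator ((\<lambda>x. x + d) -` A) c = (indicator A (c + d) :: ennreal)" for x
      by (auto simp: indicator_def)
    have "emeasure (translate d M) A = emeasure M ((\<lambda>x. x + d) -` A)"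
      unfolding translate_def using sets_eq_imp_space_eq[OF \<open>sets M = sets borel\<close>] by (subst emeasure_distr) auto
    then show "emeasure (translate d M) A =
             (\<integral>\<^sup>+x\<in>A. (ennreal (f (x - d)) * indicator {..<c + d} x) \<partial>lborel)
             + m * emeasure (return borel (c + d)) A
             + (\<integral>\<^sup>+x\<in>A. (ennreal (g (x - d)) * indicator {c + d<..} x) \<partial>lborel)"
      using em[of "(\<lambda>x. x + d) -` A"] shift[OF mf A] shift[OF mg A] by (simp add: i)
  qed
qed

lemma mode_condition_translate:
  assumes "mode_condition G c"
  shows "mode_condition (\<lambda>z. G (z - complex_of_real d)) (c + d)"
proof -
  let ?T = "\<lambda>z. z - complex_of_real d"
  have T: "?T ` upper_half_plane = upper_half_plane"
  proof -
    have "z \<in> ?T ` upper_half_plane" if "z \<in> upper_half_plane" for z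
      using that by (intro image_eqI[of _ _ "z + complex_of_real d"]) (auto simp: upper_half_plane_def)
    then show ?thesis by (auto simp: upper_half_plane_def)
  qed
  have img: "(\<lambda>z. F (z - complex_of_real d)) ` upper_half_plane = F ` upper_half_plane" for F :: "complex \<Rightarrow> 'b"
    using image_image[of F ?T upper_half_plane] T by simp
  have uni: "G holomorphic_on upper_half_plane" "inj_on G upper_half_plane"
    and hc: "horizontally_convex (G ` upper_half_plane)"
    using assms by (auto simp: mode_condition_def univalent_on_def)
  obtain z where z: "\<And>n :: nat. z n \<in> upper_half_plane" "z \<longlonglongrightarrow> complex_of_real c"
    and lim: "(\<lambda>n. ereal (Im (G (z n)))) \<longlonglongrightarrow> (INF w\<in>upper_half_plane. ereal (Im (G w)))"
    using assms by (auto simp: mode_condition_def)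
  have "?T holomorphic_on upper_half_plane" by (intro holomorphic_intros)
  from holomorphic_on_compose_gen[OF this uni(1)]
  have "(\<lambda>z. G (z - complex_of_real d)) holomorphic_on upper_half_plane"
    using T by (simp add: comp_def)
  moreover have "inj_on (\<lambda>z. G (z - complex_of_real d)) upper_half_plane"
    using comp_inj_on[of ?T upper_half_plane G] uni(2) T by (simp add: comp_def inj_on_def)
  moreover have "(\<lambda>n. z n + complex_of_real d) \<longlonglongrightarrow> complex_of_real (c + d)"
    using tendsto_add[OF z(2) tendsto_const[of "complex_of_real d"]] by simp
  moreover have "(INF w\<in>upper_half_plane. ereal (Im (G (w - complex_of_real d)))) = (INF w\<in>upper_half_plane. ereal (Im (G w)))"
    using img[of "\<lambda>w. ereal (Im (G w))"] by simp
  moreover have "z n + complex_of_real d \<in> upper_half_plane" for n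
    using z(1)[of n] by (simp add: upper_half_plane_def)
  ultimately show ?thesis
    unfolding mode_condition_def univalent_on_def using hc lim
    by (auto simp: img intro!: exI[of _ "\<lambda>n. z n + complex_of_real d"])
qed

theorem theorem1p23:
  fixes \<mu> :: "real measure" and c :: real
  assumes "prob_space \<mu>" and "sets \<mu> = sets borel"
  shows
    "(unimodal \<mu> c \<longleftrightarrow>
        (\<forall>z\<in>upper_half_plane.
           Im ((z - complex_of_real c) * deriv (cauchy_transform \<mu>) z) \<ge> 0))
     \<and> (unimodal \<mu> c \<longleftrightarrow> scaled_uniform_law \<mu> c)
     \<and> (unimodal \<mu> c \<longleftrightarrow>
          univalent_on (cauchy_transform \<mu>) upper_half_plane
          \<and> horizontally_convex (cauchy_transform \<mu> ` upper_half_plane)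
          \<and> (\<exists>z :: nat \<Rightarrow> complex.
                (\<forall>n. z n \<in> upper_half_plane)
                \<and> z \<longlonglongrightarrow> complex_of_real c
                \<and> (\<lambda>n. ereal (Im (cauchy_transform \<mu> (z n))))
                    \<longlonglongrightarrow> (INF w\<in>upper_half_plane. ereal (Im (cauchy_transform \<mu> w)))))"
proof -
  interpret \<mu>: real_distribution \<mu>
    using assms by (simp add: real_distribution_def real_distribution_axioms_def)
  define M where "M = translate (- c) \<mu>"
  have M: "real_distribution M"
    unfolding M_def translate_def by (rule \<mu>.real_distribution_distr) measurable
  interpret M: real_distribution M by fact
  \<comment> \<open>Translating back lets each one-directional transfer lemma be used twice, which
    yields an equivalence.\<close>
  have untranslate: "translate c M = \<mu>"
    unfolding M_def using assms(2) by (simp add: translate_translate translate_0)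
  have G: "cauchy_transform M = (\<lambda>z. cauchy_transform \<mu> (z - complex_of_real (- c)))"
    unfolding M_def using cauchy_transform_translate[OF assms(2)] by blast
  have G': "cauchy_transform \<mu> = (\<lambda>z. cauchy_transform M (z - complex_of_real c))"
    by (simp add: G)
  have "unimodal \<mu> c \<longleftrightarrow> unimodal M 0"
    using unimodal_translate[of \<mu> c "- c"] unimodal_translate[of M 0 c] untranslate by (auto simp: M_def)
  moreover have "scaled_uniform_law \<mu> c \<longleftrightarrow> scaled_uniform_law M 0"
    using scaled_uniform_law_translate[of \<mu> c "- c"] scaled_uniform_law_translate[of M 0 c] untranslate by (auto simp: M_def)
  moreover have "mode_condition (cauchy_transform \<mu>) c \<longleftrightarrow> mode_condition (cauchy_transform M) 0"
    using mode_condition_translate[of "cauchy_transform \<mu>" c "- c"] mode_condition_translate[of "cauchy_transform M" 0 c]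
    unfolding G[symmetric] G'[symmetric] by auto
  moreover have "(\<forall>z\<in>upper_half_plane. Im ((z - complex_of_real c) * deriv (cauchy_transform \<mu>) z) \<ge> 0)
     \<longleftrightarrow> (\<forall>z\<in>upper_half_plane. Im (z * deriv (cauchy_transform M) z) \<ge> 0)"
  proof -
    have D: "deriv (cauchy_transform M) z = deriv (cauchy_transform \<mu>) (z + complex_of_real c)" if "Im z > 0" for z
    proof (rule DERIV_imp_deriv)
      have "Im (z + complex_of_real c) > 0" using that by simp
      from \<mu>.cauchy_transform_DERIV[OF this]
      show "(cauchy_transform M has_field_derivative deriv (cauchy_transform \<mu>) (z + complex_of_real c)) (at z)"
        unfolding G by (simp add: DERIV_shift)
    qed
    have "Im (z * deriv (cauchy_transform M) z) \<ge> 0"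
      if "\<forall>z\<in>upper_half_plane. Im ((z - complex_of_real c) * deriv (cauchy_transform \<mu>) z) \<ge> 0" "Im z > 0" for z
      using that(1)[rule_format, of "z + complex_of_real c"] that(2) by (simp add: D upper_half_plane_def)
    moreover have "Im ((z - complex_of_real c) * deriv (cauchy_transform \<mu>) z) \<ge> 0"
      if "\<forall>z\<in>upper_half_plane. Im (z * deriv (cauchy_transform M) z) \<ge> 0" "Im z > 0" for z
      using that(1)[rule_format, of "z - complex_of_real c"] that(2) by (simp add: D upper_half_plane_def)
    ultimately show ?thesis by (auto simp: upper_half_plane_def)
  qed
  ultimately have "(unimodal \<mu> c \<longleftrightarrow> (\<forall>z\<in>upper_half_plane. Im ((z - complex_of_real c) * deriv (cauchy_transform \<mu>) z) \<ge> 0))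
     \<and> (unimodal \<mu> c \<longleftrightarrow> scaled_uniform_law \<mu> c) \<and> (unimodal \<mu> c \<longleftrightarrow> mode_condition (cauchy_transform \<mu>) c)"
    using equivalences_at_0[OF M] by simp
  then show ?thesis unfolding mode_condition_def .
qed

end
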